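(* For every connected locally finite graph $G$ there is a canonical isomorphism $\check H_1(|G|)\simeq\vec{\mathcal{C}}(G)$ between the first Čech homology group of the Freudenthal compactification $|G|$ of $G$ and the oriented topological cycle space $\vec{\mathcal{C}}(G)$ of $G$.
   Context: Graphs may have multiple edges but no loops (edges joining a vertex to itself). A connected locally finite graph $G$ is viewed as a 1-complex. Write $\mathring{e}$ for an edge $e$ without its endvertices. A ray is a 1-way infinite path in $G$; two rays are equivalent if no finite set of vertices separates them in $G$; the ends of $G$ are the equivalence classes of rays, and $\Omega(G)$ is the set of ends. $|G|$ is the Freudenthal compactification of $G$: its point set is $G\cup\Omega(G)$, and its topology is generated by the open sets of $G$ and the sets $\hat C(S,\omega)$ for all finite vertex sets $S$ and ends $\omega$, where $\hat C(S,\omega)$ is the union of the component $C$ of $G-S$ that contains a tail of every ray in $\omega$, all ends whose rays have tails in $C$, and all open edges between $S$ and $C$. Čech homology: for an open cover $\mathcal{U}$ of a space $X$, the nerve $X_{\mathcal{U}}$ is the simplicial complex whose 0-simplices are the elements of $\mathcal{U}$ and in which $n+1$ elements of $\mathcal{U}$ form an $n$-simplex if and only if they have non-empty intersection. If $\mathcal{U}'$ refines $\mathcal{U}$, choosing for every $U\in\mathcal{U}'$ an element of $\mathcal{U}$ containing it and extending linearly gives a map $X_{\mathcal{U}'}\to X_{\mathcal{U}}$, unique up to homotopy, and hence a well-defined homomorphism $H_n(X_{\mathcal{U}'})\to H_n(X_{\mathcal{U}})$ (integer coefficients). $\check H_n(X)$ is the inverse limit of the groups $H_n(X_{\mathcal{U}})$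 over all open covers $\mathcal{U}$ of $X$ with these homomorphisms. Oriented topological cycle space: the two orientations of an edge $e=uv$ are the triples $(e,u,v)$ and $(e,v,u)$, denoted by $\vec{e},\overleftarrow{e}$ (in some order). $\vec{E}$ is the set of all orientations of edges of $G$. $\vec{\mathcal{E}}(G)$ is the abelian group of all functions $\phi\colon\vec{E}\to\mathbb{Z}$ with $\phi(\overleftarrow{e})=-\phi(\vec{e})$. A family $(\phi_i)_{i\in I}$ in $\vec{\mathcal{E}}(G)$ is thin if for every $\vec{e}$ only finitely many $i$ satisfy $\phi_i(\vec{e})\neq0$; its thin sum is defined pointwise. A path $\sigma\colon[0,1]\to|G|$ traverses $\vec{e}=(e,\sigma(s),\sigma(t))$ if there is a subinterval $[s,t]$ such that $\sigma(s)\ne\sigma(t)$ are the endvertices of $e$ and $\sigma((s,t))=\mathring{e}$. A circle in $|G|$ is a continuous $\alpha\colon[0,1]\to|G|$ with $\alpha(0)=\alpha(1)$ that is injective on $[0,1)$; for circles, traversing is read cyclically (on $[0,1]/(0\sim1)$). The oriented circuit $\phi_\alpha$ maps $\vec{e}$ to $1$ if $\alpha$ traverses $\vec{e}$, to $-1$ if $\alpha$ traverses $\overleftarrow{e}$, and to $0$ otherwise. $\vec{\mathcal{C}}(G)$ is the subgroup of $\vec{\mathcal{E}}(G)$ formed by all thin sums of oriented circuits. The word "canonical" is used informally: no particular map is named in the statement, whose formal content is the existence of a group isomorphism. *)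

theory Defs
  imports "HOL-Analysis.Analysis" "HOL-Algebra.Product_Groups"
begin

section \<open>Graphs, rays and ends\<close>

record ('v, 'e) multigraph =
  verts :: "'v set"
  edges :: "'e set"
  endpts :: "'e \<Rightarrow> 'v set"

definition loopless_multigraph :: "('v, 'e) multigraph \<Rightarrow> bool" where
  "loopless_multigraph G \<longleftrightarrow> (\<forall>e\<in>edges G. endpts G e \<subseteq> verts G \<and> card (endpts G e) = 2)"

definition adj_avoiding :: "('v, 'e) multigraph \<Rightarrow> 'v set \<Rightarrow> ('v \<times> 'v) set" where
  "adj_avoiding G S =
     {(u, v). u \<in> verts G - S \<and> v \<in> verts G - S \<and> (\<exists>e\<in>edges G. endpts G e = {u, v})}"

definition connected_graph :: "('v, 'e) multigraph \<Rightarrow> bool" where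
  "connected_graph G \<longleftrightarrow>
     verts G \<noteq> {} \<and> (\<forall>u\<in>verts G. \<forall>v\<in>verts G. (u, v) \<in> (adj_avoiding G {})\<^sup>*)"

definition locally_finite_graph :: "('v, 'e) multigraph \<Rightarrow> bool" where
  "locally_finite_graph G \<longleftrightarrow> (\<forall>v\<in>verts G. finite {e \<in> edges G. v \<in> endpts G e})"

text \<open>Vertex sets of the components of \<open>G - S\<close>; components are induced subgraphs.\<close>

definition components_minus :: "('v, 'e) multigraph \<Rightarrow> 'v set \<Rightarrow> 'v set set" where
  "components_minus G S = {{w. (u, w) \<in> (adj_avoiding G S)\<^sup>*} | u. u \<in> verts G - S}"

text \<open>As edges may be parallel, a ray records its edges as well as its vertices.\<close>

type_synonym ('v, 'e) ray = "(nat \<Rightarrow> 'v) \<times> (nat \<Rightarrow> 'e)"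

definition rays :: "('v, 'e) multigraph \<Rightarrow> ('v, 'e) ray set" where
  "rays G = {(x, f). inj x \<and> (\<forall>n. f n \<in> edges G \<and> endpts G (f n) = {x n, x (Suc n)})}"

definition separates :: "('v, 'e) multigraph \<Rightarrow> 'v set \<Rightarrow> 'v set \<Rightarrow> 'v set \<Rightarrow> bool" where
  "separates G S A B \<longleftrightarrow> \<not> (\<exists>a\<in>A - S. \<exists>b\<in>B - S. (a, b) \<in> (adj_avoiding G S)\<^sup>*)"

definition ray_equiv :: "('v, 'e) multigraph \<Rightarrow> (('v, 'e) ray \<times> ('v, 'e) ray) set" where
  "ray_equiv G =
     {(R, R'). R \<in> rays G \<and> R' \<in> rays G \<and>
       \<not> (\<exists>S. finite S \<and> S \<subseteq> verts G \<and> separates G S (range (fst R)) (range (fst R')))}"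

definition graph_ends :: "('v, 'e) multigraph \<Rightarrow> ('v, 'e) ray set set" where
  "graph_ends G = rays G // ray_equiv G"

definition tail_in :: "('v, 'e) ray \<Rightarrow> 'v set \<Rightarrow> bool" where
  "tail_in R C \<longleftrightarrow> (\<exists>n. \<forall>m\<ge>n. fst R m \<in> C)"


section \<open>The Freudenthal compactification\<close>

text \<open>
  An inner point of an edge is given by its barycentric coordinates with respect to the
  endvertices of the edge, so that no orientation of the edge has to be chosen.
\<close>

datatype ('v, 'e) point =
    Vertex 'v
  | Inner 'e "'v \<Rightarrow> real"
  | End "('v, 'e) ray set"

text \<open>The point at position \<open>t \<in> [0, 1]\<close> on the edge \<open>e\<close>, traversed from \<open>u\<close> to \<open>v\<close>.\<close>

definition edge_point :: "'e \<Rightarrow> 'v \<Rightarrow> 'v \<Rightarrow> real \<Rightarrow> ('v, 'e) point" where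
  "edge_point e u v t =
     (if t = 0 then Vertex u else if t = 1 then Vertex v
      else Inner e (\<lambda>w. if w = u then 1 - t else if w = v then t else 0))"

definition open_edge :: "('v, 'e) multigraph \<Rightarrow> 'e \<Rightarrow> ('v, 'e) point set" where
  "open_edge G e = {edge_point e u v t | u v t. endpts G e = {u, v} \<and> 0 < t \<and> t < 1}"

definition graph_points :: "('v, 'e) multigraph \<Rightarrow> ('v, 'e) point set" where
  "graph_points G = Vertex ` verts G \<union> (\<Union>e\<in>edges G. open_edge G e)"

text \<open>The open sets of the 1-complex \<open>G\<close> (weak topology with respect to the closed edges).\<close>

definition open_in_graph :: "('v, 'e) multigraph \<Rightarrow> ('v, 'e) point set \<Rightarrow> bool" where
  "open_in_graph G U \<longleftrightarrow>
     U \<subseteq> graph_points G \<and>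
     (\<forall>e\<in>edges G. \<forall>u v. endpts G e = {u, v} \<longrightarrow>
        openin (top_of_set {0..1}) {t \<in> {0..1}. edge_point e u v t \<in> U})"

definition end_component :: "('v, 'e) multigraph \<Rightarrow> 'v set \<Rightarrow> ('v, 'e) ray set \<Rightarrow> 'v set" where
  "end_component G S \<omega> = (THE C. C \<in> components_minus G S \<and> (\<forall>R\<in>\<omega>. tail_in R C))"

definition C_hat :: "('v, 'e) multigraph \<Rightarrow> 'v set \<Rightarrow> ('v, 'e) ray set \<Rightarrow> ('v, 'e) point set" where
  "C_hat G S \<omega> = (let C = end_component G S \<omega> in
       Vertex ` C \<union> (\<Union>e\<in>{e \<in> edges G. endpts G e \<subseteq> C}. open_edge G e)
     \<union> End ` {\<omega>' \<in> graph_ends G. \<forall>R\<in>\<omega>'. tail_in R C}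
     \<union> (\<Union>e\<in>{e \<in> edges G. endpts G e \<inter> S \<noteq> {} \<and> endpts G e \<inter> C \<noteq> {}}. open_edge G e))"

definition freudenthal :: "('v, 'e) multigraph \<Rightarrow> ('v, 'e) point topology" where
  "freudenthal G = topology_generated_by
     ({U. open_in_graph G U} \<union> {C_hat G S \<omega> | S \<omega>. finite S \<and> S \<subseteq> verts G \<and> \<omega> \<in> graph_ends G})"


section \<open>Simplicial homology with integer coefficients\<close>

text \<open>
  A simplicial complex is given by the set of its (non-empty, finite) simplices.  An
  \<open>n\<close>-chain is a finitely supported integer function on oriented \<open>n\<close>-simplices that changes
  sign when the orientation is reversed.  It is written as an alternating function on the lists
  \<open>[v\<^sub>0, \<dots>, v\<^sub>n]\<close> whose entries span a simplex.  The last condition below makes it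
  alternating, and in particular forces the value 0 on lists with a repeated entry.
\<close>

definition simplicial_chains :: "nat \<Rightarrow> 'a set set \<Rightarrow> ('a list \<Rightarrow> int) set" where
  "simplicial_chains n K =
     {c. finite {xs. c xs \<noteq> 0} \<and>
         (\<forall>xs. c xs \<noteq> 0 \<longrightarrow> length xs = Suc n \<and> set xs \<in> K) \<and>
         (\<forall>xs a b ys. c (xs @ a # b # ys) = - c (xs @ b # a # ys))}"

text \<open>
  In terms of coefficients, \<open>\<partial>[v\<^sub>0, \<dots>, v\<^sub>n] = \<Sum>\<^sub>i (-1)\<^sup>i [v\<^sub>0, \<dots>, v\<^sub>i\<^sub>-\<^sub>1, v\<^sub>i\<^sub>+\<^sub>1, \<dots>, v\<^sub>n]\<close> says that the
  coefficient of \<open>\<partial>c\<close> at an oriented simplex \<open>xs\<close> is the sum of the coefficients of \<open>c\<close> at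
  \<open>v # xs\<close> over all \<open>v\<close>.  The boundary of a 0-chain is 0.
\<close>

definition simplicial_boundary :: "('a list \<Rightarrow> int) \<Rightarrow> 'a list \<Rightarrow> int" where
  "simplicial_boundary c xs = (if xs = [] then 0 else \<Sum>v | c (v # xs) \<noteq> 0. c (v # xs))"

definition simplicial_cycle_group :: "nat \<Rightarrow> 'a set set \<Rightarrow> ('a list \<Rightarrow> int) monoid" where
  "simplicial_cycle_group n K =
     \<lparr>carrier = {c \<in> simplicial_chains n K. simplicial_boundary c = (\<lambda>_. 0)},
      monoid.mult = (\<lambda>c d xs. c xs + d xs), one = (\<lambda>_. 0)\<rparr>"

definition simplicial_boundaries :: "nat \<Rightarrow> 'a set set \<Rightarrow> ('a list \<Rightarrow> int) set" where
  "simplicial_boundaries n K = simplicial_boundary ` simplicial_chains (Suc n) K"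

definition simplicial_homology :: "nat \<Rightarrow> 'a set set \<Rightarrow> ('a list \<Rightarrow> int) set monoid" where
  "simplicial_homology n K = simplicial_cycle_group n K Mod simplicial_boundaries n K"

text \<open>
  The linear extension of \<open>[v\<^sub>0, \<dots>, v\<^sub>n] \<mapsto> [f v\<^sub>0, \<dots>, f v\<^sub>n]\<close>.  Simplices that \<open>f\<close> collapses
  contribute 0, because the values of an alternating \<open>c\<close> cancel in the sum.
\<close>

definition simplicial_chain_map :: "('a \<Rightarrow> 'b) \<Rightarrow> ('a list \<Rightarrow> int) \<Rightarrow> 'b list \<Rightarrow> int" where
  "simplicial_chain_map f c ys = (\<Sum>xs | c xs \<noteq> 0 \<and> map f xs = ys. c xs)"

text \<open>
  The homomorphism into \<open>H\<^sub>n(L)\<close> induced by a simplicial map \<open>f\<close> sends the class of a cycle \<open>z\<close>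
  to the coset of \<open>f\<^sub># z\<close>.  Without choosing \<open>z\<close>, this coset is the sum of the boundaries of
  \<open>L\<close> and the image of the class.
\<close>

definition simplicial_hom_induced ::
    "nat \<Rightarrow> 'b set set \<Rightarrow> ('a \<Rightarrow> 'b) \<Rightarrow> ('a list \<Rightarrow> int) set \<Rightarrow> ('b list \<Rightarrow> int) set" where
  "simplicial_hom_induced n L f A =
     simplicial_boundaries n L <#>\<^bsub>simplicial_cycle_group n L\<^esub> (simplicial_chain_map f ` A)"


text \<open>The boundaries form a subgroup of the cycle group, so the quotient is a group.\<close>

lemma simplicial_boundary_eq_sum:
  assumes "finite V" "\<And>v. c (v # xs) \<noteq> 0 \<Longrightarrow> v \<in> V" "xs \<noteq> []"
  shows "simplicial_boundary c xs = (\<Sum>v\<in>V. c (v # xs))"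
  unfolding simplicial_boundary_def using assms by (auto intro!: sum.mono_neutral_left)

lemma simplicial_chainsD:
  assumes "c \<in> simplicial_chains n K"
  shows "finite {xs. c xs \<noteq> 0}"
    and "c xs \<noteq> 0 \<Longrightarrow> length xs = Suc n \<and> set xs \<in> K"
    and "c (xs @ a # b # ys) = - c (xs @ b # a # ys)"
  using assms unfolding simplicial_chains_def by blast+

lemma simplicial_chain_vertices:
  assumes "c \<in> simplicial_chains n K"
  obtains V where "finite V" "\<And>xs. c xs \<noteq> 0 \<Longrightarrow> set xs \<subseteq> V"
proof
  show "finite (\<Union>xs\<in>{xs. c xs \<noteq> 0}. set xs)"
    using simplicial_chainsD(1)[OF assms] by auto
qed auto

lemma simplicial_boundary_boundary:
  assumes c: "c \<in> simplicial_chains n K"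
  shows "simplicial_boundary (simplicial_boundary c) = (\<lambda>_. 0)"
proof
  fix xs :: "'a list"
  obtain V where V: "finite V" "\<And>xs. c xs \<noteq> 0 \<Longrightarrow> set xs \<subseteq> V"
    by (rule simplicial_chain_vertices[OF c]) blast
  have 1: "simplicial_boundary c ys = (\<Sum>v\<in>V. c (v # ys))" if "ys \<noteq> []" for ys
    using V that by (intro simplicial_boundary_eq_sum) fastforce+
  have swap: "c (v # w # xs) = - c (w # v # xs)" for v w
    using simplicial_chainsD(3)[OF c, of "[]" v w xs] by simp
  show "simplicial_boundary (simplicial_boundary c) xs = 0"
  proof (cases "xs = []")
    case False
    have out: "simplicial_boundary c (w # xs) = 0" if "w \<notin> V" for w
    proof -
      have "c (v # w # xs) = 0" for v using V(2)[of "v # w # xs"] that by auto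
      then show ?thesis by (simp add: 1)
    qed
    have "simplicial_boundary (simplicial_boundary c) xs = (\<Sum>w\<in>V. \<Sum>v\<in>V. c (v # w # xs))"
      using V(1) out False by (subst simplicial_boundary_eq_sum[of V]) (auto simp: 1)
    also have "\<dots> = - (\<Sum>w\<in>V. \<Sum>v\<in>V. c (w # v # xs))"
      by (simp only: sum_negf[symmetric] swap[symmetric])
    also have "(\<Sum>w\<in>V. \<Sum>v\<in>V. c (w # v # xs)) = (\<Sum>w\<in>V. \<Sum>v\<in>V. c (v # w # xs))"
      by (rule sum.swap)
    finally show ?thesis
      using \<open>simplicial_boundary (simplicial_boundary c) xs = (\<Sum>w\<in>V. \<Sum>v\<in>V. c (v # w # xs))\<close>
      by linarith
  qed (simp add: simplicial_boundary_def)
qed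

lemma simplicial_chains_add:
  assumes "c \<in> simplicial_chains n K" "d \<in> simplicial_chains n K"
  shows "(\<lambda>xs. c xs + d xs) \<in> simplicial_chains n K"
proof -
  have "{xs. c xs + d xs \<noteq> 0} \<subseteq> {xs. c xs \<noteq> 0} \<union> {xs. d xs \<noteq> 0}" by auto
  then have "finite {xs. c xs + d xs \<noteq> 0}"
    by (rule finite_subset) (use assms in \<open>simp add: simplicial_chainsD(1)\<close>)
  moreover have "length xs = Suc n \<and> set xs \<in> K" if "c xs + d xs \<noteq> 0" for xs
    using that assms[THEN simplicial_chainsD(2), of xs] by (cases "c xs = 0") auto
  moreover have "c (xs @ a # b # ys) + d (xs @ a # b # ys) = - (c (xs @ b # a # ys) + d (xs @ b # a # ys))" for xs a b ys
  proof -
    have "c (xs @ a # b # ys) = - c (xs @ b # a # ys)" "d (xs @ a # b # ys) = - d (xs @ b # a # ys)"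
      using assms[THEN simplicial_chainsD(3)] by blast+
    then show ?thesis by linarith
  qed
  ultimately show ?thesis unfolding simplicial_chains_def by blast
qed

lemma simplicial_chains_uminus:
  assumes "c \<in> simplicial_chains n K"
  shows "(\<lambda>xs. - c xs) \<in> simplicial_chains n K"
  unfolding simplicial_chains_def
proof (intro CollectI conjI allI impI)
  show "finite {xs. - c xs \<noteq> 0}" using simplicial_chainsD(1)[OF assms] by simp
  show "length xs = Suc n" "set xs \<in> K" if "- c xs \<noteq> 0" for xs
    using simplicial_chainsD(2)[OF assms, of xs] that by auto
  show "- c (xs @ a # b # ys) = - (- c (xs @ b # a # ys))" for xs a b ys
    using simplicial_chainsD(3)[OF assms, of xs a b ys] by linarith
qed

lemma simplicial_boundary_add:
  assumes c: "c \<in> simplicial_chains n K" and d: "d \<in> simplicial_chains n K"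
  shows "simplicial_boundary (\<lambda>xs. c xs + d xs) = (\<lambda>xs. simplicial_boundary c xs + simplicial_boundary d xs)"
proof
  fix xs :: "'a list"
  obtain V where V: "finite V" "\<And>xs. c xs \<noteq> 0 \<Longrightarrow> set xs \<subseteq> V"
    by (rule simplicial_chain_vertices[OF c]) blast
  obtain W where W: "finite W" "\<And>xs. d xs \<noteq> 0 \<Longrightarrow> set xs \<subseteq> W"
    by (rule simplicial_chain_vertices[OF d]) blast
  show "simplicial_boundary (\<lambda>xs. c xs + d xs) xs = simplicial_boundary c xs + simplicial_boundary d xs"
  proof (cases "xs = []")
    case False
    have "v \<in> V \<union> W" if "c (v # xs) + d (v # xs) \<noteq> 0" for v
      using V(2)[of "v#xs"] W(2)[of "v#xs"] that by (cases "c (v#xs) = 0") auto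
    then have "simplicial_boundary (\<lambda>xs. c xs + d xs) xs = (\<Sum>v\<in>V \<union> W. c (v # xs) + d (v # xs))"
      using False V(1) W(1) by (intro simplicial_boundary_eq_sum) auto
    moreover have "simplicial_boundary c xs = (\<Sum>v\<in>V \<union> W. c (v # xs))"
      using False V W by (intro simplicial_boundary_eq_sum) fastforce+
    moreover have "simplicial_boundary d xs = (\<Sum>v\<in>V \<union> W. d (v # xs))"
      using False V W by (intro simplicial_boundary_eq_sum) fastforce+
    ultimately show ?thesis by (simp add: sum.distrib)
  qed (simp add: simplicial_boundary_def)
qed

lemma simplicial_boundary_uminus:
  "simplicial_boundary (\<lambda>xs. - c xs) = (\<lambda>xs. - simplicial_boundary c xs)"
  by (auto simp: simplicial_boundary_def sum_negf)


lemma comm_group_simplicial_cycle_group: "comm_group (simplicial_cycle_group n K)"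
proof (rule comm_groupI)
  show "\<one>\<^bsub>simplicial_cycle_group n K\<^esub> \<in> carrier (simplicial_cycle_group n K)"
    by (auto simp: simplicial_cycle_group_def simplicial_chains_def simplicial_boundary_def)
  show "\<exists>y\<in>carrier (simplicial_cycle_group n K). y \<otimes>\<^bsub>simplicial_cycle_group n K\<^esub> x = \<one>\<^bsub>simplicial_cycle_group n K\<^esub>"
    if "x \<in> carrier (simplicial_cycle_group n K)" for x
    using that by (intro bexI[of _ "\<lambda>xs. - x xs"])
      (auto simp: simplicial_cycle_group_def simplicial_chains_uminus simplicial_boundary_uminus)
qed (auto simp: simplicial_cycle_group_def simplicial_chains_add simplicial_boundary_add algebra_simps)

lemma simplicial_boundary_in_chains:
  assumes c: "c \<in> simplicial_chains (Suc n) K" and K: "\<And>\<sigma> \<tau>. \<sigma> \<in> K \<Longrightarrow> \<tau> \<subseteq> \<sigma> \<Longrightarrow> \<tau> \<noteq> {} \<Longrightarrow> \<tau> \<in> K"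
  shows "simplicial_boundary c \<in> simplicial_chains n K"
proof -
  have alt: "c (xs @ a # b # ys) = - c (xs @ b # a # ys)" for xs a b ys
    using c unfolding simplicial_chains_def by blast
  have nz: "\<exists>v. c (v # xs) \<noteq> 0" "xs \<noteq> []" if "simplicial_boundary c xs \<noteq> 0" for xs
    using that unfolding simplicial_boundary_def by (auto split: if_splits elim: sum.not_neutral_contains_not_neutral)
  have "{xs. simplicial_boundary c xs \<noteq> 0} \<subseteq> tl ` {xs. c xs \<noteq> 0}"
    using nz by (force simp: image_iff)
  then have "finite {xs. simplicial_boundary c xs \<noteq> 0}"
    by (rule finite_subset) (use c in \<open>simp add: simplicial_chainsD(1)\<close>)
  moreover have "length xs = Suc n \<and> set xs \<in> K" if nzx: "simplicial_boundary c xs \<noteq> 0" for xs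
  proof -
    obtain v where v: "c (v # xs) \<noteq> 0" using nz(1) nzx by blast
    then have "length (v # xs) = Suc (Suc n)" "set (v # xs) \<in> K"
      using c unfolding simplicial_chains_def by blast+
    then show ?thesis using K[of "set (v # xs)" "set xs"] nz(2)[OF nzx] by auto
  qed
  moreover have "simplicial_boundary c (xs @ a # b # ys) = - simplicial_boundary c (xs @ b # a # ys)" for xs a b ys
  proof -
    have "c (v # xs @ a # b # ys) = - c (v # xs @ b # a # ys)" for v
      using alt[of "v # xs" a b ys] by simp
    then show ?thesis unfolding simplicial_boundary_def by (simp add: sum_negf)
  qed
  ultimately show ?thesis unfolding simplicial_chains_def by blast
qed

lemma subgroup_simplicial_boundaries:
  assumes K: "\<And>\<sigma> \<tau>. \<sigma> \<in> K \<Longrightarrow> \<tau> \<subseteq> \<sigma> \<Longrightarrow> \<tau> \<noteq> {} \<Longrightarrow> \<tau> \<in> K"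
  shows "subgroup (simplicial_boundaries n K) (simplicial_cycle_group n K)"
proof -
  interpret comm_group "simplicial_cycle_group n K" by (rule comm_group_simplicial_cycle_group)
  have inv: "inv\<^bsub>simplicial_cycle_group n K\<^esub> x = (\<lambda>xs. - x xs)" if "x \<in> carrier (simplicial_cycle_group n K)" for x
    using that by (intro inv_equality)
      (auto simp: simplicial_cycle_group_def simplicial_chains_uminus simplicial_boundary_uminus)
  have sub: "simplicial_boundaries n K \<subseteq> carrier (simplicial_cycle_group n K)"
    using simplicial_boundary_in_chains[OF _ K] simplicial_boundary_boundary
    by (auto simp: simplicial_boundaries_def simplicial_cycle_group_def)
  show ?thesis
  proof (rule subgroupI)
    show "simplicial_boundaries n K \<noteq> {}"
    proof -
      have "(\<lambda>_. 0) \<in> simplicial_chains (Suc n) K" by (simp add: simplicial_chains_def)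
      then show ?thesis by (auto simp: simplicial_boundaries_def)
    qed
    show "inv\<^bsub>simplicial_cycle_group n K\<^esub> a \<in> simplicial_boundaries n K" if a: "a \<in> simplicial_boundaries n K" for a
    proof -
      obtain c where c: "c \<in> simplicial_chains (Suc n) K" "a = simplicial_boundary c"
        using a by (auto simp: simplicial_boundaries_def)
      have "simplicial_boundary (\<lambda>xs. - c xs) \<in> simplicial_boundaries n K"
        unfolding simplicial_boundaries_def by (intro imageI simplicial_chains_uminus c(1))
      then show ?thesis
        unfolding inv[OF subsetD[OF sub a]] by (simp only: c(2) simplicial_boundary_uminus)
    qed
    show "a \<otimes>\<^bsub>simplicial_cycle_group n K\<^esub> b \<in> simplicial_boundaries n K"
      if a: "a \<in> simplicial_boundaries n K" and b: "b \<in> simplicial_boundaries n K" for a b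
    proof -
      obtain c d where cd: "c \<in> simplicial_chains (Suc n) K" "a = simplicial_boundary c"
          "d \<in> simplicial_chains (Suc n) K" "b = simplicial_boundary d"
        using a b unfolding simplicial_boundaries_def by blast
      then have "a \<otimes>\<^bsub>simplicial_cycle_group n K\<^esub> b = simplicial_boundary (\<lambda>xs. c xs + d xs)"
        by (simp add: simplicial_boundary_add simplicial_cycle_group_def)
      then show ?thesis using simplicial_chains_add[OF cd(1,3)] by (auto simp: simplicial_boundaries_def)
    qed
  qed (rule sub)
qed

lemma comm_group_simplicial_homology:
  assumes "\<And>\<sigma> \<tau>. \<sigma> \<in> K \<Longrightarrow> \<tau> \<subseteq> \<sigma> \<Longrightarrow> \<tau> \<noteq> {} \<Longrightarrow> \<tau> \<in> K"
  shows "comm_group (simplicial_homology n K)"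
proof -
  interpret comm_group "simplicial_cycle_group n K" by (rule comm_group_simplicial_cycle_group)
  show ?thesis unfolding simplicial_homology_def
    by (rule abelian_FactGroup[OF subgroup_simplicial_boundaries[OF assms]])
qed


section \<open>Cech homology\<close>

definition open_covers :: "'a topology \<Rightarrow> 'a set set set" where
  "open_covers X = {\<U>. (\<forall>U\<in>\<U>. openin X U) \<and> \<Union>\<U> = topspace X}"

definition nerve :: "'a set set \<Rightarrow> 'a set set set" where
  "nerve \<U> = {\<sigma>. finite \<sigma> \<and> \<sigma> \<noteq> {} \<and> \<sigma> \<subseteq> \<U> \<and> \<Inter>\<sigma> \<noteq> {}}"

lemma comm_group_simplicial_homology_nerve: "comm_group (simplicial_homology n (nerve \<U>))"
proof (rule comm_group_simplicial_homology)
  fix \<sigma> \<tau> assume "\<sigma> \<in> nerve \<U>" "\<tau> \<subseteq> \<sigma>" "\<tau> \<noteq> {}"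
  moreover from this have "finite \<tau>" "\<Inter>\<sigma> \<subseteq> \<Inter>\<tau>"
    by (auto simp: nerve_def intro: finite_subset)
  ultimately show "\<tau> \<in> nerve \<U>"
    unfolding nerve_def by blast
qed

definition refinement_projection :: "'a set set \<Rightarrow> 'a set set \<Rightarrow> ('a set \<Rightarrow> 'a set) \<Rightarrow> bool" where
  "refinement_projection \<U>' \<U> p \<longleftrightarrow> (\<forall>U\<in>\<U>'. p U \<in> \<U> \<and> U \<subseteq> p U)"

text \<open>
  The inverse limit over all open covers.  A projection \<open>p\<close> exists if and only if \<open>\<U>'\<close> refines
  \<open>\<U>\<close>, and all projections induce the same homomorphism.
\<close>

definition cech_homology ::
    "nat \<Rightarrow> 'a topology \<Rightarrow> ('a set set \<Rightarrow> ('a set list \<Rightarrow> int) set) monoid" where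
  "cech_homology n X =
     (let P = product_group (open_covers X) (\<lambda>\<U>. simplicial_homology n (nerve \<U>)) in
      P \<lparr>carrier := {x \<in> carrier P.
           \<forall>\<U>\<in>open_covers X. \<forall>\<U>'\<in>open_covers X. \<forall>p. refinement_projection \<U>' \<U> p \<longrightarrow>
             simplicial_hom_induced n (nerve \<U>) p (x \<U>') = x \<U>}\<rparr>)"


section \<open>The oriented topological cycle space\<close>

definition oriented_edges :: "('v, 'e) multigraph \<Rightarrow> ('e \<times> 'v \<times> 'v) set" where
  "oriented_edges G = {(e, u, v). e \<in> edges G \<and> endpts G e = {u, v}}"

fun reverse_edge :: "'e \<times> 'v \<times> 'v \<Rightarrow> 'e \<times> 'v \<times> 'v" where
  "reverse_edge (e, u, v) = (e, v, u)"

text \<open>Functions on the oriented edges are represented by their extensions by 0.\<close>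

definition oriented_edge_space :: "('v, 'e) multigraph \<Rightarrow> ('e \<times> 'v \<times> 'v \<Rightarrow> int) monoid" where
  "oriented_edge_space G =
     \<lparr>carrier = {\<phi>. (\<forall>a\<in>oriented_edges G. \<phi> (reverse_edge a) = - \<phi> a) \<and>
                    (\<forall>a. a \<notin> oriented_edges G \<longrightarrow> \<phi> a = 0)},
      monoid.mult = (\<lambda>\<phi> \<psi> a. \<phi> a + \<psi> a), one = (\<lambda>_. 0)\<rparr>"

definition thin_family ::
    "('v, 'e) multigraph \<Rightarrow> 'i set \<Rightarrow> ('i \<Rightarrow> 'e \<times> 'v \<times> 'v \<Rightarrow> int) \<Rightarrow> bool" where
  "thin_family G I \<phi> \<longleftrightarrow> (\<forall>a\<in>oriented_edges G. finite {i \<in> I. \<phi> i a \<noteq> 0})"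

definition thin_sum :: "'i set \<Rightarrow> ('i \<Rightarrow> 'e \<times> 'v \<times> 'v \<Rightarrow> int) \<Rightarrow> 'e \<times> 'v \<times> 'v \<Rightarrow> int" where
  "thin_sum I \<phi> a = (\<Sum>i\<in>{i \<in> I. \<phi> i a \<noteq> 0}. \<phi> i a)"

definition circle :: "('v, 'e) multigraph \<Rightarrow> (real \<Rightarrow> ('v, 'e) point) \<Rightarrow> bool" where
  "circle G \<alpha> \<longleftrightarrow> pathin (freudenthal G) \<alpha> \<and> \<alpha> 0 = \<alpha> 1 \<and> inj_on \<alpha> {0..<1}"

text \<open>
  Cyclic traversal: intervals of the circle \<open>[0, 1]/(0 \<sim> 1)\<close> are the images of real intervals
  of length at most 1 under \<open>frac\<close>.
\<close>

fun traverses ::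
    "('v, 'e) multigraph \<Rightarrow> (real \<Rightarrow> ('v, 'e) point) \<Rightarrow> 'e \<times> 'v \<times> 'v \<Rightarrow> bool" where
  "traverses G \<alpha> (e, u, v) \<longleftrightarrow>
     (e, u, v) \<in> oriented_edges G \<and>
     (\<exists>s t. s < t \<and> t \<le> s + 1 \<and> \<alpha> (frac s) = Vertex u \<and> \<alpha> (frac t) = Vertex v \<and>
            (\<lambda>x. \<alpha> (frac x)) ` {s<..<t} = open_edge G e)"

definition oriented_circuit ::
    "('v, 'e) multigraph \<Rightarrow> (real \<Rightarrow> ('v, 'e) point) \<Rightarrow> 'e \<times> 'v \<times> 'v \<Rightarrow> int" where
  "oriented_circuit G \<alpha> a =
     (if traverses G \<alpha> a then 1 else if traverses G \<alpha> (reverse_edge a) then - 1 else 0)"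

definition oriented_circuits :: "('v, 'e) multigraph \<Rightarrow> ('e \<times> 'v \<times> 'v \<Rightarrow> int) set" where
  "oriented_circuits G = {oriented_circuit G \<alpha> | \<alpha>. circle G \<alpha>}"

text \<open>
  Index sets of natural numbers suffice for thin families of oriented circuits, because \<open>G\<close>
  has only countably many edges: see \<open>thin_sum_in_oriented_cycle_space\<close> below.
\<close>

definition oriented_cycle_space :: "('v, 'e) multigraph \<Rightarrow> ('e \<times> 'v \<times> 'v \<Rightarrow> int) monoid" where
  "oriented_cycle_space G =
     (oriented_edge_space G) \<lparr>carrier :=
        {thin_sum I \<phi> | (I :: nat set) \<phi>. \<phi> ` I \<subseteq> oriented_circuits G \<and> thin_family G I \<phi>}\<rparr>"

lemma countable_oriented_edges:
  assumes lm: "loopless_multigraph G" and con: "connected_graph G" and lf: "locally_finite_graph G"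
  shows "countable (oriented_edges G)"
proof -
  have fin_nb: "countable (adj_avoiding G {} `` {u})" for u
  proof (cases "u \<in> verts G")
    case True
    let ?E = "{e \<in> edges G. u \<in> endpts G e}"
    have "finite (\<Union>e\<in>?E. endpts G e)"
    proof (rule finite_UN_I)
      show "finite ?E" using lf True by (auto simp: locally_finite_graph_def)
      show "finite (endpts G e)" if "e \<in> ?E" for e
        using lm that by (auto simp: loopless_multigraph_def intro: card_ge_0_finite)
    qed
    moreover have "adj_avoiding G {} `` {u} \<subseteq> (\<Union>e\<in>?E. endpts G e)"
      by (fastforce simp: adj_avoiding_def)
    ultimately show ?thesis by (meson countable_finite finite_subset)
  qed (auto simp: adj_avoiding_def)
  have step: "countable (adj_avoiding G {} `` Y)" if "countable Y" for Y
  proof -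
    have "adj_avoiding G {} `` Y = (\<Union>u\<in>Y. adj_avoiding G {} `` {u})" by auto
    then show ?thesis using that fin_nb by auto
  qed
  obtain r where r: "r \<in> verts G" using con by (auto simp: connected_graph_def)
  have "verts G \<subseteq> (adj_avoiding G {})\<^sup>* `` {r}"
    using con r by (auto simp: connected_graph_def)
  moreover have "countable ((adj_avoiding G {})\<^sup>* `` {r})"
    by (rule countable_rtrancl) (auto intro: step)
  ultimately have cv: "countable (verts G)" by (rule countable_subset)
  have "edges G \<subseteq> (\<Union>v\<in>verts G. {e \<in> edges G. v \<in> endpts G e})"
  proof
    fix e assume e: "e \<in> edges G"
    then have "endpts G e \<noteq> {}" "endpts G e \<subseteq> verts G"
      using lm by (auto simp: loopless_multigraph_def)
    then show "e \<in> (\<Union>v\<in>verts G. {e \<in> edges G. v \<in> endpts G e})" using e by auto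
  qed
  moreover have "countable (\<Union>v\<in>verts G. {e \<in> edges G. v \<in> endpts G e})"
    using cv lf by (auto simp: locally_finite_graph_def intro: countable_finite)
  ultimately have "countable (edges G)" by (rule countable_subset)
  moreover have "oriented_edges G \<subseteq> edges G \<times> verts G \<times> verts G"
    using lm by (fastforce simp: oriented_edges_def loopless_multigraph_def)
  ultimately show ?thesis using cv by (meson countable_SIGMA countable_subset)
qed

lemma oriented_circuit_outside:
  assumes "a \<notin> oriented_edges G"
  shows "oriented_circuit G \<alpha> a = 0"
  using assms by (cases a) (auto simp: oriented_circuit_def oriented_edges_def insert_commute)

lemma thin_sum_in_oriented_cycle_space:
  fixes I :: "'i set" and G :: "('v, 'e) multigraph"
  assumes "loopless_multigraph G" "connected_graph G" "locally_finite_graph G"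
    and circ: "\<phi> ` I \<subseteq> oriented_circuits G" and thin: "thin_family G I \<phi>"
  shows "thin_sum I \<phi> \<in> carrier (oriented_cycle_space G)"
proof -
  define J where "J = (\<Union>a\<in>oriented_edges G. {i \<in> I. \<phi> i a \<noteq> 0})"
  have cJ: "countable J"
    unfolding J_def using thin countable_oriented_edges[OF assms(1-3)]
    by (intro countable_UN) (auto simp: thin_family_def intro: countable_finite)
  define K where "K = to_nat_on J ` J"
  define \<psi> where "\<psi> = \<phi> \<circ> from_nat_into J"
  have inj: "inj_on (to_nat_on J) J" using cJ by (rule inj_on_to_nat_on)
  have \<psi>: "\<psi> (to_nat_on J i) = \<phi> i" if "i \<in> J" for i
    using that cJ by (simp add: \<psi>_def)
  have zero: "\<phi> i a = 0" if "i \<in> I" "a \<notin> oriented_edges G" for i a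
    using circ that oriented_circuit_outside by (fastforce simp: oriented_circuits_def)
  have sub: "{i \<in> I. \<phi> i a \<noteq> 0} \<subseteq> J" for a
    using zero unfolding J_def by blast
  have K_eq: "{k \<in> K. \<psi> k a \<noteq> 0} = to_nat_on J ` {i \<in> I. \<phi> i a \<noteq> 0}" for a
  proof -
    have "{i \<in> I. \<phi> i a \<noteq> 0} = {i \<in> J. \<phi> i a \<noteq> 0}"
      using sub[of a] by (auto simp: J_def)
    then show ?thesis using \<psi> by (auto simp: K_def)
  qed
  have "thin_sum K \<psi> = thin_sum I \<phi>"
  proof
    fix a
    have "thin_sum K \<psi> a = (\<Sum>k\<in>to_nat_on J ` {i \<in> I. \<phi> i a \<noteq> 0}. \<psi> k a)"
      by (simp only: thin_sum_def K_eq)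
    also have "\<dots> = (\<Sum>i\<in>{i \<in> I. \<phi> i a \<noteq> 0}. \<psi> (to_nat_on J i) a)"
      using inj_on_subset[OF inj sub] by (simp add: sum.reindex)
    also have "\<dots> = thin_sum I \<phi> a"
      unfolding thin_sum_def using sub[of a] \<psi> by (intro sum.cong) auto
    finally show "thin_sum K \<psi> a = thin_sum I \<phi> a" .
  qed
  moreover have "thin_family G K \<psi>"
    using thin by (simp add: thin_family_def K_eq)
  moreover have "\<psi> ` K \<subseteq> oriented_circuits G"
    using circ \<psi> by (auto simp: K_def J_def)
  ultimately show ?thesis
    unfolding oriented_cycle_space_def by (auto intro!: exI[of _ K] exI[of _ \<psi>])
qed

end

theory Submission
  imports Defs
begin

text \<open>
  Both groups are identified with the group of integral flows: the edge functions whose net value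
  vanishes on the boundary of every component of \<open>G - F\<close>, for every finite edge set \<open>F\<close>.

  For the Cech side, a finite edge set \<open>F\<close> and a number \<open>M\<close> give an open cover by the components of
  \<open>G - F\<close> (with their ends and initial segments of the edges in \<open>F\<close>) and by \<open>M - 1\<close> overlapping
  segments of each edge in \<open>F\<close>.  Its nerve is a graph, obtained from \<open>G\<close> by contracting the components
  of \<open>G - F\<close> and subdividing the edges in \<open>F\<close>, so that its first homology group consists of flows
  on \<open>F\<close>.  A Koenig argument shows that these covers are cofinal: an infinite descending sequence of
  components that do not fit into the given cover contains a vertex or a ray, and thus converges to
  a vertex or to an end.

  For the cycle space, a circle is balanced on every finite cut, because the height
  function of the cut, composed with the circle, changes only along the traversed cut edges.
  Conversely, the edges are enumerated and a flow is killed on one edge after the other by subtracting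
  multiples of finite circuits that avoid the earlier edges; these circuits form a thin family.
\<close>

section \<open>Components after deleting finitely many edges\<close>

text \<open>The choice behind all constructions is to delete edges instead of vertices: the
  components of \<open>G - F\<close> partition all of \<open>V\<close>, there are finitely many of
  them, and every end lies in exactly one. The covers, the balance condition and the neighbourhoods
  of ends thus refer to the same sets.

  A nerve of dimension one has no nonzero 1-boundaries, so each homology class of such a cover is a
  single cycle, and an element of the limit assigns a definite integer to every edge. A finer mesh
  does not change these integers, so any two of the covers can be compared on a common refinement.
  The nerve of an arbitrary cover may be complicated, but it enters only through projections from
  such covers, and two projections differ by a boundary on a flow.

  On the cycle side, a circle may run through infinitely many edges and ends, so that its edges have
  no first or next one and its crossings of a cut cannot be counted in order. A continuous
  integer-valued function takes the place of the count. In the other direction finite circuits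
  suffice because infinitely many of them may be summed.\<close>

definition edge_adj :: "('v, 'e) multigraph \<Rightarrow> 'e set \<Rightarrow> ('v \<times> 'v) set" where
  "edge_adj G F = {(u, v). \<exists>e\<in>edges G - F. endpts G e = {u, v}}"

definition comp_of :: "('v, 'e) multigraph \<Rightarrow> 'e set \<Rightarrow> 'v \<Rightarrow> 'v set" where
  "comp_of G F u = (edge_adj G F)\<^sup>* `` {u}"

definition comps :: "('v, 'e) multigraph \<Rightarrow> 'e set \<Rightarrow> 'v set set" where
  "comps G F = comp_of G F ` verts G"

definition star_edges :: "('v, 'e) multigraph \<Rightarrow> 'v set \<Rightarrow> 'e set" where
  "star_edges G S = {e \<in> edges G. endpts G e \<inter> S \<noteq> {}}"

lemma edge_adj_sym: "(u, v) \<in> edge_adj G F \<Longrightarrow> (v, u) \<in> edge_adj G F"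
  by (auto simp: edge_adj_def insert_commute)

lemma edge_adj_rtrancl_sym: "(u, v) \<in> (edge_adj G F)\<^sup>* \<Longrightarrow> (v, u) \<in> (edge_adj G F)\<^sup>*"
  by (meson edge_adj_sym symI sym_rtrancl symD)

lemma comp_of_self [simp]: "u \<in> comp_of G F u"
  by (simp add: comp_of_def)

lemma comp_of_eqI: "v \<in> comp_of G F u \<Longrightarrow> comp_of G F v = comp_of G F u"
  unfolding comp_of_def set_eq_iff Image_singleton_iff
  by (blast intro: rtrancl_trans dest: edge_adj_rtrancl_sym)

lemma comps_mem_eq: "K \<in> comps G F \<Longrightarrow> v \<in> K \<Longrightarrow> K = comp_of G F v"
  using comp_of_eqI by (fastforce simp: comps_def)

lemma comps_eqI: "K \<in> comps G F \<Longrightarrow> K' \<in> comps G F \<Longrightarrow> v \<in> K \<Longrightarrow> v \<in> K' \<Longrightarrow> K = K'"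
  by (metis comps_mem_eq)

lemma comp_of_in_comps: "u \<in> verts G \<Longrightarrow> comp_of G F u \<in> comps G F"
  by (simp add: comps_def)

lemma edge_adj_antimono: "F \<subseteq> F' \<Longrightarrow> edge_adj G F' \<subseteq> edge_adj G F"
  by (auto simp: edge_adj_def)

lemma comp_of_antimono: "F \<subseteq> F' \<Longrightarrow> comp_of G F' u \<subseteq> comp_of G F u"
  unfolding comp_of_def using rtrancl_mono[OF edge_adj_antimono[of F F' G]] by blast

lemma comps_edge:
  assumes "K \<in> comps G F" "e \<in> edges G - F" "endpts G e = {u, v}" "u \<in> K"
  shows "v \<in> K"
proof -
  have "(u, v) \<in> edge_adj G F" using assms by (auto simp: edge_adj_def)
  then have "v \<in> comp_of G F u" by (auto simp: comp_of_def)
  then show ?thesis using assms comps_mem_eq by metis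
qed

lemma comps_nonempty: "K \<in> comps G F \<Longrightarrow> K \<noteq> {}"
  by (auto simp: comps_def intro: comp_of_self)

locale lf_graph =
  fixes G :: "('v, 'e) multigraph"
  assumes lm: "loopless_multigraph G" and con: "connected_graph G" and lf: "locally_finite_graph G"
begin

abbreviation "V \<equiv> verts G"
abbreviation "E \<equiv> edges G"

lemma edge_ends: 
  assumes "e \<in> E" obtains u v where "endpts G e = {u, v}" "u \<noteq> v" "u \<in> V" "v \<in> V"
  using lm assms unfolding loopless_multigraph_def by (metis card_2_iff insert_subset)

lemma endpts_neq: "e \<in> E \<Longrightarrow> endpts G e = {u, v} \<Longrightarrow> u \<noteq> v"
  using lm unfolding loopless_multigraph_def by force

lemma endpts_V: "e \<in> E \<Longrightarrow> endpts G e \<subseteq> V"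
  using lm unfolding loopless_multigraph_def by blast

lemma finite_endpts: "e \<in> E \<Longrightarrow> finite (endpts G e)"
  by (metis edge_ends finite.emptyI finite_insert)

lemma edge_adj_V: "(u, v) \<in> edge_adj G F \<Longrightarrow> u \<in> V \<and> v \<in> V"
  using endpts_V by (fastforce simp: edge_adj_def)

lemma comp_of_subset_V: "u \<in> V \<Longrightarrow> comp_of G F u \<subseteq> V"
proof
  fix v assume u: "u \<in> V" and "v \<in> comp_of G F u"
  then have "(u, v) \<in> (edge_adj G F)\<^sup>*" by (simp add: comp_of_def)
  then show "v \<in> V" by induction (use u edge_adj_V in auto)
qed

lemma comps_subset_V: "K \<in> comps G F \<Longrightarrow> K \<subseteq> V"
  using comp_of_subset_V by (fastforce simp: comps_def)

lemma finite_star_edges: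
  assumes "finite S" "S \<subseteq> V" shows "finite (star_edges G S)"
proof -
  have "star_edges G S = (\<Union>v\<in>S. {e \<in> E. v \<in> endpts G e})"
    by (auto simp: star_edges_def)
  then show ?thesis using assms lf by (auto simp: locally_finite_graph_def)
qed

lemma star_edges_subset: "star_edges G S \<subseteq> E"
  by (auto simp: star_edges_def)

text \<open>Vertex deletion is the special case of edge deletion in which all edges at
  \<open>S\<close> go. This carries the separators and components in the definition of ends over to
  edge sets.\<close>

lemma adj_avoiding_eq: "adj_avoiding G S = edge_adj G (star_edges G S)"
  using endpts_V unfolding adj_avoiding_def edge_adj_def star_edges_def by fastforce

lemma comp_of_empty: "u \<in> V \<Longrightarrow> comp_of G {} u = V"
proof -
  assume u: "u \<in> V"
  have "star_edges G {} = {}" by (auto simp: star_edges_def)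
  then have "\<forall>v\<in>V. (u, v) \<in> (edge_adj G {})\<^sup>*"
    using con u unfolding connected_graph_def adj_avoiding_eq by auto
  then show ?thesis using comp_of_subset_V[OF u] by (auto simp: comp_of_def)
qed

lemma V_nonempty: "V \<noteq> {}"
  using con by (simp add: connected_graph_def)

text \<open>Every component contains the root \<open>r\<close> or an end of a deleted edge: a walk
  from \<open>r\<close> to a vertex of the component stays in it after the last deleted
  edge.\<close>

lemma finite_comps:
  assumes F: "finite F" "F \<subseteq> E" shows "finite (comps G F)"
proof -
  obtain r where r: "r \<in> V" using V_nonempty by blast
  define A where "A = insert r (\<Union>e\<in>F. endpts G e)"
  have "finite A" using F finite_endpts by (auto simp: A_def)
  moreover have "comps G F \<subseteq> comp_of G F ` A"
  proof
    fix K assume "K \<in> comps G F"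
    then obtain u where u: "u \<in> V" "K = comp_of G F u" by (auto simp: comps_def)
    have "(r, u) \<in> (edge_adj G {})\<^sup>*" using comp_of_empty[OF r] u by (auto simp: comp_of_def)
    then have "\<exists>a\<in>A. u \<in> comp_of G F a"
    proof induction
      case base show ?case by (auto simp: A_def)
    next
      case (step y z)
      then obtain a e where a: "a \<in> A" "y \<in> comp_of G F a" and e: "e \<in> E" "endpts G e = {y, z}"
        by (auto simp: edge_adj_def)
      show ?case
      proof (cases "e \<in> F")
        case True
        then have "z \<in> A" using e by (auto simp: A_def)
        then show ?thesis using comp_of_self[of z] by blast
      next
        case False
        then have "(y, z) \<in> edge_adj G F" using e by (auto simp: edge_adj_def)
        then show ?thesis using a by (auto simp: comp_of_def intro: rtrancl_into_rtrancl)
      qed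
    qed
    then obtain a where "a \<in> A" "u \<in> comp_of G F a" by blast
    then show "K \<in> comp_of G F ` A" using u(2) comp_of_eqI[of u G F a] by simp
  qed
  ultimately show ?thesis by (meson finite_surj)
qed

lemma countable_E: "countable E"
proof -
  have "E \<subseteq> fst ` oriented_edges G"
  proof
    fix e assume e: "e \<in> E"
    then obtain u v where "endpts G e = {u, v}" by (rule edge_ends)
    then have "(e, u, v) \<in> oriented_edges G" using e by (auto simp: oriented_edges_def)
    then show "e \<in> fst ` oriented_edges G" by force
  qed
  then show ?thesis
    using countable_oriented_edges[OF lm con lf] by (meson countable_image countable_subset)
qed

lemma components_minus_eq: "components_minus G S = {comp_of G (star_edges G S) u | u. u \<in> V - S}"
  unfolding components_minus_def adj_avoiding_eq comp_of_def by auto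

text \<open>Deleted vertices survive as singleton components. No end lies in them, by
  \<open>end_not_finite\<close>.\<close>

lemma comp_of_star_single: "s \<in> S \<Longrightarrow> comp_of G (star_edges G S) s = {s}"
proof -
  assume s: "s \<in> S"
  have "v = s" if "(s, v) \<in> (edge_adj G (star_edges G S))\<^sup>*" for v
    using that by induction (use s in \<open>auto simp: edge_adj_def star_edges_def\<close>)
  then show ?thesis by (auto simp: comp_of_def)
qed

lemma comp_of_star_disjoint:
  assumes "u \<notin> S" shows "comp_of G (star_edges G S) u \<inter> S = {}"
proof -
  have False if "v \<in> comp_of G (star_edges G S) u" "v \<in> S" for v
  proof -
    have "u \<in> comp_of G (star_edges G S) v" using comp_of_eqI[OF that(1)] comp_of_self by metis
    then show False using comp_of_star_single[OF that(2)] assms that by auto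
  qed
  then show ?thesis by auto
qed

section \<open>Rays and ends\<close>

lemma raysD: "R \<in> rays G \<Longrightarrow> inj (fst R)" "R \<in> rays G \<Longrightarrow> snd R n \<in> E"
  "R \<in> rays G \<Longrightarrow> endpts G (snd R n) = {fst R n, fst R (Suc n)}"
  by (auto simp: rays_def)

lemma rays_V: "R \<in> rays G \<Longrightarrow> fst R n \<in> V"
  using raysD(2,3)[of R n] endpts_V[of "snd R n"] by auto

lemma ray_edges_inj: "R \<in> rays G \<Longrightarrow> inj (snd R)"
proof (rule injI)
  fix m n assume R: "R \<in> rays G" and "snd R m = snd R n"
  then have "{fst R m, fst R (Suc m)} = {fst R n, fst R (Suc n)}" using raysD(3) by metis
  then show "m = n" using raysD(1)[OF R] by (auto simp: doubleton_eq_iff inj_eq)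
qed

lemma inj_eventually_avoids:
  assumes "inj (f :: nat \<Rightarrow> 'a)" "finite A" shows "\<exists>n. \<forall>m\<ge>n. f m \<notin> A"
proof -
  have "finite (f -` A)" using assms by (simp add: finite_vimageI)
  then obtain n where "\<forall>m\<in>f -` A. m < n" by (meson finite_nat_set_iff_bounded)
  then show ?thesis by (metis linorder_not_less vimageI)
qed

text \<open>The edges of a ray are distinct, so only finitely many lie in \<open>F\<close>; after
  the last of these the ray stays in one component.\<close>

lemma ray_tail:
  assumes R: "R \<in> rays G" and F: "finite F"
  shows "\<exists>K\<in>comps G F. tail_in R K"
proof -
  obtain n where n: "\<forall>m\<ge>n. snd R m \<notin> F"
    using inj_eventually_avoids[OF ray_edges_inj[OF R] F] by blast
  have "fst R m \<in> comp_of G F (fst R n)" if "m \<ge> n" for m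
    using that
  proof (induction m rule: dec_induct)
    case (step m)
    have "(fst R m, fst R (Suc m)) \<in> edge_adj G F"
      using raysD[OF R] n step by (auto simp: edge_adj_def intro!: bexI[of _ "snd R m"])
    then show ?case using step by (auto simp: comp_of_def intro: rtrancl_into_rtrancl)
  qed simp
  then show ?thesis using rays_V[OF R] unfolding tail_in_def by (meson comp_of_in_comps)
qed

lemma tail_in_mono: "tail_in R K \<Longrightarrow> K \<subseteq> K' \<Longrightarrow> tail_in R K'"
  by (auto simp: tail_in_def)

lemma tail_in_meet: "tail_in R K \<Longrightarrow> tail_in R K' \<Longrightarrow> K \<inter> K' \<noteq> {}"
  unfolding tail_in_def by (metis disjoint_iff le_cases)

text \<open>The set \<open>S\<close> consists of all ends of \<open>F\<close> and of the initial
  parts of both rays. A path that avoids it uses no edge of \<open>F\<close> and can join the rays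
  only in their tails, so both tails lie in one component.\<close>

lemma ray_equiv_tail:
  assumes RR: "(R, R') \<in> ray_equiv G" and F: "finite F" "F \<subseteq> E" and K: "K \<in> comps G F" "tail_in R K"
  shows "tail_in R' K"
proof -
  have R: "R \<in> rays G" "R' \<in> rays G" using RR by (auto simp: ray_equiv_def)
  obtain K' where K': "K' \<in> comps G F" "tail_in R' K'" using ray_tail[OF R(2) F(1)] by blast
  obtain n where n: "\<forall>m\<ge>n. fst R m \<in> K" using K by (auto simp: tail_in_def)
  obtain n' where n': "\<forall>m\<ge>n'. fst R' m \<in> K'" using K' by (auto simp: tail_in_def)
  define S where "S = (\<Union>e\<in>F. endpts G e) \<union> fst R ` {..<n} \<union> fst R' ` {..<n'}"
  have S: "finite S" "S \<subseteq> V"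
    using F finite_endpts endpts_V rays_V[OF R(1)] rays_V[OF R(2)] by (auto simp: S_def)
  then have "\<not> separates G S (range (fst R)) (range (fst R'))" using RR by (auto simp: ray_equiv_def)
  then obtain a b where ab: "a \<in> range (fst R) - S" "b \<in> range (fst R') - S"
    "(a, b) \<in> (edge_adj G (star_edges G S))\<^sup>*"
    unfolding separates_def adj_avoiding_eq by blast
  have "a \<in> K" using ab(1) n by (force simp: S_def not_less)
  moreover have "b \<in> K'" using ab(2) n' by (force simp: S_def not_less)
  moreover have "F \<subseteq> star_edges G S" 
  proof
    fix e assume "e \<in> F"
    then have "e \<in> E" "endpts G e \<subseteq> S" "endpts G e \<noteq> {}"
      using F edge_ends[of e] unfolding S_def by auto
    then show "e \<in> star_edges G S" unfolding star_edges_def by blast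
  qed
  then have "b \<in> comp_of G F a" using ab(3) comp_of_antimono[of F "star_edges G S" G a] by (auto simp: comp_of_def)
  ultimately have "K' = K" using K(1) K'(1) comps_mem_eq comps_eqI by metis
  then show ?thesis using K' by simp
qed

lemma ray_equiv_refl: 
  assumes "R \<in> rays G" shows "(R, R) \<in> ray_equiv G"
proof -
  have "\<not> separates G S (range (fst R)) (range (fst R))" if "finite S" for S
  proof -
    obtain n where "fst R n \<notin> S" using inj_eventually_avoids[OF raysD(1)[OF assms] \<open>finite S\<close>] by blast
    then show ?thesis by (auto simp: separates_def)
  qed
  then show ?thesis using assms by (auto simp: ray_equiv_def)
qed

lemma end_repr:
  assumes "w \<in> graph_ends G"
  obtains R where "R \<in> rays G" "R \<in> w" "\<And>R'. R' \<in> w \<Longrightarrow> (R, R') \<in> ray_equiv G"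
  using assms unfolding graph_ends_def by (metis Image_singleton_iff quotientE ray_equiv_refl)

definition end_in :: "('v, 'e) ray set \<Rightarrow> 'v set \<Rightarrow> bool" where
  "end_in w K \<longleftrightarrow> (\<forall>R\<in>w. tail_in R K)"

lemma end_comp:
  assumes w: "w \<in> graph_ends G" and F: "finite F" "F \<subseteq> E"
  obtains K where "K \<in> comps G F" "end_in w K"
proof -
  obtain R where R: "R \<in> rays G" "R \<in> w" "\<And>R'. R' \<in> w \<Longrightarrow> (R, R') \<in> ray_equiv G"
    using end_repr[OF w] by blast
  obtain K where K: "K \<in> comps G F" "tail_in R K" using ray_tail[OF R(1) F(1)] by blast
  then have "end_in w K" using ray_equiv_tail[OF _ F K] R(3) by (auto simp: end_in_def)
  then show thesis using that K by blast
qed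

lemma end_in_meet: "w \<in> graph_ends G \<Longrightarrow> end_in w K \<Longrightarrow> end_in w K' \<Longrightarrow> K \<inter> K' \<noteq> {}"
  by (meson end_repr end_in_def tail_in_meet)

lemma end_in_unique: 
  "w \<in> graph_ends G \<Longrightarrow> end_in w K \<Longrightarrow> end_in w K' \<Longrightarrow> K \<in> comps G F \<Longrightarrow> K' \<in> comps G F \<Longrightarrow> K = K'"
  using end_in_meet comps_eqI by (metis disjoint_iff)

lemma end_in_mono: "end_in w K \<Longrightarrow> K \<subseteq> K' \<Longrightarrow> end_in w K'"
  by (auto simp: end_in_def intro: tail_in_mono)

lemma end_not_finite: "w \<in> graph_ends G \<Longrightarrow> end_in w K \<Longrightarrow> infinite K"
proof
  assume w: "w \<in> graph_ends G" "end_in w K" and K: "finite K"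
  obtain R where R: "R \<in> rays G" "R \<in> w" using end_repr[OF w(1)] by blast
  then have "tail_in R K" using w by (auto simp: end_in_def)
  then show False using inj_eventually_avoids[OF raysD(1)[OF R(1)] K]
    unfolding tail_in_def by (metis le_cases)
qed

end

section \<open>The topology of the Freudenthal compactification\<close>

lemma edge_point_swap: "u \<noteq> v \<Longrightarrow> edge_point e v u t = edge_point e u v (1 - t)"
  by (auto simp: edge_point_def)

lemma edge_point_not_End [simp]: "edge_point e u v t \<noteq> End w"
  by (simp add: edge_point_def)

context lf_graph
begin

text \<open>A reference orientation, chosen arbitrarily for each edge. It gives every closed edge
  one parametrisation \<open>epoint\<close> and lets antisymmetric functions on oriented edges be
  handled as functions on \<open>E\<close>.\<close>

definition src :: "'e \<Rightarrow> 'v" where "src e = fst (SOME p. endpts G e = {fst p, snd p})"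
definition tgt :: "'e \<Rightarrow> 'v" where "tgt e = snd (SOME p. endpts G e = {fst p, snd p})"

lemma endpts_eq: "e \<in> E \<Longrightarrow> endpts G e = {src e, tgt e}"
proof -
  assume "e \<in> E"
  then obtain u v where "endpts G e = {u, v}" by (rule edge_ends)
  then have "\<exists>p. endpts G e = {fst p, snd p}" by (metis fst_conv snd_conv)
  from someI_ex[OF this] show ?thesis by (simp add: src_def tgt_def)
qed

lemma src_neq_tgt: "e \<in> E \<Longrightarrow> src e \<noteq> tgt e"
  using endpts_neq endpts_eq by blast

lemma src_V: "e \<in> E \<Longrightarrow> src e \<in> V" and tgt_V: "e \<in> E \<Longrightarrow> tgt e \<in> V"
  using endpts_V endpts_eq by blast+

lemma src_tgt_cases:
  assumes "e \<in> E" "endpts G e = {u, v}"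
  obtains "u = src e" "v = tgt e" | "u = tgt e" "v = src e"
  using assms endpts_eq[of e] by (auto simp: doubleton_eq_iff)

definition epoint :: "'e \<Rightarrow> real \<Rightarrow> ('v, 'e) point" where "epoint e t = edge_point e (src e) (tgt e) t"

lemma epoint_0 [simp]: "epoint e 0 = Vertex (src e)" and epoint_1 [simp]: "epoint e 1 = Vertex (tgt e)"
  by (simp_all add: epoint_def edge_point_def)

lemma epoint_not_End [simp]: "epoint e t \<noteq> End w" "End w \<noteq> epoint e t"
  by (simp_all add: epoint_def edge_point_def)

lemma epoint_Vertex_iff: "epoint e t = Vertex w \<longleftrightarrow> (t = 0 \<and> w = src e) \<or> (t = 1 \<and> w = tgt e)"
    and Vertex_epoint_iff: "Vertex w = epoint e t \<longleftrightarrow> (t = 0 \<and> w = src e) \<or> (t = 1 \<and> w = tgt e)"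
  by (auto simp: epoint_def edge_point_def)

lemma epoint_Inner: "0 < t \<Longrightarrow> t < 1 \<Longrightarrow> epoint e t = Inner e (\<lambda>w. if w = src e then 1 - t else if w = tgt e then t else 0)"
  by (simp add: epoint_def edge_point_def)

lemma epoint_inj:
  assumes "epoint e t = epoint e' t'" "0 < t" "t < 1"
  shows "e = e' \<and> t = t'"
proof -
  have 1: "epoint e t = Inner e (\<lambda>w. if w = src e then 1 - t else if w = tgt e then t else 0)"
    using epoint_Inner assms by blast
  then have t': "t' \<noteq> 0" "t' \<noteq> 1" using assms(1) by (metis epoint_0 epoint_1 point.distinct(1))+
  then have 2: "epoint e' t' = Inner e' (\<lambda>w. if w = src e' then 1 - t' else if w = tgt e' then t' else 0)"
    by (simp add: epoint_def edge_point_def)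
  have e: "e = e'" using 1 2 assms by simp
  \<comment> \<open>The coordinate at \<open>src e\<close> recovers the parameter.\<close>
  then have "1 - t = 1 - t'" using fun_cong[of _ _ "src e"] 1 2 assms by fastforce
  then show ?thesis using e by simp
qed

lemma edge_point_epoint:
  assumes "e \<in> E" "endpts G e = {u, v}"
  shows "edge_point e u v t = (if u = src e then epoint e t else epoint e (1 - t))"
  using assms
proof (cases rule: src_tgt_cases)
  case 2
  then show ?thesis using src_neq_tgt[OF assms(1)] edge_point_swap[of "src e" "tgt e"] by (simp add: epoint_def)
qed (auto simp: epoint_def)

lemma open_edge_eq: assumes e: "e \<in> E" shows "open_edge G e = epoint e ` {0<..<1}"
proof
  show "open_edge G e \<subseteq> epoint e ` {0<..<1}"
  proof
    fix p assume "p \<in> open_edge G e"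
    then obtain u v t where p: "p = edge_point e u v t" "endpts G e = {u, v}" "0 < t" "t < 1"
      by (auto simp: open_edge_def)
    then show "p \<in> epoint e ` {0<..<1}" using edge_point_epoint[OF e p(2)] by (auto intro!: image_eqI)
  qed
  show "epoint e ` {0<..<1} \<subseteq> open_edge G e"
    using endpts_eq[OF e] unfolding open_edge_def epoint_def by fastforce
qed

section \<open>Points of the compactification and traces of its subsets on edges\<close>

definition points :: "('v, 'e) point set" where
  "points = graph_points G \<union> End ` graph_ends G"

lemma points_cases:
  assumes "p \<in> points"
  obtains (V) v where "v \<in> V" "p = Vertex v"
  | (E) e t where "e \<in> E" "0 < t" "t < 1" "p = epoint e t"
  | (End) w where "w \<in> graph_ends G" "p = End w"
  using assms open_edge_eq unfolding points_def graph_points_def by fastforce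

lemma epoint_graph_points: "e \<in> E \<Longrightarrow> t \<in> {0..1} \<Longrightarrow> epoint e t \<in> graph_points G"
proof -
  assume "e \<in> E" "t \<in> {0..1}"
  then have "t = 0 \<or> t = 1 \<or> t \<in> {0<..<1}" by auto
  then show ?thesis using \<open>e \<in> E\<close> src_V[of e] tgt_V[of e] open_edge_eq[of e] unfolding graph_points_def by fastforce
qed

lemma epoint_points: "e \<in> E \<Longrightarrow> t \<in> {0..1} \<Longrightarrow> epoint e t \<in> points"
  using epoint_graph_points by (simp add: points_def)

lemma Vertex_points: "Vertex v \<in> points \<longleftrightarrow> v \<in> V"
  by (auto simp: points_def graph_points_def open_edge_eq Vertex_epoint_iff)

lemma End_points: "End w \<in> points \<longleftrightarrow> w \<in> graph_ends G"
  by (auto simp: points_def graph_points_def open_edge_eq)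

definition edge_trace :: "'e \<Rightarrow> ('v, 'e) point set \<Rightarrow> real set" where
  "edge_trace e U = {t \<in> {0..1}. epoint e t \<in> U}"

definition open_trace :: "'e \<Rightarrow> ('v, 'e) point set \<Rightarrow> bool" where
  "open_trace e U \<longleftrightarrow> openin (top_of_set {0..1}) (edge_trace e U)"

lemma open_trace_reverse:
  assumes "open_trace e U" shows "openin (top_of_set {0..1}) {t \<in> {0..1}. epoint e (1 - t) \<in> U}"
proof -
  have "continuous_map (top_of_set {0..1}) (top_of_set {0..1}) (\<lambda>t::real. 1 - t)"
    by (auto intro!: continuous_intros)
  from openin_continuous_map_preimage[OF this assms[unfolded open_trace_def]]
  have "openin (top_of_set {0..1}) {x \<in> {0..1}. 1 - x \<in> edge_trace e U}" by simp
  moreover have "{x \<in> {0..1}. 1 - x \<in> edge_trace e U} = {t \<in> {0..1}. epoint e (1 - t) \<in> U}"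
    by (auto simp: edge_trace_def)
  ultimately show ?thesis by simp
qed

text \<open>One direction per edge is enough, because reflecting the unit interval preserves
  openness.\<close>

lemma open_in_graph_iff: "open_in_graph G U \<longleftrightarrow> U \<subseteq> graph_points G \<and> (\<forall>e\<in>E. open_trace e U)"
proof
  assume *: "open_in_graph G U"
  then have "open_trace e U" if "e \<in> E" for e
    using endpts_eq[OF that] that unfolding open_in_graph_def open_trace_def edge_trace_def epoint_def by simp
  then show "U \<subseteq> graph_points G \<and> (\<forall>e\<in>E. open_trace e U)" using * by (simp add: open_in_graph_def)
next
  assume *: "U \<subseteq> graph_points G \<and> (\<forall>e\<in>E. open_trace e U)"
  have "openin (top_of_set {0..1}) {t \<in> {0..1}. edge_point e u v t \<in> U}"
    if e: "e \<in> E" and uv: "endpts G e = {u, v}" for e u v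
    using * e open_trace_reverse[of e U] unfolding edge_point_epoint[OF e uv]
    by (cases "u = src e") (auto simp: open_trace_def edge_trace_def)
  then show "open_in_graph G U" using * by (simp add: open_in_graph_def)
qed

text \<open>The part of the compactification that belongs to a component \<open>K\<close> of
  \<open>G - F\<close>. Unlike \<open>C_hat\<close> it contains no open edge that leaves the
  component, so pieces of different components are disjoint.\<close>

definition piece :: "'e set \<Rightarrow> 'v set \<Rightarrow> ('v, 'e) point set" where
  "piece F K = Vertex ` K \<union> (\<Union>e\<in>{e \<in> E - F. endpts G e \<subseteq> K}. open_edge G e)
     \<union> End ` {w \<in> graph_ends G. end_in w K}"

lemma Vertex_piece [simp]: "Vertex v \<in> piece F K \<longleftrightarrow> v \<in> K"
  by (auto simp: piece_def open_edge_eq Vertex_epoint_iff)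

lemma End_piece [simp]: "End w \<in> piece F K \<longleftrightarrow> w \<in> graph_ends G \<and> end_in w K"
  by (auto simp: piece_def open_edge_eq)

lemma epoint_piece: 
  assumes "e \<in> E" "0 < t" "t < 1"
  shows "epoint e t \<in> piece F K \<longleftrightarrow> e \<notin> F \<and> src e \<in> K \<and> tgt e \<in> K"
proof -
  have "epoint e t \<in> piece F K \<longleftrightarrow> (\<exists>e'\<in>E - F. endpts G e' \<subseteq> K \<and> epoint e t \<in> open_edge G e')"
    using assms epoint_not_End by (auto simp: piece_def epoint_Vertex_iff)
  also have "\<dots> \<longleftrightarrow> e \<in> E - F \<and> endpts G e \<subseteq> K"
  proof -
    have "epoint e t \<in> open_edge G e' \<longleftrightarrow> e = e'" if "e' \<in> E" for e'
      using that assms epoint_inj[of e t] by (auto simp: open_edge_eq)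
    then show ?thesis using assms(1) by auto
  qed
  finally show ?thesis using assms endpts_eq by auto
qed

lemma piece_antimono:
  assumes "F \<subseteq> F'" "K' \<subseteq> K" shows "piece F' K' \<subseteq> piece F K"
  using assms end_in_mono[of _ K' K] unfolding piece_def by blast

text \<open>Shows that the \<open>THE\<close> in \<open>end_component\<close> is well defined. The
  component that holds the end cannot be a single deleted vertex, because an end needs an infinite
  vertex set.\<close>

lemma end_component_eq:
  assumes w: "w \<in> graph_ends G" and S: "finite S" "S \<subseteq> V"
  shows "end_component G S w \<in> components_minus G S" "end_in w (end_component G S w)"
    "C \<in> components_minus G S \<Longrightarrow> end_in w C \<Longrightarrow> C = end_component G S w"
proof -
  have F: "finite (star_edges G S)" "star_edges G S \<subseteq> E"
    using finite_star_edges[OF S] star_edges_subset by auto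
  have sub: "components_minus G S \<subseteq> comps G (star_edges G S)"
    by (auto simp: components_minus_eq comps_def)
  obtain K where K: "K \<in> comps G (star_edges G S)" "end_in w K"
    using end_comp[OF w F] by blast
  then obtain u where u: "u \<in> V" "K = comp_of G (star_edges G S) u" by (auto simp: comps_def)
  have "u \<notin> S" using comp_of_star_single[of u S] u K end_not_finite[OF w K(2)] by auto
  then have KC: "K \<in> components_minus G S" using u by (auto simp: components_minus_eq)
  have uniq: "C = K" if "C \<in> components_minus G S" "end_in w C" for C
    using end_in_unique[OF w] that K sub by blast
  have *: "end_component G S w = K"
  proof -
    have "end_component G S w = (THE C. C \<in> components_minus G S \<and> end_in w C)"
      by (simp add: end_component_def end_in_def)
    also have "\<dots> = K" by (rule the_equality) (use KC K(2) uniq in blast)+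
    finally show ?thesis .
  qed
  then show "end_component G S w \<in> components_minus G S" "end_in w (end_component G S w)"
    using KC K(2) by simp_all
  show "C = end_component G S w" if "C \<in> components_minus G S" "end_in w C"
    using uniq[OF that] \<open>end_component G S w = K\<close> by simp
qed

text \<open>An edge with one end in the component has its other end there or in \<open>S\<close>, so
  all its inner points belong to \<open>C_hat\<close>. On such an edge at most an endvertex outside
  the component is missing, which leaves an open trace.\<close>

lemma C_hat_piece:
  assumes w: "w \<in> graph_ends G" and S: "finite S" "S \<subseteq> V"
  shows "piece (star_edges G S) (end_component G S w) \<subseteq> C_hat G S w"
    and "End w' \<in> C_hat G S w \<Longrightarrow> w' \<in> graph_ends G \<and> end_in w' (end_component G S w)"
    and "C_hat G S w \<subseteq> points"
    and "e \<in> E \<Longrightarrow> open_trace e (C_hat G S w)"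
proof -
  define C where "C = end_component G S w"
  have eq: "C_hat G S w = Vertex ` C \<union> (\<Union>e\<in>{e \<in> E. endpts G e \<subseteq> C}. open_edge G e)
     \<union> End ` {w' \<in> graph_ends G. end_in w' C}
     \<union> (\<Union>e\<in>{e \<in> E. endpts G e \<inter> S \<noteq> {} \<and> endpts G e \<inter> C \<noteq> {}}. open_edge G e)"
    by (simp add: C_hat_def C_def Let_def end_in_def)
  obtain u where u: "u \<in> V" "u \<notin> S" "C = comp_of G (star_edges G S) u"
    using end_component_eq(1)[OF w S] by (auto simp: C_def components_minus_eq)
  have CS: "C \<inter> S = {}" using comp_of_star_disjoint u by blast
  have CV: "C \<subseteq> V" using comp_of_subset_V u by blast
  have Ccomp: "C \<in> comps G (star_edges G S)" using u(1,3) comp_of_in_comps by simp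
  show "piece (star_edges G S) (end_component G S w) \<subseteq> C_hat G S w"
    unfolding eq C_def[symmetric] piece_def by blast
  show "End w' \<in> C_hat G S w \<Longrightarrow> w' \<in> graph_ends G \<and> end_in w' (end_component G S w)"
    unfolding eq C_def[symmetric] by (auto simp: open_edge_eq)
  show "C_hat G S w \<subseteq> points"
    using CV unfolding eq points_def graph_points_def by blast
  assume e: "e \<in> E"
  have Vx: "Vertex v \<in> C_hat G S w \<longleftrightarrow> v \<in> C" for v
    unfolding eq by (auto simp: open_edge_eq Vertex_epoint_iff)
  have In: "epoint e t \<in> C_hat G S w \<longleftrightarrow> endpts G e \<inter> C \<noteq> {}" if "0 < t" "t < 1" for t
  proof -
    have mem: "epoint e t \<in> open_edge G e' \<longleftrightarrow> e = e'" if "e' \<in> E" for e'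
      using that \<open>0 < t\<close> \<open>t < 1\<close> epoint_inj[of e t] by (auto simp: open_edge_eq)
    have "epoint e t \<in> C_hat G S w \<longleftrightarrow> endpts G e \<subseteq> C \<or> (endpts G e \<inter> S \<noteq> {} \<and> endpts G e \<inter> C \<noteq> {})"
      unfolding eq using e mem that by (auto simp: epoint_Vertex_iff)
    moreover have "endpts G e \<subseteq> C \<or> endpts G e \<inter> S \<noteq> {}" if "endpts G e \<inter> C \<noteq> {}"
    proof (rule disjCI)
      assume "\<not> endpts G e \<inter> S \<noteq> {}"
      then have e': "e \<in> E - star_edges G S" using e by (auto simp: star_edges_def)
      then have "src e \<in> C \<Longrightarrow> tgt e \<in> C" "tgt e \<in> C \<Longrightarrow> src e \<in> C"
        using comps_edge[OF Ccomp e'] endpts_eq[OF e] by (auto simp: insert_commute)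
      then show "endpts G e \<subseteq> C" using that endpts_eq[OF e] by auto
    qed
    ultimately show ?thesis using endpts_eq[OF e] by auto
  qed
  have tr: "edge_trace e (C_hat G S w) = {t \<in> {0..1}. (t = 0 \<longrightarrow> src e \<in> C) \<and> (t = 1 \<longrightarrow> tgt e \<in> C) \<and>
      (0 < t \<and> t < 1 \<longrightarrow> src e \<in> C \<or> tgt e \<in> C)}"
  proof -
    have "epoint e t \<in> C_hat G S w \<longleftrightarrow> (t = 0 \<longrightarrow> src e \<in> C) \<and> (t = 1 \<longrightarrow> tgt e \<in> C) \<and>
      (0 < t \<and> t < 1 \<longrightarrow> src e \<in> C \<or> tgt e \<in> C)" if t: "t \<in> {0..1}" for t
    proof -
      consider "t = 0" | "t = 1" | "0 < t" "t < 1" using t by fastforce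
      then show ?thesis by cases (simp_all add: Vx In endpts_eq[OF e])
    qed
    then show ?thesis unfolding edge_trace_def by blast
  qed
  have "edge_trace e (C_hat G S w) = {0..1} \<inter> ((if src e \<in> C then {..<1} else {}) \<union> (if tgt e \<in> C then {0<..} else {}))"
    unfolding tr by auto
  moreover have "open ((if src e \<in> C then {..<1} else {}) \<union> (if tgt e \<in> C then {0<..} else {} :: real set))"
    by auto
  ultimately show "open_trace e (C_hat G S w)" unfolding open_trace_def openin_open by blast
qed

text \<open>As \<open>S\<close> contains all ends of \<open>F\<close>, no edge that meets the
  component of \<open>G - S\<close> lies in \<open>F\<close>. The open edges between
  \<open>S\<close> and this component, which \<open>C_hat\<close> includes, therefore run inside
  \<open>K\<close>.\<close>

lemma end_piece_subset_C_hat: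
  assumes w: "w \<in> graph_ends G" and F: "finite F" "F \<subseteq> E" and K: "K \<in> comps G F" "end_in w K"
  defines "S \<equiv> \<Union>e\<in>F. endpts G e"
  shows "finite S" "S \<subseteq> V" "C_hat G S w \<subseteq> piece F K" "End w \<in> C_hat G S w"
proof -
  show S: "finite S" "S \<subseteq> V" using F finite_endpts endpts_V by (auto simp: S_def)
  have FS: "F \<subseteq> star_edges G S"
  proof
    fix e assume "e \<in> F"
    then have "e \<in> E" "endpts G e \<subseteq> S" "endpts G e \<noteq> {}"
      using F edge_ends[of e] unfolding S_def by auto
    then show "e \<in> star_edges G S" unfolding star_edges_def by blast
  qed
  define C where "C = end_component G S w"
  have eq: "C_hat G S w = Vertex ` C \<union> (\<Union>e\<in>{e \<in> E. endpts G e \<subseteq> C}. open_edge G e)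
     \<union> End ` {w' \<in> graph_ends G. end_in w' C}
     \<union> (\<Union>e\<in>{e \<in> E. endpts G e \<inter> S \<noteq> {} \<and> endpts G e \<inter> C \<noteq> {}}. open_edge G e)"
    by (simp add: C_hat_def C_def Let_def end_in_def)
  have CwS: "end_in w C" using end_component_eq(2)[OF w S] by (simp add: C_def)
  obtain u where u: "u \<in> V" "u \<notin> S" "C = comp_of G (star_edges G S) u"
    using end_component_eq(1)[OF w S] by (auto simp: C_def components_minus_eq)
  have CS: "C \<inter> S = {}" using comp_of_star_disjoint u by blast
  have CK: "C \<subseteq> K"
  proof -
    have 1: "C \<subseteq> comp_of G F u" using comp_of_antimono[OF FS] u(3) by simp
    then have "end_in w (comp_of G F u)" using CwS end_in_mono by blast
    then have "comp_of G F u = K" using end_in_unique[OF w _ K(2)] K comp_of_in_comps[OF u(1)] by blast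
    then show ?thesis using 1 by simp
  qed
  have nF: "e \<notin> F" if "endpts G e \<inter> C \<noteq> {}" for e
    using that CS unfolding S_def by blast
  have nFK: "e \<in> {e \<in> E - F. endpts G e \<subseteq> K}" if e: "e \<in> E" "endpts G e \<inter> C \<noteq> {}" for e
  proof -
    have e': "e \<in> E - F" using nF that by auto
    then have "src e \<in> K \<Longrightarrow> tgt e \<in> K" "tgt e \<in> K \<Longrightarrow> src e \<in> K"
      using comps_edge[OF K(1) e'] endpts_eq[OF e(1)] by (auto simp: insert_commute)
    then show ?thesis using e e' CK endpts_eq[OF e(1)] by auto
  qed
  show "C_hat G S w \<subseteq> piece F K"
  proof
    fix p assume "p \<in> C_hat G S w"
    then consider (a) "p \<in> Vertex ` C" | (b) e where "e \<in> E" "endpts G e \<inter> C \<noteq> {}" "p \<in> open_edge G e"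
      | (c) w' where "w' \<in> graph_ends G" "end_in w' C" "p = End w'"
      unfolding eq using endpts_eq by fastforce
    then show "p \<in> piece F K"
    proof cases
      case a then show ?thesis using CK unfolding piece_def by blast
    next
      case b then show ?thesis using nFK unfolding piece_def by blast
    next
      case c then show ?thesis using CK end_in_mono unfolding piece_def by blast
    qed
  qed
  show "End w \<in> C_hat G S w" using CwS w unfolding eq by blast
qed

text \<open>Openness at an end in terms of edge deletion. By \<open>C_hat_piece\<close> and
  \<open>end_piece_subset_C_hat\<close>, pieces and the sets \<open>C_hat\<close> generate the same
  neighbourhoods.\<close>

definition end_nbhd :: "('v, 'e) point set \<Rightarrow> ('v, 'e) ray set \<Rightarrow> bool" where
  "end_nbhd U w \<longleftrightarrow> (\<exists>F K. finite F \<and> F \<subseteq> E \<and> K \<in> comps G F \<and> end_in w K \<and> piece F K \<subseteq> U)"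

text \<open>The component of \<open>G - (F \<union> F')\<close> that contains the end lies in both
  given components.\<close>

lemma end_nbhd_Int:
  assumes w: "w \<in> graph_ends G" and "end_nbhd U w" "end_nbhd U' w" shows "end_nbhd (U \<inter> U') w"
proof -
  obtain F K where F: "finite F" "F \<subseteq> E" "K \<in> comps G F" "end_in w K" "piece F K \<subseteq> U"
    using assms by (auto simp: end_nbhd_def)
  obtain F' K' where F': "finite F'" "F' \<subseteq> E" "K' \<in> comps G F'" "end_in w K'" "piece F' K' \<subseteq> U'"
    using assms by (auto simp: end_nbhd_def)
  obtain L where L: "L \<in> comps G (F \<union> F')" "end_in w L"
    using end_comp[OF w, of "F \<union> F'"] F F' by blast
  have sub: "L \<subseteq> M" if M: "M \<in> comps G H" "end_in w M" "H \<subseteq> F \<union> F'" for M H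
  proof -
    obtain v where v: "v \<in> L" "v \<in> M" using end_in_meet[OF w L(2) M(2)] by blast
    then show ?thesis using comp_of_antimono[OF M(3)] L(1) M(1) comps_mem_eq[of _ G _ v] by metis
  qed
  have "piece (F \<union> F') L \<subseteq> U \<inter> U'"
    using piece_antimono[OF _ sub[OF F(3,4)], of F "F \<union> F'"] piece_antimono[OF _ sub[OF F'(3,4)], of F' "F \<union> F'"]
      F F' by blast
  then show ?thesis using L F F' unfolding end_nbhd_def by (meson Un_subset_iff finite_UnI)
qed

text \<open>Replaces the generated topology by a local test. For the converse, a point of
  \<open>G\<close> lies in \<open>U \<inter> graph_points G\<close>, which is open in the 1-complex,
  and an end lies in a \<open>C_hat\<close> inside its piece.\<close>

lemma openin_freudenthal_iff:
  "openin (freudenthal G) U \<longleftrightarrow> U \<subseteq> points \<and> (\<forall>e\<in>E. open_trace e U) \<and> (\<forall>w. End w \<in> U \<longrightarrow> end_nbhd U w)"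
  (is "?L \<longleftrightarrow> ?R")
proof
  assume ?L
  then have "generate_topology_on ({U. open_in_graph G U} \<union> {C_hat G S w | S w. finite S \<and> S \<subseteq> V \<and> w \<in> graph_ends G}) U"
    by (simp add: freudenthal_def openin_topology_generated_by_iff)
  then show ?R
  proof induction
    case Empty show ?case by (auto simp: open_trace_def edge_trace_def)
  next
    case (Int a b)
    have "edge_trace e (a \<inter> b) = edge_trace e a \<inter> edge_trace e b" for e by (auto simp: edge_trace_def)
    then have "open_trace e (a \<inter> b)" if "e \<in> E" for e using Int that by (auto simp: open_trace_def)
    moreover have "end_nbhd (a \<inter> b) w" if "End w \<in> a \<inter> b" for w
    proof -
      have "w \<in> graph_ends G" using that Int End_points by blast
      then show ?thesis using Int that end_nbhd_Int by blast
    qed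
    ultimately show ?case using Int by blast
  next
    case (UN k)
    have "edge_trace e (\<Union>k) = (\<Union>a\<in>k. edge_trace e a)" for e by (auto simp: edge_trace_def)
    then have "open_trace e (\<Union>k)" if "e \<in> E" for e using UN that by (auto simp: open_trace_def)
    moreover have "end_nbhd (\<Union>k) w" if "End w \<in> \<Union>k" for w
      using that UN unfolding end_nbhd_def by (meson Sup_upper UnionE subset_trans)
    ultimately show ?case using UN by blast
  next
    case (Basis s)
    then consider "open_in_graph G s" | S w where "s = C_hat G S w" "finite S" "S \<subseteq> V" "w \<in> graph_ends G" by blast
    then show ?case
    proof cases
      case 1
      then have "End w \<notin> s" for w by (auto simp: open_in_graph_iff graph_points_def open_edge_eq)
      then show ?thesis using 1 by (auto simp: open_in_graph_iff points_def)
    next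
      case 2
      note * = C_hat_piece[OF 2(4,2,3)]
      let ?C = "end_component G S w"
      have C: "?C \<in> comps G (star_edges G S)" 
        using end_component_eq(1)[OF 2(4,2,3)] by (auto simp: components_minus_eq comps_def)
      have "end_nbhd s w'" if "End w' \<in> s" for w'
      proof -
        have "end_in w' ?C" using *(2)[of w'] that 2(1) by blast
        then show ?thesis unfolding end_nbhd_def 2(1) 
          using C *(1) finite_star_edges[OF 2(2,3)] star_edges_subset by blast
      qed
      then show ?thesis using * 2 by auto
    qed
  qed
next
  assume R: ?R
  let ?B = "{U. open_in_graph G U} \<union> {C_hat G S w | S w. finite S \<and> S \<subseteq> V \<and> w \<in> graph_ends G}"
  have b: "openin (freudenthal G) s" if "s \<in> ?B" for s
    using that by (simp add: freudenthal_def openin_topology_generated_by_iff generate_topology_on.Basis)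
  have "\<exists>s. openin (freudenthal G) s \<and> p \<in> s \<and> s \<subseteq> U" if p: "p \<in> U" for p
  proof (cases "p \<in> graph_points G")
    case True
    have "edge_trace e (U \<inter> graph_points G) = edge_trace e U" if "e \<in> E" for e
      using that epoint_graph_points by (auto simp: edge_trace_def)
    then have "open_in_graph G (U \<inter> graph_points G)"
      using R by (auto simp: open_in_graph_iff open_trace_def)
    then show ?thesis using True p b[of "U \<inter> graph_points G"] by blast
  next
    case False
    then obtain w where w: "w \<in> graph_ends G" "p = End w" using p R by (auto simp: points_def)
    then have "end_nbhd U w" using R p by blast
    then obtain F K where F: "finite F" "F \<subseteq> E" "K \<in> comps G F" "end_in w K" "piece F K \<subseteq> U"
      by (auto simp: end_nbhd_def)
    note * = end_piece_subset_C_hat[OF w(1) F(1-4)]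
    show ?thesis using b[of "C_hat G (\<Union>e\<in>F. endpts G e) w"] * w F(5) by blast
  qed
  then show ?L by (subst openin_subopen) blast
qed

lemma topspace_freudenthal [simp]: "topspace (freudenthal G) = points"
proof
  show "topspace (freudenthal G) \<subseteq> points"
    using openin_freudenthal_iff openin_topspace by blast
  have "edge_trace e points = {0..1}" if "e \<in> E" for e using that epoint_points by (auto simp: edge_trace_def)
  then have "open_trace e points" if "e \<in> E" for e using that by (simp add: open_trace_def)
  moreover have "end_nbhd points w" if "End w \<in> points" for w
  proof -
    have w: "w \<in> graph_ends G" using that End_points by blast
    obtain K where K: "K \<in> comps G {}" "end_in w K" using end_comp[OF w, of "{}"] by blast
    have "piece {} K \<subseteq> points"
      using comps_subset_V[OF K(1)] unfolding piece_def points_def graph_points_def by blast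
    then show ?thesis unfolding end_nbhd_def using K by blast
  qed
  ultimately have "openin (freudenthal G) points" by (simp add: openin_freudenthal_iff)
  then show "points \<subseteq> topspace (freudenthal G)" by (rule openin_subset)
qed

lemma piece_points: "K \<in> comps G F \<Longrightarrow> piece F K \<subseteq> points"
  using comps_subset_V[of K F] unfolding piece_def points_def graph_points_def by blast

end

section \<open>Chains of simplicial complexes\<close>

text \<open>Point masses on lists. They are not alternating, hence no chains in general, but
  boundary and chain map are linear on all finitely supported functions, so identities can be
  checked on them.\<close>

definition list_delta :: "'a list \<Rightarrow> 'a list \<Rightarrow> int" where
  "list_delta l xs = of_bool (xs = l)"

lemma finite_support_delta: "finite {xs. list_delta l xs \<noteq> 0}"
  by (simp add: list_delta_def)

lemma finite_support_add:
  "finite {xs. c xs \<noteq> 0} \<Longrightarrow> finite {xs. d xs \<noteq> (0::int)} \<Longrightarrow> finite {xs. c xs + d xs \<noteq> 0}"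
  by (rule finite_subset[of _ "{xs. c xs \<noteq> 0} \<union> {xs. d xs \<noteq> 0}"]) auto

lemma finite_support_scale: "finite {xs. c xs \<noteq> 0} \<Longrightarrow> finite {xs. k * c xs \<noteq> (0::int)}"
  by (rule finite_subset[of _ "{xs. c xs \<noteq> 0}"]) auto

lemma finite_support_sum:
  "finite I \<Longrightarrow> (\<And>i. i \<in> I \<Longrightarrow> finite {xs. c i xs \<noteq> 0}) \<Longrightarrow> finite {xs. (\<Sum>i\<in>I. c i xs) \<noteq> (0::int)}"
  by (induction I rule: finite_induct) (auto intro: finite_support_add)

lemma finite_cons_support: "finite {xs. c xs \<noteq> (0::int)} \<Longrightarrow> finite {v. c (v # xs) \<noteq> 0}"
  using finite_vimageI[of "{xs. c xs \<noteq> 0}" "\<lambda>v. v # xs"] by (simp add: vimage_def inj_on_def)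

text \<open>The additivity in \<open>simplicial_boundary_add\<close> is stated for alternating
  chains; this version asks for finite support only, so that it applies to
  \<open>list_delta\<close>.\<close>

lemma simplicial_boundary_lin_add:
  assumes "finite {xs. c xs \<noteq> 0}" "finite {xs. d xs \<noteq> 0}"
  shows "simplicial_boundary (\<lambda>xs. c xs + d xs) = (\<lambda>xs. simplicial_boundary c xs + simplicial_boundary d xs)"
proof
  fix xs
  show "simplicial_boundary (\<lambda>xs. c xs + d xs) xs = simplicial_boundary c xs + simplicial_boundary d xs"
  proof (cases "xs = []")
    case False
    let ?A = "{v. c (v # xs) \<noteq> 0} \<union> {v. d (v # xs) \<noteq> 0}"
    have A: "finite ?A" using assms by (simp add: finite_cons_support)
    have "simplicial_boundary (\<lambda>xs. c xs + d xs) xs = (\<Sum>v\<in>?A. c (v # xs) + d (v # xs))"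
      "simplicial_boundary c xs = (\<Sum>v\<in>?A. c (v # xs))" "simplicial_boundary d xs = (\<Sum>v\<in>?A. d (v # xs))"
      by (rule simplicial_boundary_eq_sum[OF A]; use False in auto)+
    then show ?thesis by (simp add: sum.distrib)
  qed (simp add: simplicial_boundary_def)
qed

lemma simplicial_boundary_scale:
  "simplicial_boundary (\<lambda>xs. k * c xs) = (\<lambda>xs. k * simplicial_boundary c xs)"
  by (cases "k = 0") (auto simp: simplicial_boundary_def sum_distrib_left)

lemma finite_support_diff:
  "finite {xs. c xs \<noteq> 0} \<Longrightarrow> finite {xs. d xs \<noteq> (0::int)} \<Longrightarrow> finite {xs. c xs - d xs \<noteq> 0}"
  using finite_support_add[of c "\<lambda>xs. (-1) * d xs", OF _ finite_support_scale] by simp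

lemma simplicial_boundary_diff:
  assumes "finite {xs. c xs \<noteq> 0}" "finite {xs. d xs \<noteq> 0}"
  shows "simplicial_boundary (\<lambda>xs. c xs - d xs) = (\<lambda>xs. simplicial_boundary c xs - simplicial_boundary d xs)"
  using simplicial_boundary_lin_add[OF assms(1) finite_support_scale[OF assms(2), of "-1"]]
    simplicial_boundary_scale[of "-1" d] by simp

lemma simplicial_boundary_sum:
  assumes "finite I" "\<And>i. i \<in> I \<Longrightarrow> finite {xs. c i xs \<noteq> 0}"
  shows "simplicial_boundary (\<lambda>xs. \<Sum>i\<in>I. c i xs) = (\<lambda>xs. \<Sum>i\<in>I. simplicial_boundary (c i) xs)"
  using assms
proof (induction I rule: finite_induct)
  case empty
  show ?case by (simp add: simplicial_boundary_def fun_eq_iff)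
next
  case (insert i I)
  then show ?case by (simp add: simplicial_boundary_lin_add finite_support_sum)
qed

text \<open>Only the head is dropped, because \<open>simplicial_boundary\<close> reads coefficients
  at \<open>v # xs\<close>; the other faces of a simplex come from the other orderings of its
  vertices in an alternating chain. Lists with fewer than two entries give 0, since the boundary
  vanishes at \<open>[]\<close>.\<close>

lemma simplicial_boundary_delta:
  "simplicial_boundary (list_delta l) = (case l of v # w # r \<Rightarrow> list_delta (w # r) | _ \<Rightarrow> (\<lambda>_. 0))"
proof
  fix xs
  show "simplicial_boundary (list_delta l) xs = (case l of v # w # r \<Rightarrow> list_delta (w # r) | _ \<Rightarrow> (\<lambda>_. 0)) xs"
  proof (cases "xs = []")
    case False
    then have "simplicial_boundary (list_delta l) xs = (\<Sum>v\<in>set l. list_delta l (v # xs))"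
      by (intro simplicial_boundary_eq_sum) (auto simp: list_delta_def split: if_splits)
    also have "\<dots> = (case l of v # w # r \<Rightarrow> list_delta (w # r) | _ \<Rightarrow> (\<lambda>_. 0)) xs"
    proof (cases l)
      case (Cons v l')
      have "(\<Sum>w\<in>set l. list_delta l (w # xs)) = (\<Sum>w\<in>set l. if w = v then of_bool (xs = l') else 0)"
        using Cons by (intro sum.cong) (auto simp: list_delta_def)
      also have "\<dots> = of_bool (xs = l')" using Cons by simp
      finally show ?thesis using Cons False by (cases l') (auto simp: list_delta_def)
    qed simp
    finally show ?thesis .
  qed (auto simp: simplicial_boundary_def list_delta_def split: list.split)
qed

section \<open>Linearity and naturality of chain maps\<close>

lemma simplicial_chain_map_eq_sum:
  assumes "finite A" "\<And>xs. c xs \<noteq> 0 \<Longrightarrow> xs \<in> A"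
  shows "simplicial_chain_map f c ys = (\<Sum>xs\<in>A. if map f xs = ys then c xs else 0)"
proof -
  have "(\<Sum>xs\<in>A. if map f xs = ys then c xs else 0) = (\<Sum>xs\<in>{xs\<in>A. map f xs = ys}. c xs)"
    using assms(1) by (simp add: sum.inter_filter)
  also have "\<dots> = simplicial_chain_map f c ys"
    unfolding simplicial_chain_map_def using assms by (intro sum.mono_neutral_right) auto
  finally show ?thesis by simp
qed

lemma simplicial_chain_map_add:
  assumes "finite {xs. c xs \<noteq> 0}" "finite {xs. d xs \<noteq> 0}"
  shows "simplicial_chain_map f (\<lambda>xs. c xs + d xs) = (\<lambda>xs. simplicial_chain_map f c xs + simplicial_chain_map f d xs)"
proof
  fix ys
  let ?A = "{xs. c xs \<noteq> 0} \<union> {xs. d xs \<noteq> 0}"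
  have A: "finite ?A" using assms by simp
  have "simplicial_chain_map f (\<lambda>xs. c xs + d xs) ys = (\<Sum>xs\<in>?A. if map f xs = ys then c xs + d xs else 0)"
    "simplicial_chain_map f c ys = (\<Sum>xs\<in>?A. if map f xs = ys then c xs else 0)"
    "simplicial_chain_map f d ys = (\<Sum>xs\<in>?A. if map f xs = ys then d xs else 0)"
    by (rule simplicial_chain_map_eq_sum[OF A]; auto)+
  then show "simplicial_chain_map f (\<lambda>xs. c xs + d xs) ys = simplicial_chain_map f c ys + simplicial_chain_map f d ys"
    by (simp add: sum.distrib[symmetric] if_distrib cong: if_cong)
qed

lemma simplicial_chain_map_scale:
  "simplicial_chain_map f (\<lambda>xs. k * c xs) = (\<lambda>xs. k * simplicial_chain_map f c xs)"
  by (cases "k = 0") (auto simp: simplicial_chain_map_def sum_distrib_left)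

lemma simplicial_chain_map_diff:
  assumes "finite {xs. c xs \<noteq> 0}" "finite {xs. d xs \<noteq> 0}"
  shows "simplicial_chain_map f (\<lambda>xs. c xs - d xs) = (\<lambda>xs. simplicial_chain_map f c xs - simplicial_chain_map f d xs)"
  using simplicial_chain_map_add[OF assms(1) finite_support_scale[OF assms(2), of "-1"], of f]
    simplicial_chain_map_scale[of f "-1" d] by simp

lemma simplicial_chain_map_sum:
  assumes "finite I" "\<And>i. i \<in> I \<Longrightarrow> finite {xs. c i xs \<noteq> 0}"
  shows "simplicial_chain_map f (\<lambda>xs. \<Sum>i\<in>I. c i xs) = (\<lambda>xs. \<Sum>i\<in>I. simplicial_chain_map f (c i) xs)"
  using assms
proof (induction I rule: finite_induct)
  case empty
  show ?case by (simp add: simplicial_chain_map_def fun_eq_iff)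
next
  case (insert i I)
  then show ?case by (simp add: simplicial_chain_map_add finite_support_sum)
qed

lemma simplicial_chain_map_delta: "simplicial_chain_map f (list_delta l) = list_delta (map f l)"
proof
  fix ys show "simplicial_chain_map f (list_delta l) ys = list_delta (map f l) ys"
    by (subst simplicial_chain_map_eq_sum[of "{l}"]) (auto simp: list_delta_def split: if_splits)
qed

lemma finite_support_chain_map:
  assumes "finite {xs. c xs \<noteq> 0}" shows "finite {xs. simplicial_chain_map f c xs \<noteq> 0}"
proof (rule finite_subset)
  show "{xs. simplicial_chain_map f c xs \<noteq> 0} \<subseteq> map f ` {xs. c xs \<noteq> 0}"
    unfolding simplicial_chain_map_def by (auto elim!: sum.not_neutral_contains_not_neutral)
qed (use assms in simp)

lemma finite_support_boundary_delta: "finite {xs. simplicial_boundary (list_delta l) xs \<noteq> 0}"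
  unfolding simplicial_boundary_delta by (auto simp: finite_support_delta split: list.split)

lemma finite_support_boundary:
  assumes "finite {xs. c xs \<noteq> 0}" shows "finite {xs. simplicial_boundary c xs \<noteq> 0}"
proof (rule finite_subset)
  show "{xs. simplicial_boundary c xs \<noteq> 0} \<subseteq> tl ` {xs. c xs \<noteq> 0}"
    unfolding simplicial_boundary_def
    by (force split: if_splits elim!: sum.not_neutral_contains_not_neutral)
qed (use assms in simp)

lemma sum_list_delta:
  assumes "finite {xs. c xs \<noteq> 0}"
  shows "(\<lambda>xs. \<Sum>l\<in>{l. c l \<noteq> 0}. c l * list_delta l xs) = c"
proof
  fix xs
  have "(\<Sum>l\<in>{l. c l \<noteq> 0}. c l * list_delta l xs) = (\<Sum>l\<in>{l. c l \<noteq> 0}. if l = xs then c l else 0)"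
    by (intro sum.cong) (auto simp: list_delta_def)
  also have "\<dots> = c xs" using assms by auto
  finally show "(\<Sum>l\<in>{l. c l \<noteq> 0}. c l * list_delta l xs) = c xs" .
qed

lemma simplicial_chain_map_comp:
  assumes "finite {xs. c xs \<noteq> 0}"
  shows "simplicial_chain_map g (simplicial_chain_map f c) = simplicial_chain_map (g \<circ> f) c"
proof -
  let ?I = "{l. c l \<noteq> 0}"
  have *: "simplicial_chain_map h (\<lambda>xs. \<Sum>l\<in>?I. c l * list_delta (k l) xs) = (\<lambda>xs. \<Sum>l\<in>?I. c l * list_delta (map h (k l)) xs)"
    for h :: "'d \<Rightarrow> 'e" and k
    using assms by (simp add: simplicial_chain_map_sum finite_support_scale finite_support_delta
        simplicial_chain_map_scale simplicial_chain_map_delta)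
  have **: "simplicial_chain_map h c = (\<lambda>xs. \<Sum>l\<in>?I. c l * list_delta (map h l) xs)" for h :: "'a \<Rightarrow> 'e"
    using assms by (subst sum_list_delta[OF assms, symmetric])
      (simp add: simplicial_chain_map_sum finite_support_scale finite_support_delta
        simplicial_chain_map_scale simplicial_chain_map_delta)
  show ?thesis by (simp add: * **)
qed

text \<open>By linearity it suffices to compare both sides on \<open>list_delta\<close>, where
  dropping the head commutes with \<open>map f\<close>.\<close>

lemma simplicial_chain_map_boundary:
  assumes "finite {xs. c xs \<noteq> 0}"
  shows "simplicial_boundary (simplicial_chain_map f c) = simplicial_chain_map f (simplicial_boundary c)"
proof -
  let ?I = "{l. c l \<noteq> 0}"
  have delta: "simplicial_boundary (list_delta (map f l)) = simplicial_chain_map f (simplicial_boundary (list_delta l))" for l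
    by (cases l; cases "tl l")
      (auto simp: simplicial_boundary_delta simplicial_chain_map_delta simplicial_chain_map_def fun_eq_iff)
  have "simplicial_boundary (simplicial_chain_map f c) = (\<lambda>xs. \<Sum>l\<in>?I. c l * simplicial_boundary (list_delta (map f l)) xs)"
    by (subst sum_list_delta[OF assms, symmetric])
      (use assms in \<open>simp add: simplicial_chain_map_sum finite_support_scale finite_support_delta
        simplicial_chain_map_scale simplicial_chain_map_delta simplicial_boundary_sum simplicial_boundary_scale\<close>)
  also have "\<dots> = simplicial_chain_map f (simplicial_boundary c)"
    unfolding delta
    by (subst (3) sum_list_delta[OF assms, symmetric])
      (use assms in \<open>simp add: simplicial_chain_map_sum finite_support_scale finite_support_delta finite_support_boundary_delta
        simplicial_chain_map_scale simplicial_boundary_sum simplicial_boundary_scale\<close>)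
  finally show ?thesis .
qed

text \<open>An adjacent transposition as a total involution on lists that commutes with
  \<open>map\<close>, so that it can serve as a bijection between two fibres of
  \<open>map f\<close>.\<close>

definition swap_adj :: "nat \<Rightarrow> 'a list \<Rightarrow> 'a list" where
  "swap_adj i xs = (if Suc i < length xs then take i xs @ xs ! Suc i # xs ! i # drop (Suc (Suc i)) xs else xs)"

lemma swap_adj_append [simp]: "swap_adj (length xs) (xs @ a # b # ys) = xs @ b # a # ys"
  by (simp add: swap_adj_def nth_append)

lemma swap_adj_cases: 
  assumes "Suc i < length zs"
  obtains xs a b ys where "zs = xs @ a # b # ys" "length xs = i"
  using assms that[of "take i zs" "zs ! i" "zs ! Suc i" "drop (Suc (Suc i)) zs"]
  by (metis Cons_nth_drop_Suc Suc_lessD append_take_drop_id length_take min.absorb4)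

lemma swap_adj_swap_adj [simp]: "swap_adj i (swap_adj i zs) = zs"
proof (cases "Suc i < length zs")
  case True
  then obtain xs a b ys where "zs = xs @ a # b # ys" "length xs = i" by (rule swap_adj_cases)
  then show ?thesis using swap_adj_append by metis
qed (simp add: swap_adj_def)

lemma map_swap_adj: "map f (swap_adj i zs) = swap_adj i (map f zs)"
  by (auto simp: swap_adj_def take_map drop_map)

text \<open>For alternation, \<open>swap_adj\<close> exchanges the fibres of \<open>map f\<close>
  over the two lists and reverses the sign of \<open>c\<close>.\<close>

lemma simplicial_chain_map_in_chains:
  assumes c: "c \<in> simplicial_chains n K" and f: "\<And>\<sigma>. \<sigma> \<in> K \<Longrightarrow> f ` \<sigma> \<in> L"
  shows "simplicial_chain_map f c \<in> simplicial_chains n L"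
proof -
  note fin = simplicial_chainsD(1)[OF c]
  have "length ys = Suc n \<and> set ys \<in> L" if "simplicial_chain_map f c ys \<noteq> 0" for ys
  proof -
    have "\<exists>xs. c xs \<noteq> 0 \<and> map f xs = ys"
      using that unfolding simplicial_chain_map_def by (auto elim!: sum.not_neutral_contains_not_neutral)
    then obtain xs where "c xs \<noteq> 0" "map f xs = ys" by blast
    then show ?thesis using simplicial_chainsD(2)[OF c, of xs] f by auto
  qed
  moreover have "simplicial_chain_map f c (xs @ a # b # ys) = - simplicial_chain_map f c (xs @ b # a # ys)" for xs a b ys
  proof -
    let ?i = "length xs"
    have alt: "c (swap_adj ?i zs) = - c zs" if len: "Suc ?i < length zs" for zs
    proof -
      obtain us u v vs where z: "zs = us @ u # v # vs" "length us = ?i" using swap_adj_cases[OF len] by blast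
      then have "swap_adj ?i zs = us @ v # u # vs" using swap_adj_append by metis
      then show ?thesis using simplicial_chainsD(3)[OF c, of us v u vs] z by simp
    qed
    have len: "Suc ?i < length zs" if "map f zs = xs @ a # b # ys" for zs a b
      using arg_cong[OF that, of length] by simp
    have "simplicial_chain_map f c (xs @ a # b # ys) = (\<Sum>zs | c zs \<noteq> 0 \<and> map f zs = xs @ b # a # ys. - c zs)"
      unfolding simplicial_chain_map_def
    proof (rule sum.reindex_bij_witness[where i = "swap_adj ?i" and j = "swap_adj ?i"])
      fix zs assume "zs \<in> {zs. c zs \<noteq> 0 \<and> map f zs = xs @ a # b # ys}"
      then show "swap_adj ?i zs \<in> {zs. c zs \<noteq> 0 \<and> map f zs = xs @ b # a # ys}" "- c (swap_adj ?i zs) = c zs"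
        using alt[OF len[of zs a b]] by (auto simp: map_swap_adj)
    next
      fix zs assume "zs \<in> {zs. c zs \<noteq> 0 \<and> map f zs = xs @ b # a # ys}"
      then show "swap_adj ?i zs \<in> {zs. c zs \<noteq> 0 \<and> map f zs = xs @ a # b # ys}"
        using alt[OF len[of zs b a]] by (auto simp: map_swap_adj)
    qed auto
    then show ?thesis by (simp add: sum_negf simplicial_chain_map_def)
  qed
  ultimately show ?thesis using finite_support_chain_map[OF fin] unfolding simplicial_chains_def by blast
qed

lemma simplicial_chains_zero: "(\<lambda>_. 0) \<in> simplicial_chains n K"
  by (simp add: simplicial_chains_def)

lemma simplicial_chains_scale:
  assumes "c \<in> simplicial_chains n K" shows "(\<lambda>xs. k * c xs) \<in> simplicial_chains n K"
proof -
  note D = simplicial_chainsD[OF assms]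
  have "k * c (xs @ a # b # ys) = - (k * c (xs @ b # a # ys))" for xs a b ys
    using D(3)[of xs a b ys] by simp
  moreover have "length xs = Suc n \<and> set xs \<in> K" if "k * c xs \<noteq> 0" for xs
    using D(2)[of xs] that by simp
  ultimately show ?thesis using finite_support_scale[OF D(1)] unfolding simplicial_chains_def by blast
qed

lemma simplicial_chains_sum:
  "finite I \<Longrightarrow> (\<And>i. i \<in> I \<Longrightarrow> c i \<in> simplicial_chains n K) \<Longrightarrow> (\<lambda>xs. \<Sum>i\<in>I. c i xs) \<in> simplicial_chains n K"
  by (induction I rule: finite_induct) (auto intro: simplicial_chains_add simplicial_chains_zero)

lemma simplicial_chainsI:
  assumes "finite {xs. c xs \<noteq> 0}" "\<And>xs. c xs \<noteq> 0 \<Longrightarrow> length xs = Suc n \<and> set xs \<in> K"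
    "\<And>xs a b ys. c (xs @ a # b # ys) = - c (xs @ b # a # ys)"
  shows "c \<in> simplicial_chains n K"
  unfolding simplicial_chains_def
proof (intro CollectI conjI allI impI)
  show "c (xs @ a # b # ys) = - c (xs @ b # a # ys)" for xs a b ys by (rule assms(3))
qed (use assms(1,2) in auto)

section \<open>Oriented edges and triangles as alternating chains\<close>

definition edge_chain :: "'a \<Rightarrow> 'a \<Rightarrow> 'a list \<Rightarrow> int" where
  "edge_chain X Y xs = list_delta [X, Y] xs - list_delta [Y, X] xs"

lemma edge_chain_lin: "edge_chain X Y = (\<lambda>xs. list_delta [X, Y] xs - list_delta [Y, X] xs)"
  by (simp add: edge_chain_def fun_eq_iff)

lemma finite_support_edge_chain: "finite {xs. edge_chain X Y xs \<noteq> 0}"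
  unfolding edge_chain_lin by (intro finite_support_diff finite_support_delta)

lemma edge_chain_self: "edge_chain X X xs = 0"
  by (simp add: edge_chain_def)

lemma edge_chain_in_chains:
  assumes "{X, Y} \<in> K" shows "edge_chain X Y \<in> simplicial_chains 1 K"
proof -
  have alt: "edge_chain X Y (xs @ a # b # ys) = - edge_chain X Y (xs @ b # a # ys)" for xs a b ys
    by (cases xs; cases ys; cases "tl xs") (simp_all add: edge_chain_def list_delta_def conj_ac)
  have supp: "length xs = Suc 1 \<and> set xs \<in> K" if "edge_chain X Y xs \<noteq> 0" for xs
  proof -
    have "xs = [X, Y] \<or> xs = [Y, X]"
    proof (rule ccontr)
      assume "\<not> ?thesis"
      then have "edge_chain X Y xs = 0" by (simp add: edge_chain_def list_delta_def)
      then show False using that by simp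
    qed
    then have "set xs = {X, Y} \<and> length xs = 2" by auto
    then show ?thesis using assms by simp
  qed
  show ?thesis by (rule simplicial_chainsI[OF finite_support_edge_chain supp alt])
qed

lemma simplicial_boundary_edge_chain:
  "simplicial_boundary (edge_chain X Y) xs = list_delta [Y] xs - list_delta [X] xs"
  unfolding edge_chain_lin
  by (simp add: simplicial_boundary_diff finite_support_delta simplicial_boundary_delta)

lemma simplicial_chain_map_edge_chain: "simplicial_chain_map f (edge_chain X Y) = edge_chain (f X) (f Y)"
  unfolding edge_chain_lin
  by (simp add: simplicial_chain_map_diff finite_support_delta simplicial_chain_map_delta)

definition tri_chain :: "'a \<Rightarrow> 'a \<Rightarrow> 'a \<Rightarrow> 'a list \<Rightarrow> int" where
  "tri_chain X Y Z xs = list_delta [X, Y, Z] xs + list_delta [Y, Z, X] xs + list_delta [Z, X, Y] xs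
     - list_delta [X, Z, Y] xs - list_delta [Z, Y, X] xs - list_delta [Y, X, Z] xs"

lemma tri_chain_in_chains:
  assumes "{X, Y, Z} \<in> K" shows "tri_chain X Y Z \<in> simplicial_chains 2 K"
proof -
  have alt: "tri_chain X Y Z (xs @ a # b # ys) = - tri_chain X Y Z (xs @ b # a # ys)" for xs a b ys
  proof (cases xs)
    case (Cons x xs')
    then show ?thesis by (cases xs'; cases ys) (simp_all add: tri_chain_def list_delta_def conj_ac)
  next
    case Nil
    then show ?thesis by (cases ys; cases "tl ys") (simp_all add: tri_chain_def list_delta_def conj_ac)
  qed
  have supp: "length xs = Suc 2 \<and> set xs \<in> K" if "tri_chain X Y Z xs \<noteq> 0" for xs
  proof -
    have "xs \<in> {[X, Y, Z], [Y, Z, X], [Z, X, Y], [X, Z, Y], [Z, Y, X], [Y, X, Z]}"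
    proof (rule ccontr)
      assume "\<not> ?thesis"
      then have "tri_chain X Y Z xs = 0" by (simp add: tri_chain_def list_delta_def)
      then show False using that by simp
    qed
    then have "set xs = {X, Y, Z} \<and> length xs = 3" by auto
    then show ?thesis using assms by simp
  qed
  have fin: "finite {xs. tri_chain X Y Z xs \<noteq> 0}"
    unfolding tri_chain_def by (intro finite_support_add finite_support_diff finite_support_delta)
  show ?thesis by (rule simplicial_chainsI[OF fin supp alt])
qed

text \<open>Dropping the heads of the six orderings leaves the three sides in both directions, with
  the signs of the usual boundary of an ordered triangle.\<close>

lemma simplicial_boundary_tri_chain:
  "simplicial_boundary (tri_chain X Y Z) xs = edge_chain X Y xs + edge_chain Y Z xs - edge_chain X Z xs"
proof -
  have "tri_chain X Y Z = (\<lambda>xs. list_delta [X, Y, Z] xs + list_delta [Y, Z, X] xs + list_delta [Z, X, Y] xs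
     - list_delta [X, Z, Y] xs - list_delta [Z, Y, X] xs - list_delta [Y, X, Z] xs)"
    by (simp add: tri_chain_def fun_eq_iff)
  then have "simplicial_boundary (tri_chain X Y Z) = (\<lambda>xs. simplicial_boundary (list_delta [X, Y, Z]) xs
      + simplicial_boundary (list_delta [Y, Z, X]) xs + simplicial_boundary (list_delta [Z, X, Y]) xs
      - simplicial_boundary (list_delta [X, Z, Y]) xs - simplicial_boundary (list_delta [Z, Y, X]) xs
      - simplicial_boundary (list_delta [Y, X, Z]) xs)"
    by (simp only: simplicial_boundary_lin_add simplicial_boundary_diff finite_support_add finite_support_diff
        finite_support_delta)
  then show ?thesis by (simp add: simplicial_boundary_delta edge_chain_def)
qed

section \<open>Homology classes\<close>

definition cycles :: "nat \<Rightarrow> 'a set set \<Rightarrow> ('a list \<Rightarrow> int) set" where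
  "cycles n K = {c \<in> simplicial_chains n K. simplicial_boundary c = (\<lambda>_. 0)}"

text \<open>The coset of \<open>z\<close> in additive form, so that computations with classes become
  pointwise sums.\<close>

definition hclass :: "nat \<Rightarrow> 'a set set \<Rightarrow> ('a list \<Rightarrow> int) \<Rightarrow> ('a list \<Rightarrow> int) set" where
  "hclass n K z = {(\<lambda>xs. b xs + z xs) | b. b \<in> simplicial_boundaries n K}"

lemma carrier_cycle_group: "carrier (simplicial_cycle_group n K) = cycles n K"
  by (simp add: simplicial_cycle_group_def cycles_def)

lemma mult_cycle_group: "c \<otimes>\<^bsub>simplicial_cycle_group n K\<^esub> d = (\<lambda>xs. c xs + d xs)"
  by (simp add: simplicial_cycle_group_def)

lemma carrier_homology: "carrier (simplicial_homology n K) = hclass n K ` cycles n K"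
proof -
  have "simplicial_boundaries n K #>\<^bsub>simplicial_cycle_group n K\<^esub> z = hclass n K z" for z :: "'a list \<Rightarrow> int"
    by (auto simp: r_coset_def hclass_def mult_cycle_group)
  then show ?thesis
    by (auto simp: simplicial_homology_def FactGroup_def RCOSETS_def carrier_cycle_group)
qed

lemma zero_boundary: "(\<lambda>_. 0) \<in> simplicial_boundaries n K"
  unfolding simplicial_boundaries_def
  by (rule image_eqI[OF _ simplicial_chains_zero]) (simp add: simplicial_boundary_def fun_eq_iff)

lemma boundaries_add:
  assumes "b \<in> simplicial_boundaries n K" "b' \<in> simplicial_boundaries n K"
  shows "(\<lambda>xs. b xs + b' xs) \<in> simplicial_boundaries n K"
proof -
  obtain c c' where c: "c \<in> simplicial_chains (Suc n) K" "c' \<in> simplicial_chains (Suc n) K"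
    "b = simplicial_boundary c" "b' = simplicial_boundary c'"
    using assms by (auto simp: simplicial_boundaries_def)
  show ?thesis unfolding simplicial_boundaries_def
    by (rule image_eqI[OF _ simplicial_chains_add[OF c(1,2)]]) (simp add: simplicial_boundary_add[OF c(1,2)] c(3,4))
qed

lemma boundaries_uminus:
  assumes "b \<in> simplicial_boundaries n K" shows "(\<lambda>xs. - b xs) \<in> simplicial_boundaries n K"
proof -
  obtain c where c: "c \<in> simplicial_chains (Suc n) K" "b = simplicial_boundary c"
    using assms by (auto simp: simplicial_boundaries_def)
  show ?thesis unfolding simplicial_boundaries_def
    by (rule image_eqI[OF _ simplicial_chains_uminus[OF c(1)]]) (simp add: simplicial_boundary_uminus c(2))
qed

lemma hclassI: "b \<in> simplicial_boundaries n K \<Longrightarrow> (\<lambda>xs. b xs + z xs) \<in> hclass n K z"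
  by (auto simp: hclass_def)

lemma hclass_eqI:
  assumes "(\<lambda>xs. z xs - z' xs) \<in> simplicial_boundaries n K" shows "hclass n K z = hclass n K z'"
proof -
  have *: "hclass n K z \<subseteq> hclass n K z'" if "(\<lambda>xs. z xs - z' xs) \<in> simplicial_boundaries n K" for z z'
  proof
    fix y assume "y \<in> hclass n K z"
    then obtain b where b: "b \<in> simplicial_boundaries n K" "y = (\<lambda>xs. b xs + z xs)" by (auto simp: hclass_def)
    have "y = (\<lambda>xs. (b xs + (z xs - z' xs)) + z' xs)" using b by simp
    then show "y \<in> hclass n K z'" using hclassI[OF boundaries_add[OF b(1) that], of z'] by simp
  qed
  have "(\<lambda>xs. z' xs - z xs) \<in> simplicial_boundaries n K" using boundaries_uminus[OF assms] by simp
  then show ?thesis using * assms by blast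
qed

lemma mult_homology:
  "hclass n K z \<otimes>\<^bsub>simplicial_homology n K\<^esub> hclass n K z' = hclass n K (\<lambda>xs. z xs + z' xs)"
proof -
  have "hclass n K z \<otimes>\<^bsub>simplicial_homology n K\<^esub> hclass n K z' =
    {(\<lambda>xs. (b xs + z xs) + (b' xs + z' xs)) | b b'. b \<in> simplicial_boundaries n K \<and> b' \<in> simplicial_boundaries n K}"
    unfolding simplicial_homology_def FactGroup_def monoid.simps set_mult_def mult_cycle_group hclass_def by blast
  also have "\<dots> = hclass n K (\<lambda>xs. z xs + z' xs)"
  proof
    show "{(\<lambda>xs. (b xs + z xs) + (b' xs + z' xs)) | b b'. b \<in> simplicial_boundaries n K \<and> b' \<in> simplicial_boundaries n K}
      \<subseteq> hclass n K (\<lambda>xs. z xs + z' xs)"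
    proof clarify
      fix b b' assume "b \<in> simplicial_boundaries n K" "b' \<in> simplicial_boundaries n K"
      from hclassI[OF boundaries_add[OF this], of "\<lambda>xs. z xs + z' xs"]
      show "(\<lambda>xs. (b xs + z xs) + (b' xs + z' xs)) \<in> hclass n K (\<lambda>xs. z xs + z' xs)"
        by (simp add: algebra_simps)
    qed
    show "hclass n K (\<lambda>xs. z xs + z' xs) \<subseteq> {(\<lambda>xs. (b xs + z xs) + (b' xs + z' xs)) | b b'. b \<in> simplicial_boundaries n K \<and> b' \<in> simplicial_boundaries n K}"
    proof
      fix y assume "y \<in> hclass n K (\<lambda>xs. z xs + z' xs)"
      then obtain b where b: "b \<in> simplicial_boundaries n K" "y = (\<lambda>xs. b xs + (z xs + z' xs))" by (auto simp: hclass_def)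
      then have "y = (\<lambda>xs. (b xs + z xs) + ((\<lambda>_. 0) xs + z' xs))" by (simp add: algebra_simps)
      then show "y \<in> {(\<lambda>xs. (b xs + z xs) + (b' xs + z' xs)) | b b'. b \<in> simplicial_boundaries n K \<and> b' \<in> simplicial_boundaries n K}"
        using b(1) zero_boundary[of n K] by (intro CollectI exI[of _ b] exI[of _ "\<lambda>_. 0"]) simp
    qed
  qed
  finally show ?thesis .
qed

text \<open>The chain map commutes with the boundary, so it sends the class of \<open>z\<close> into
  a single coset; adding the boundaries of \<open>L\<close> fills that coset up.\<close>

lemma hom_induced_hclass:
  assumes f: "\<And>\<sigma>. \<sigma> \<in> K \<Longrightarrow> f ` \<sigma> \<in> L" and z: "finite {xs. z xs \<noteq> 0}"
  shows "simplicial_hom_induced n L f (hclass n K z) = hclass n L (simplicial_chain_map f z)"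
proof -
  have img: "simplicial_chain_map f b \<in> simplicial_boundaries n L \<and> finite {xs. b xs \<noteq> 0}"
    if "b \<in> simplicial_boundaries n K" for b
  proof -
    obtain c where c: "c \<in> simplicial_chains (Suc n) K" "b = simplicial_boundary c"
      using \<open>b \<in> _\<close> by (auto simp: simplicial_boundaries_def)
    have "simplicial_chain_map f b = simplicial_boundary (simplicial_chain_map f c)"
      using simplicial_chain_map_boundary[OF simplicial_chainsD(1)[OF c(1)], of f] c(2) by metis
    then show ?thesis using simplicial_chain_map_in_chains[OF c(1) f]
        finite_support_boundary[OF simplicial_chainsD(1)[OF c(1)]] c(2)
      by (auto simp: simplicial_boundaries_def)
  qed
  have eq: "simplicial_hom_induced n L f (hclass n K z) =
    {(\<lambda>xs. b xs + simplicial_chain_map f (\<lambda>xs. b' xs + z xs) xs) | b b'. b \<in> simplicial_boundaries n L \<and> b' \<in> simplicial_boundaries n K}"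
    unfolding simplicial_hom_induced_def set_mult_def hclass_def mult_cycle_group by blast
  show ?thesis
  proof
    show "simplicial_hom_induced n L f (hclass n K z) \<subseteq> hclass n L (simplicial_chain_map f z)"
      unfolding eq
    proof clarify
      fix b b' assume b: "b \<in> simplicial_boundaries n L" and b': "b' \<in> simplicial_boundaries n K"
      have "(\<lambda>xs. b xs + simplicial_chain_map f (\<lambda>xs. b' xs + z xs) xs)
        = (\<lambda>xs. (b xs + simplicial_chain_map f b' xs) + simplicial_chain_map f z xs)"
        using simplicial_chain_map_add[of b' z f] img[OF b'] z by (simp add: add.assoc)
      then show "(\<lambda>xs. b xs + simplicial_chain_map f (\<lambda>xs. b' xs + z xs) xs) \<in> hclass n L (simplicial_chain_map f z)"
        using hclassI[OF boundaries_add[OF b], of "simplicial_chain_map f b'"] img[OF b'] by simp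
    qed
    show "hclass n L (simplicial_chain_map f z) \<subseteq> simplicial_hom_induced n L f (hclass n K z)"
    proof
      fix y assume "y \<in> hclass n L (simplicial_chain_map f z)"
      then obtain b where b: "b \<in> simplicial_boundaries n L" "y = (\<lambda>xs. b xs + simplicial_chain_map f z xs)"
        by (auto simp: hclass_def)
      have "y = (\<lambda>xs. b xs + simplicial_chain_map f (\<lambda>xs. (\<lambda>_. 0) xs + z xs) xs)" using b by simp
      then show "y \<in> simplicial_hom_induced n L f (hclass n K z)"
        unfolding eq using b(1) zero_boundary[of n K] by (intro CollectI exI[of _ b] exI[of _ "\<lambda>_. 0"]) simp
    qed
  qed
qed

lemma chain_map_cycles:
  assumes "z \<in> cycles n K" "\<And>\<sigma>. \<sigma> \<in> K \<Longrightarrow> f ` \<sigma> \<in> L"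
  shows "simplicial_chain_map f z \<in> cycles n L"
  using assms simplicial_chain_map_in_chains[of z n K f L]
    simplicial_chain_map_boundary[of z f, OF simplicial_chainsD(1)[of z n K]]
  by (simp add: cycles_def simplicial_chain_map_def fun_eq_iff)

lemma nerve_projection:
  assumes "refinement_projection \<U>' \<U> p" "\<sigma> \<in> nerve \<U>'" shows "p ` \<sigma> \<in> nerve \<U>"
proof -
  have "\<Inter>\<sigma> \<subseteq> \<Inter>(p ` \<sigma>)" using assms by (fastforce simp: refinement_projection_def nerve_def)
  then show ?thesis using assms by (fastforce simp: refinement_projection_def nerve_def)
qed

section \<open>Covers whose nerves are graphs\<close>

context lf_graph
begin

text \<open>Three is the least number of parts that makes the subdivided graph simple even where
  contraction turns an edge into a loop: one part would leave the loop, two parts a pair of parallel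
  edges, and a simplicial complex sees neither.\<close>

definition admissible :: "'e set \<Rightarrow> nat \<Rightarrow> bool" where
  "admissible F M \<longleftrightarrow> finite F \<and> F \<subseteq> E \<and> 3 \<le> M"

definition starset :: "'e set \<Rightarrow> nat \<Rightarrow> 'v set \<Rightarrow> ('v, 'e) point set" where
  "starset F M K = piece F K \<union> {epoint e t | e t. e \<in> F \<and> 0 < t \<and> t < 1 \<and>
     ((src e \<in> K \<and> real M * t < 1) \<or> (tgt e \<in> K \<and> real M - 1 < real M * t))}"

definition seg :: "nat \<Rightarrow> 'e \<Rightarrow> nat \<Rightarrow> ('v, 'e) point set" where
  "seg M e j = {epoint e t | t. 0 < t \<and> t < 1 \<and> \<bar>real M * t - real j\<bar> < 1}"

text \<open>The \<open>j\<close>-th vertex on the path that replaces \<open>e\<close> in the nerve.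
  The values at \<open>0\<close> and \<open>M\<close> are the contracted components at the ends of
  \<open>e\<close>, and they coincide if both ends lie in the same component.\<close>

definition node :: "'e set \<Rightarrow> nat \<Rightarrow> 'e \<Rightarrow> nat \<Rightarrow> ('v, 'e) point set" where
  "node F M e j = (if j = 0 then starset F M (comp_of G F (src e))
     else if j = M then starset F M (comp_of G F (tgt e)) else seg M e j)"

definition star_cover :: "'e set \<Rightarrow> nat \<Rightarrow> ('v, 'e) point set set" where
  "star_cover F M = starset F M ` comps G F \<union> {seg M e j | e j. e \<in> F \<and> 0 < j \<and> j < M}"

lemma Vertex_starset [simp]: "Vertex v \<in> starset F M K \<longleftrightarrow> v \<in> K"
  by (auto simp: starset_def Vertex_epoint_iff)

lemma End_starset [simp]: "End w \<in> starset F M K \<longleftrightarrow> w \<in> graph_ends G \<and> end_in w K"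
  by (auto simp: starset_def)

lemma starset_inj: "starset F M K = starset F M K' \<longleftrightarrow> K = K'"
proof
  assume eq: "starset F M K = starset F M K'"
  have "K = {v. Vertex v \<in> starset F M K}" for K by simp
  then show "K = K'" using eq by metis
qed simp

lemma epoint_starset:
  assumes "F \<subseteq> E" "e \<in> E" "0 < t" "t < 1"
  shows "epoint e t \<in> starset F M K \<longleftrightarrow> (if e \<in> F then (src e \<in> K \<and> real M * t < 1) \<or> (tgt e \<in> K \<and> real M - 1 < real M * t)
     else src e \<in> K \<and> tgt e \<in> K)"
proof -
  have "epoint e t \<in> {epoint e t | e t. e \<in> F \<and> 0 < t \<and> t < 1 \<and>
     ((src e \<in> K \<and> real M * t < 1) \<or> (tgt e \<in> K \<and> real M - 1 < real M * t))} \<longleftrightarrow>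
     e \<in> F \<and> ((src e \<in> K \<and> real M * t < 1) \<or> (tgt e \<in> K \<and> real M - 1 < real M * t))"
    using epoint_inj[of e t] assms by blast
  then show ?thesis using epoint_piece[OF assms(2-4), of F K] by (auto simp: starset_def)
qed

lemma epoint_seg:
  assumes "0 < t" "t < 1"
  shows "epoint e t \<in> seg M e' j \<longleftrightarrow> e = e' \<and> \<bar>real M * t - real j\<bar> < 1"
  using assms epoint_inj[of e t] unfolding seg_def by blast

lemma node_in_star_cover: "admissible F M \<Longrightarrow> e \<in> F \<Longrightarrow> j \<le> M \<Longrightarrow> node F M e j \<in> star_cover F M"
proof -
  assume F: "admissible F M" and e: "e \<in> F" and j: "j \<le> M"
  have "e \<in> E" using F e by (auto simp: admissible_def)
  then have *: "comp_of G F (src e) \<in> comps G F" "comp_of G F (tgt e) \<in> comps G F"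
    using src_V tgt_V comp_of_in_comps[of _ G F] by simp_all
  consider "j = 0" | "j = M" "j \<noteq> 0" | "0 < j" "j < M" using j by linarith
  then show "node F M e j \<in> star_cover F M" by cases (use * e in \<open>auto simp: node_def star_cover_def\<close>)
qed

text \<open>The inequality also describes the two stars at the ends: it reads \<open>M t < 1\<close>
  for \<open>j = 0\<close> and \<open>M - 1 < M t\<close> for \<open>j = M\<close>. One formula thus
  governs all overlaps on an edge.\<close>

lemma epoint_in_star_cover_iff:
  assumes F: "admissible F M" and e: "e \<in> F" and t: "0 < t" "t < 1" and X: "X \<in> star_cover F M"
  shows "epoint e t \<in> X \<longleftrightarrow> (\<exists>j\<le>M. X = node F M e j \<and> \<bar>real M * t - real j\<bar> < 1)"
proof
  have FE: "F \<subseteq> E" "e \<in> E" "M > 0" using F e by (auto simp: admissible_def)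
  have Mt: "0 < real M * t" "real M * t < real M" using t FE by auto
  assume p: "epoint e t \<in> X"
  consider K where "K \<in> comps G F" "X = starset F M K" | e' j where "e' \<in> F" "0 < j" "j < M" "X = seg M e' j"
    using X by (auto simp: star_cover_def)
  then show "\<exists>j\<le>M. X = node F M e j \<and> \<bar>real M * t - real j\<bar> < 1"
  proof cases
    case 1
    then consider "src e \<in> K" "real M * t < 1" | "tgt e \<in> K" "real M - 1 < real M * t"
      using p epoint_starset[OF FE(1,2) t] e by auto
    then show ?thesis
    proof cases
      case 1
      then have "X = node F M e 0" using comps_mem_eq[OF \<open>K \<in> comps G F\<close>] \<open>X = _\<close> by (simp add: node_def)
      then show ?thesis using 1 Mt by (intro exI[of _ 0]) auto
    next
      case 2
      then have "X = node F M e M" using comps_mem_eq[OF \<open>K \<in> comps G F\<close>] \<open>X = _\<close> FE by (simp add: node_def)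
      then show ?thesis using 2 Mt by (intro exI[of _ M]) auto
    qed
  next
    case 2
    then have "e = e'" "\<bar>real M * t - real j\<bar> < 1" using p epoint_seg[OF t] by auto
    moreover have "X = node F M e j" using 2 \<open>e = e'\<close> by (simp add: node_def)
    ultimately show ?thesis using 2 by (intro exI[of _ j]) auto
  qed
next
  have FE: "F \<subseteq> E" "e \<in> E" "M > 0" using F e by (auto simp: admissible_def)
  assume "\<exists>j\<le>M. X = node F M e j \<and> \<bar>real M * t - real j\<bar> < 1"
  then obtain j where "j \<le> M" "X = node F M e j" "\<bar>real M * t - real j\<bar> < 1" by blast
  then show "epoint e t \<in> X" using epoint_starset[OF FE(1,2) t] epoint_seg[OF t] e FE
    by (auto simp: node_def split: if_splits)
qed

text \<open>A piece meets only one member of the cover, so two members can meet only in inner points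
  of edges of \<open>F\<close>; \<open>star_cover_meet\<close> draws this conclusion.\<close>

lemma piece_in_star_cover_iff:
  assumes F: "admissible F M" and K: "K \<in> comps G F" and p: "p \<in> piece F K" and X: "X \<in> star_cover F M"
  shows "p \<in> X \<longleftrightarrow> X = starset F M K"
proof
  assume "X = starset F M K" then show "p \<in> X" using p by (simp add: starset_def)
next
  assume pX: "p \<in> X"
  have FE: "F \<subseteq> E" using F by (auto simp: admissible_def)
  from X consider K' where "K' \<in> comps G F" "X = starset F M K'" | e' j where "e' \<in> F" "0 < j" "j < M" "X = seg M e' j"
    by (auto simp: star_cover_def)
  then show "X = starset F M K"
  proof cases
    case 1
    from piece_points[OF K] p have "p \<in> points" by blast
    then have "K \<inter> K' \<noteq> {}"
    proof (cases rule: points_cases)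
      case (V v)
      then show ?thesis using p pX 1 by auto
    next
      case (E e t)
      then have "e \<notin> F" "src e \<in> K" using p epoint_piece by auto
      then show ?thesis using E pX 1 epoint_starset[OF FE E(1-3)] by auto
    next
      case (End w)
      then show ?thesis using p pX 1 end_in_meet by auto
    qed
    then obtain v where "v \<in> K" "v \<in> K'" by blast
    then have "K' = K" using comps_eqI[OF 1(1) K] by simp
    then show ?thesis using 1 by simp
  next
    case 2
    then obtain t where "p = epoint e' t" "0 < t" "t < 1" using pX by (auto simp: seg_def)
    then have False using p epoint_piece[of e' t F K] 2 FE by auto
    then show ?thesis ..
  qed
qed

lemma points_piece_or_edge:
  assumes F: "finite F" "F \<subseteq> E" and p: "p \<in> points"
  obtains K where "K \<in> comps G F" "p \<in> piece F K" | e t where "e \<in> F" "0 < t" "t < 1" "p = epoint e t"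
  using p
proof (cases rule: points_cases)
  case (V v)
  then show ?thesis using that(1)[OF comp_of_in_comps[of v G F]] by simp
next
  case (E e t)
  show ?thesis
  proof (cases "e \<in> F")
    case False
    have K: "comp_of G F (src e) \<in> comps G F" using comp_of_in_comps[OF src_V[OF E(1)]] .
    have "tgt e \<in> comp_of G F (src e)"
      using comps_edge[OF K, of e "src e" "tgt e"] E False endpts_eq by auto
    then show ?thesis using that(1)[OF K] E False epoint_piece by simp
  qed (use that(2) E in blast)
next
  case (End w)
  then obtain K where "K \<in> comps G F" "end_in w K" using end_comp F by blast
  then show ?thesis using that(1)[of K] End by simp
qed

lemma starset_points: "admissible F M \<Longrightarrow> K \<in> comps G F \<Longrightarrow> starset F M K \<subseteq> points"
  using piece_points[of K F] unfolding starset_def admissible_def by (auto intro!: epoint_points)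

lemma star_cover_points: "admissible F M \<Longrightarrow> X \<in> star_cover F M \<Longrightarrow> X \<subseteq> points"
  using starset_points[of F M] unfolding star_cover_def seg_def admissible_def by (auto intro!: epoint_points)

lemma star_cover_cover:
  assumes F: "admissible F M" and p: "p \<in> points" shows "\<exists>X\<in>star_cover F M. p \<in> X"
proof -
  have FE: "finite F" "F \<subseteq> E" "M > 0" using F by (auto simp: admissible_def)
  show ?thesis using points_piece_or_edge[OF FE(1,2) p]
  proof cases
    case (1 K)
    then show ?thesis unfolding star_cover_def starset_def by blast
  next
    case (2 e t)
    define j where "j = nat \<lfloor>real M * t\<rfloor>"
    have Mt: "0 < real M * t" "real M * t < real M" using 2 FE by auto
    have j: "\<bar>real M * t - real j\<bar> < 1" using Mt unfolding j_def by linarith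
    have jM: "j \<le> M" using Mt unfolding j_def by linarith
    then show ?thesis using epoint_in_star_cover_iff[OF F 2(1-3) node_in_star_cover[OF F 2(1) jM]] j 2(4) node_in_star_cover[OF F 2(1) jM] by blast
  qed
qed

lemma openin_starset:
  assumes F: "admissible F M" and K: "K \<in> comps G F" shows "openin (freudenthal G) (starset F M K)"
  unfolding openin_freudenthal_iff
proof (intro conjI allI ballI impI)
  have FE: "finite F" "F \<subseteq> E" "M > 1" using F by (auto simp: admissible_def)
  show "starset F M K \<subseteq> points" using starset_points[OF F K] .
  show "end_nbhd (starset F M K) w" if "End w \<in> starset F M K" for w
    using that FE K unfolding end_nbhd_def starset_def
    by (intro exI[of _ F] exI[of _ K]) auto
  fix e assume e: "e \<in> E"
  show "open_trace e (starset F M K)"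
  proof (cases "e \<in> F")
    case True
    define O' where "O' = (if src e \<in> K then {..<1 / real M} else {}) \<union> (if tgt e \<in> K then {1 - 1 / real M<..} else {})"
    have M1: "1 / real M < 1" "1 - 1 / real M > 0" using FE by auto
    have M2: "real M * t < 1 \<longleftrightarrow> t < 1 / real M" "real M - 1 < real M * t \<longleftrightarrow> 1 - 1 / real M < t" for t
      using FE by (auto simp: field_simps)
    have "epoint e t \<in> starset F M K \<longleftrightarrow> t \<in> O'" if t: "t \<in> {0..1}" for t
    proof -
      consider "t = 0" | "t = 1" | "0 < t" "t < 1" using t by fastforce
      then show ?thesis
      proof cases
        case 3
        then show ?thesis using epoint_starset[OF FE(2) e 3] True M2 by (auto simp: O'_def)
      qed (use FE M1 in \<open>auto simp: O'_def\<close>)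
    qed
    then have "edge_trace e (starset F M K) = {0..1} \<inter> O'" by (auto simp: edge_trace_def)
    moreover have "open O'" by (auto simp: O'_def)
    ultimately show ?thesis unfolding open_trace_def openin_open by blast
  next
    case False
    have iff: "src e \<in> K \<longleftrightarrow> tgt e \<in> K"
      using comps_edge[OF K, of e] e False endpts_eq[OF e] by (auto simp: insert_commute)
    have "epoint e t \<in> starset F M K \<longleftrightarrow> src e \<in> K" if t: "t \<in> {0..1}" for t
    proof -
      consider "t = 0" | "t = 1" | "0 < t" "t < 1" using t by fastforce
      then show ?thesis
        by cases (use epoint_starset[OF FE(2) e] False iff in auto)
    qed
    then have "edge_trace e (starset F M K) = (if src e \<in> K then {0..1} else {})" by (auto simp: edge_trace_def)
    then show ?thesis unfolding open_trace_def by simp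
  qed
qed

lemma openin_seg:
  assumes e: "e \<in> E" and j: "0 < j" "j < M" shows "openin (freudenthal G) (seg M e j)"
  unfolding openin_freudenthal_iff
proof (intro conjI allI ballI impI)
  show "seg M e j \<subseteq> points" using e epoint_points by (auto simp: seg_def)
  show "end_nbhd (seg M e j) w" if "End w \<in> seg M e j" for w using that by (auto simp: seg_def)
  fix e' assume e': "e' \<in> E"
  have "epoint e' t \<in> seg M e j \<longleftrightarrow> e' = e \<and> t \<in> {(real j - 1) / M<..<(real j + 1) / M}" if t: "t \<in> {0..1}" for t
  proof -
    consider "t = 0 \<or> t = 1" | "0 < t" "t < 1" using t by fastforce
    then show ?thesis
    proof cases
      case 1
      then have "epoint e' t \<notin> seg M e j" by (auto simp: seg_def Vertex_epoint_iff)
      moreover have "t \<notin> {(real j - 1) / M<..<(real j + 1) / M}" using 1 j by (auto simp: field_simps)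
      ultimately show ?thesis by blast
    next
      case 2
      then show ?thesis using j epoint_seg[OF 2] by (auto simp: field_simps abs_less_iff)
    qed
  qed
  then have "edge_trace e' (seg M e j) = {0..1} \<inter> (if e' = e then {(real j - 1) / M<..<(real j + 1) / M} else {})"
    by (auto simp: edge_trace_def)
  then show "open_trace e' (seg M e j)" unfolding open_trace_def openin_open by auto
qed

lemma star_cover_open_cover: assumes F: "admissible F M" shows "star_cover F M \<in> open_covers (freudenthal G)"
proof -
  have "openin (freudenthal G) X" if "X \<in> star_cover F M" for X
    using that F openin_starset[OF F] openin_seg unfolding star_cover_def admissible_def by auto
  moreover have "\<Union>(star_cover F M) = points" using star_cover_cover[OF F] star_cover_points[OF F] by blast
  ultimately show ?thesis by (simp add: open_covers_def)
qed

text \<open>The centre of an inner segment, at parameter \<open>j / M\<close>, lies in no other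
  node. The first index is inner because end nodes of different edges may coincide.\<close>

lemma node_inj:
  assumes F: "admissible F M" and e: "e \<in> F" "0 < j" "j < M" and e': "e' \<in> F" "j' \<le> M"
    and eq: "node F M e j = node F M e' j'"
  shows "e = e' \<and> j = j'"
proof -
  define t where "t = real j / real M"
  have t: "0 < t" "t < 1" "real M * t = real j" using e by (auto simp: t_def)
  have p: "epoint e t \<in> node F M e j"
    by (rule epoint_in_star_cover_iff[OF F e(1) t(1,2) node_in_star_cover[OF F e(1)], THEN iffD2]) (use e t in \<open>auto intro!: exI[of _ j]\<close>)
  show ?thesis
  proof (cases "0 < j' \<and> j' < M")
    case True
    then have "epoint e t \<in> seg M e' j'" using p eq by (simp add: node_def)
    then show ?thesis using epoint_seg[OF t(1,2)] t(3) by auto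
  next
    case False
    then have "\<exists>K. node F M e' j' = starset F M K" using e' by (auto simp: node_def)
    then obtain K where "node F M e' j' = starset F M K" by blast
    then have "real j < 1 \<or> real M - 1 < real j" 
      using p eq epoint_starset[of F e t M K] t F e by (auto simp: admissible_def)
    then show ?thesis using e by linarith
  qed
qed

lemma star_cover_meet:
  assumes F: "admissible F M" and XY: "X \<in> star_cover F M" "Y \<in> star_cover F M" "X \<noteq> Y" and p: "p \<in> X" "p \<in> Y"
  obtains e t where "e \<in> F" "0 < t" "t < 1" "p = epoint e t"
proof -
  have FE: "finite F" "F \<subseteq> E" "M > 0" using F by (auto simp: admissible_def)
  have "p \<in> points" using star_cover_points[OF F XY(1)] p by blast
  with FE(1,2) show thesis
  proof (cases rule: points_piece_or_edge)
    case (1 K)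
    then have False using piece_in_star_cover_iff[OF F 1] XY p by auto
    then show ?thesis ..
  qed (rule that)
qed

text \<open>Both indices are within distance less than 1 of the same number \<open>M t\<close>, so
  they differ by exactly one.\<close>

lemma nerve_star_cover_edge:
  assumes F: "admissible F M" and XY: "X \<in> star_cover F M" "Y \<in> star_cover F M" "X \<noteq> Y" "X \<inter> Y \<noteq> {}"
  obtains e j where "e \<in> F" "j < M" "X = node F M e j \<and> Y = node F M e (Suc j) \<or> X = node F M e (Suc j) \<and> Y = node F M e j"
proof -
  obtain p where p: "p \<in> X" "p \<in> Y" using XY by blast
  obtain e t where e: "e \<in> F" "0 < t" "t < 1" "p = epoint e t" using star_cover_meet[OF F XY(1-3) p] .
  obtain i where i: "i \<le> M" "X = node F M e i" "\<bar>real M * t - real i\<bar> < 1"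
    using epoint_in_star_cover_iff[OF F e(1-3) XY(1)] p e by auto
  obtain j where j: "j \<le> M" "Y = node F M e j" "\<bar>real M * t - real j\<bar> < 1"
    using epoint_in_star_cover_iff[OF F e(1-3) XY(2)] p e by auto
  have "i \<noteq> j" using i j XY by auto
  then have "i = Suc j \<or> j = Suc i" using i j by linarith
  then show thesis using that[OF e(1), of i] that[OF e(1), of j] i j by auto
qed

lemma node_pair_nerve:
  assumes F: "admissible F M" and e: "e \<in> F" "j < M"
  shows "{node F M e j, node F M e (Suc j)} \<in> nerve (star_cover F M)"
proof -
  \<comment> \<open>The point halfway between the centres of the two nodes.\<close>
  define t where "t = (real j + 1 / 2) / real M"
  have M: "real j + 1 \<le> real M" using e by linarith
  have t: "0 < t" "t < 1" "real M * t = real j + 1 / 2" using M by (auto simp: t_def)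
  have "epoint e t \<in> node F M e i" if i: "i = j \<or> i = Suc j" for i
    by (rule epoint_in_star_cover_iff[OF F e(1) t(1,2) node_in_star_cover[OF F e(1)], THEN iffD2]) (use e t i in \<open>auto intro!: exI[of _ i]\<close>)
  then have "epoint e t \<in> node F M e j" "epoint e t \<in> node F M e (Suc j)" by auto
  then show ?thesis using node_in_star_cover[OF F e(1)] e unfolding nerve_def by auto
qed

text \<open>Members that share a point have indices at distance less than 1 from one real number,
  and at most two integers satisfy this.\<close>

lemma nerve_star_cover_card:
  assumes F: "admissible F M" and s: "\<sigma> \<in> nerve (star_cover F M)" shows "card \<sigma> \<le> 2"
proof (rule ccontr)
  assume "\<not> card \<sigma> \<le> 2"
  then have "3 \<le> card \<sigma>" by simp
  then obtain T where "T \<subseteq> \<sigma>" "card T = 3" by (meson obtain_subset_with_card_n)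
  then obtain X Y Z where XYZ: "X \<in> \<sigma>" "Y \<in> \<sigma>" "Z \<in> \<sigma>" "X \<noteq> Y" "X \<noteq> Z" "Y \<noteq> Z" by (auto simp: card_3_iff)
  obtain p where "p \<in> \<Inter>\<sigma>" using s by (auto simp: nerve_def)
  then have p: "p \<in> X" "p \<in> Y" "p \<in> Z" using XYZ by auto
  have star_cover: "X \<in> star_cover F M" "Y \<in> star_cover F M" "Z \<in> star_cover F M" using s XYZ by (auto simp: nerve_def)
  obtain e t where e: "e \<in> F" "0 < t" "t < 1" "p = epoint e t" using star_cover_meet[OF F star_cover(1,2) XYZ(4) p(1,2)] .
  obtain i where i: "X = node F M e i" "\<bar>real M * t - real i\<bar> < 1"
    using epoint_in_star_cover_iff[OF F e(1-3) star_cover(1)] p e by auto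
  obtain j where j: "Y = node F M e j" "\<bar>real M * t - real j\<bar> < 1"
    using epoint_in_star_cover_iff[OF F e(1-3) star_cover(2)] p e by auto
  obtain k where k: "Z = node F M e k" "\<bar>real M * t - real k\<bar> < 1"
    using epoint_in_star_cover_iff[OF F e(1-3) star_cover(3)] p e by auto
  have "i \<noteq> j" "i \<noteq> k" "j \<noteq> k" using i j k XYZ by auto
  then show False using i(2) j(2) k(2) by linarith
qed

lemma alternating_repeat:
  assumes "c \<in> simplicial_chains n K" shows "c (xs @ a # a # ys) = (0::int)"
  using simplicial_chainsD(3)[OF assms, of xs a a ys] by simp

text \<open>A 2-chain is supported on lists of three entries with at most two distinct ones, and
  alternation makes its coefficients vanish there. Passing to homology therefore identifies no two
  cycles.\<close>

lemma boundaries_star_cover: assumes F: "admissible F M" shows "simplicial_boundaries 1 (nerve (star_cover F M)) = {\<lambda>_. 0}"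
proof -
  have zero: "c = (\<lambda>_. 0)" if c: "c \<in> simplicial_chains (Suc 1) (nerve (star_cover F M))" for c
  proof
    fix xs
    show "c xs = 0"
    proof (rule ccontr)
      assume nz: "c xs \<noteq> 0"
      then have xs: "length xs = 3" "card (set xs) \<le> 2" 
        using simplicial_chainsD(2)[OF c nz] nerve_star_cover_card[OF F] by auto
      then obtain x y z where "xs = [x, y, z]" by (auto simp: numeral_3_eq_3 length_Suc_conv)
      moreover have "x = y \<or> y = z \<or> x = z" using xs calculation by (auto simp: card_insert_if split: if_splits)
      moreover have "c [x, z, y] = - c [x, y, z]" using simplicial_chainsD(3)[OF c, of "[x]" z y "[]"] by simp
      ultimately show False using nz alternating_repeat[OF c, of "[]" x "[z]"] alternating_repeat[OF c, of "[x]" z "[]"]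
          alternating_repeat[OF c, of "[]" x "[y]"] by auto
    qed
  qed
  show ?thesis
  proof
    show "simplicial_boundaries 1 (nerve (star_cover F M)) \<subseteq> {\<lambda>_. 0}"
      using zero by (auto simp: simplicial_boundaries_def simplicial_boundary_def fun_eq_iff)
  qed (use zero_boundary in auto)
qed

lemma hclass_star_cover: "admissible F M \<Longrightarrow> hclass 1 (nerve (star_cover F M)) z = {z}"
  unfolding hclass_def boundaries_star_cover by auto

section \<open>Cycles of the nerve as flows on \<open>F\<close>\<close>

definition flow_chain :: "'e set \<Rightarrow> nat \<Rightarrow> ('e \<Rightarrow> int) \<Rightarrow> ('v, 'e) point set list \<Rightarrow> int" where
  "flow_chain F M \<psi> xs = (\<Sum>e\<in>F. \<psi> e * (\<Sum>j<M. edge_chain (node F M e j) (node F M e (Suc j)) xs))"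

abbreviation crossing :: "'v set \<Rightarrow> 'e \<Rightarrow> int" where
  "crossing K e \<equiv> of_bool (tgt e \<in> K) - of_bool (src e \<in> K)"

text \<open>Kirchhoff's law in the graph that arises by contracting the components of
  \<open>G - F\<close>: an edge counts for \<open>K\<close> only if exactly one of its ends lies in
  \<open>K\<close>.\<close>

definition balanced :: "'e set \<Rightarrow> ('e \<Rightarrow> int) \<Rightarrow> bool" where
  "balanced F \<psi> \<longleftrightarrow> (\<forall>K\<in>comps G F. (\<Sum>e\<in>F. \<psi> e * crossing K e) = 0)"

lemma finite_support_path_chain:
  "finite {xs. (\<Sum>j<M. edge_chain (g j) (g (Suc j)) xs) \<noteq> 0}"
  by (intro finite_support_sum finite_support_edge_chain) simp

lemma finite_support_flow_chain: "finite F \<Longrightarrow> finite {xs. flow_chain F M \<psi> xs \<noteq> 0}"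
  unfolding flow_chain_def by (intro finite_support_sum finite_support_scale finite_support_edge_chain) auto

lemma flow_chain_in_chains:
  assumes F: "admissible F M" shows "flow_chain F M \<psi> \<in> simplicial_chains 1 (nerve (star_cover F M))"
proof -
  have "finite F" using F by (simp add: admissible_def)
  then have "(\<lambda>xs. \<Sum>e\<in>F. \<psi> e * (\<Sum>j<M. edge_chain (node F M e j) (node F M e (Suc j)) xs)) \<in> simplicial_chains 1 (nerve (star_cover F M))"
    by (intro simplicial_chains_sum simplicial_chains_scale edge_chain_in_chains node_pair_nerve[OF F]) auto
  then show ?thesis unfolding flow_chain_def[abs_def] by simp
qed

lemma boundary_path_chain:
  "simplicial_boundary (\<lambda>xs. \<Sum>j<M. edge_chain (g j) (g (Suc j)) xs) xs = list_delta [g M] xs - list_delta [g 0] xs"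
proof -
  have "simplicial_boundary (\<lambda>xs. \<Sum>j<M. edge_chain (g j) (g (Suc j)) xs) xs =
    (\<Sum>j<M. list_delta [g (Suc j)] xs - list_delta [g j] xs)"
    by (simp add: simplicial_boundary_sum finite_support_edge_chain simplicial_boundary_edge_chain)
  also have "\<dots> = list_delta [g M] xs - list_delta [g 0] xs"
    by (rule sum_lessThan_telescope)
  finally show ?thesis .
qed

lemma boundary_flow_chain:
  assumes "finite F"
  shows "simplicial_boundary (flow_chain F M \<psi>) xs = (\<Sum>e\<in>F. \<psi> e * (list_delta [node F M e M] xs - list_delta [node F M e 0] xs))"
proof -
  have "simplicial_boundary (flow_chain F M \<psi>) =
    (\<lambda>xs. \<Sum>e\<in>F. \<psi> e * simplicial_boundary (\<lambda>xs. \<Sum>j<M. edge_chain (node F M e j) (node F M e (Suc j)) xs) xs)"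
    unfolding flow_chain_def[abs_def]
    by (subst simplicial_boundary_sum[OF assms])
      (simp_all add: finite_support_scale finite_support_path_chain simplicial_boundary_scale)
  then show ?thesis by (simp add: boundary_path_chain)
qed

lemma node_end_iff:
  assumes F: "admissible F M" and e: "e \<in> F" and K: "K \<in> comps G F"
  shows "node F M e 0 = starset F M K \<longleftrightarrow> src e \<in> K" "node F M e M = starset F M K \<longleftrightarrow> tgt e \<in> K"
proof -
  have "comp_of G F v = K \<longleftrightarrow> v \<in> K" for v using comps_mem_eq[OF K, of v] comp_of_self by metis
  then show "node F M e 0 = starset F M K \<longleftrightarrow> src e \<in> K" "node F M e M = starset F M K \<longleftrightarrow> tgt e \<in> K"
    using F by (simp_all add: node_def starset_inj admissible_def)
qed

text \<open>Along each path the boundary telescopes; what remains at the star of \<open>K\<close> is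
  the net inflow into \<open>K\<close>.\<close>

lemma flow_chain_cycle_iff:
  assumes F: "admissible F M" shows "flow_chain F M \<psi> \<in> cycles 1 (nerve (star_cover F M)) \<longleftrightarrow> balanced F \<psi>"
proof -
  have fin: "finite F" and FE: "F \<subseteq> E" using F by (auto simp: admissible_def)
  have at: "simplicial_boundary (flow_chain F M \<psi>) [starset F M K] =
    (\<Sum>e\<in>F. \<psi> e * crossing K e)" if "K \<in> comps G F" for K
    unfolding boundary_flow_chain[OF fin] list_delta_def using node_end_iff[OF F _ that]
    by (intro sum.cong refl) (auto simp: eq_commute[of "starset F M K"])
  have "simplicial_boundary (flow_chain F M \<psi>) xs = 0" if "balanced F \<psi>" for xs
  proof (cases "\<exists>K\<in>comps G F. xs = [starset F M K]")
    case True
    then show ?thesis using at that by (auto simp: balanced_def)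
  next
    case False
    have "\<exists>K\<in>comps G F. node F M e 0 = starset F M K" "\<exists>K\<in>comps G F. node F M e M = starset F M K" if "e \<in> F" for e
    proof -
      have "comp_of G F (src e) \<in> comps G F" "comp_of G F (tgt e) \<in> comps G F"
        using that FE src_V[of e] tgt_V[of e] comp_of_in_comps[of _ G F] by auto
      then show "\<exists>K\<in>comps G F. node F M e 0 = starset F M K" "\<exists>K\<in>comps G F. node F M e M = starset F M K"
        using F by (auto simp: node_def admissible_def)
    qed
    then have "xs \<noteq> [node F M e 0]" "xs \<noteq> [node F M e M]" if "e \<in> F" for e
      using False that by metis+
    then show ?thesis unfolding boundary_flow_chain[OF fin] by (simp add: list_delta_def)
  qed
  moreover have "balanced F \<psi>" if "simplicial_boundary (flow_chain F M \<psi>) = (\<lambda>_. 0)"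
    unfolding balanced_def using at that by simp
  ultimately show ?thesis using flow_chain_in_chains[OF F, of \<psi>] unfolding cycles_def by blast
qed

text \<open>Of two consecutive nodes at least one is inner, and by \<open>node_inj\<close> it fixes
  the edge and the index.\<close>

lemma node_pair_inj:
  assumes F: "admissible F M" and e: "e \<in> F" "i < M" and e': "e' \<in> F" "j < M"
  shows "node F M e' j = node F M e i \<and> node F M e' (Suc j) = node F M e (Suc i) \<longleftrightarrow> e' = e \<and> j = i"
    and "\<not> (node F M e' (Suc j) = node F M e i \<and> node F M e' j = node F M e (Suc i))"
proof -
  have M: "3 \<le> M" using F by (simp add: admissible_def)
  show "node F M e' j = node F M e i \<and> node F M e' (Suc j) = node F M e (Suc i) \<longleftrightarrow> e' = e \<and> j = i"
  proof (cases "i = 0")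
    case True
    then show ?thesis using node_inj[OF F e(1), of "Suc i" e' "Suc j"] M e e' by auto
  next
    case False
    then show ?thesis using node_inj[OF F e(1), of i e' j] e e' by auto
  qed
  show "\<not> (node F M e' (Suc j) = node F M e i \<and> node F M e' j = node F M e (Suc i))"
  proof
    assume *: "node F M e' (Suc j) = node F M e i \<and> node F M e' j = node F M e (Suc i)"
    show False
    proof (cases "i = 0")
      case True
      then have "e' = e \<and> j = 1" using node_inj[OF F e(1), of "Suc i" e' j] M e e' * by auto
      \<comment> \<open>Here \<open>3 \<le> M\<close> enters: index 2 is still inner, so its node
        differs from node 0. With two parts, a contracted loop would run forth and back along the
        same edge of the nerve.\<close>
      then show False using node_inj[OF F e(1), of 2 e i] * True M e by (auto simp: numeral_2_eq_2)
    next
      case False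
      then have "e' = e \<and> i = Suc j" using node_inj[OF F e(1), of i e' "Suc j"] e e' * by auto
      moreover from this have "j \<noteq> 0 \<or> Suc i < M" using M by auto
      ultimately show False
        using node_inj[OF F e(1), of j e "Suc i"] node_inj[OF F e(1), of "Suc i" e j] * e e' by auto
    qed
  qed
qed

lemma flow_chain_at:
  assumes F: "admissible F M" and e: "e \<in> F" "i < M"
  shows "flow_chain F M \<psi> [node F M e i, node F M e (Suc i)] = \<psi> e"
proof -
  have fin: "finite F" using F by (simp add: admissible_def)
  have val: "edge_chain (node F M e' j) (node F M e' (Suc j)) [node F M e i, node F M e (Suc i)] = of_bool (e' = e \<and> j = i)"
    if "e' \<in> F" "j < M" for e' j
  proof -
    have "[node F M e i, node F M e (Suc i)] = [node F M e' j, node F M e' (Suc j)] \<longleftrightarrow> e' = e \<and> j = i"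
      unfolding list.inject using node_pair_inj(1)[OF F e that] by metis
    moreover have "[node F M e i, node F M e (Suc i)] \<noteq> [node F M e' (Suc j), node F M e' j]"
      unfolding list.inject using node_pair_inj(2)[OF F e that] by metis
    ultimately show ?thesis unfolding edge_chain_def list_delta_def by (simp only: of_bool_eq diff_0_right)
  qed
  have "flow_chain F M \<psi> [node F M e i, node F M e (Suc i)] = (\<Sum>e'\<in>F. \<psi> e' * (\<Sum>j<M. of_bool (e' = e \<and> j = i)))"
    unfolding flow_chain_def by (intro sum.cong refl arg_cong2[of _ _ _ _ "(*)"] val) auto
  also have "\<dots> = (\<Sum>e'\<in>F. if e' = e then \<psi> e else 0)"
  proof (rule sum.cong)
    fix e' assume "e' \<in> F"
    have "(\<Sum>j<M. of_bool (e' = e \<and> j = i) :: int) = (\<Sum>j<M. if j = i then of_bool (e' = e) else 0)"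
      by (rule sum.cong) auto
    also have "\<dots> = of_bool (e' = e)" using e by simp
    finally show "\<psi> e' * (\<Sum>j<M. of_bool (e' = e \<and> j = i)) = (if e' = e then \<psi> e else 0)" by simp
  qed simp
  also have "\<dots> = \<psi> e" using fin e by simp
  finally show ?thesis .
qed

text \<open>An inner node has exactly two neighbours in the nerve, so a vanishing boundary there
  forces equal coefficients before and after it. A cycle is thus determined by the first edge of
  each path.\<close>

lemma cycles_star_cover_eq:
  assumes F: "admissible F M" and c: "c \<in> cycles 1 (nerve (star_cover F M))"
  shows "c = flow_chain F M (\<lambda>e. c [node F M e 0, node F M e 1])"
proof
  have M: "3 \<le> M" and FE: "F \<subseteq> E" using F by (auto simp: admissible_def)
  have ch: "c \<in> simplicial_chains 1 (nerve (star_cover F M))" and bd: "simplicial_boundary c = (\<lambda>_. 0)"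
    using c by (auto simp: cycles_def)
  have swap: "d [X, Y] = - d [Y, X]" if "d \<in> simplicial_chains 1 (nerve (star_cover F M))" for d X Y
    using simplicial_chainsD(3)[OF that, of "[]" X Y "[]"] by simp
  have supp: "\<exists>X Y e j. xs = [X, Y] \<and> e \<in> F \<and> j < M \<and> (X = node F M e j \<and> Y = node F M e (Suc j) \<or> X = node F M e (Suc j) \<and> Y = node F M e j)"
    if d: "d \<in> simplicial_chains 1 (nerve (star_cover F M))" and nz: "d xs \<noteq> 0" for d xs
  proof -
    have xs: "length xs = 2" "set xs \<in> nerve (star_cover F M)" using simplicial_chainsD(2)[OF d nz] by auto
    then obtain X Y where XY: "xs = [X, Y]" by (auto simp: numeral_2_eq_2 length_Suc_conv)
    have "X \<noteq> Y" using alternating_repeat[OF d, of "[]" X "[]"] nz XY by auto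
    moreover have "X \<in> star_cover F M" "Y \<in> star_cover F M" "X \<inter> Y \<noteq> {}" using xs XY by (auto simp: nerve_def)
    ultimately obtain e j where "e \<in> F" "j < M" "X = node F M e j \<and> Y = node F M e (Suc j) \<or> X = node F M e (Suc j) \<and> Y = node F M e j"
      using nerve_star_cover_edge[OF F] by metis
    then show ?thesis using XY by blast
  qed
  have const: "c [node F M e j, node F M e (Suc j)] = c [node F M e 0, node F M e 1]" if e: "e \<in> F" and j: "j < M" for e j
    using j
  proof (induction j)
    case (Suc j)
    let ?n = "node F M e (Suc j)" and ?V = "{node F M e j, node F M e (Suc (Suc j))}"
    \<comment> \<open>At least one of the two neighbours is inner, so they differ even if
      \<open>e\<close> becomes a loop.\<close>
    have ne: "node F M e j \<noteq> node F M e (Suc (Suc j))"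
      using node_inj[OF F e, of j e "Suc (Suc j)"] node_inj[OF F e, of "Suc (Suc j)" e j] Suc e M
      by (cases "j = 0") auto
    have "v \<in> ?V" if nz: "c (v # [?n]) \<noteq> 0" for v
    proof -
      obtain e' i where e': "e' \<in> F" "i < M" "v = node F M e' i \<and> ?n = node F M e' (Suc i) \<or> v = node F M e' (Suc i) \<and> ?n = node F M e' i"
        using supp[OF ch nz] by auto
      then show ?thesis using node_inj[OF F e, of "Suc j" e' "Suc i"] node_inj[OF F e, of "Suc j" e' i] Suc by auto
    qed
    then have "simplicial_boundary c [?n] = (\<Sum>v\<in>?V. c (v # [?n]))"
      by (intro simplicial_boundary_eq_sum) auto
    then have "c [node F M e j, ?n] + c [node F M e (Suc (Suc j)), ?n] = 0" using ne bd by simp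
    then show ?case using Suc swap[OF ch, of "node F M e (Suc (Suc j))" ?n] by simp
  qed simp
  fix xs
  let ?\<psi> = "\<lambda>e. c [node F M e 0, node F M e 1]"
  note chd = flow_chain_in_chains[OF F, of ?\<psi>]
  have agree: "c [node F M e j, node F M e (Suc j)] = flow_chain F M ?\<psi> [node F M e j, node F M e (Suc j)]"
    if "e \<in> F" "j < M" for e j using const[OF that] flow_chain_at[OF F that] by simp
  show "c xs = flow_chain F M ?\<psi> xs"
  proof (cases "c xs = 0 \<and> flow_chain F M ?\<psi> xs = 0")
    case False
    then obtain X Y e j where "xs = [X, Y]" "e \<in> F" "j < M" "X = node F M e j \<and> Y = node F M e (Suc j) \<or> X = node F M e (Suc j) \<and> Y = node F M e j"
      using supp[OF ch, of xs] supp[OF chd, of xs] by blast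
    then show ?thesis using agree[of e j] swap[OF ch, of X Y] swap[OF chd, of X Y] by auto
  qed simp
qed

end

section \<open>Refinements between the covers\<close>

text \<open>Of \<open>d\<close> consecutive steps, \<open>d - 1\<close> keep the quotient and give
  degenerate edges; only the last one advances.\<close>

lemma sum_edge_chain_div:
  assumes "0 < d"
  shows "(\<Sum>j<m * d. edge_chain (g (j div d)) (g (Suc j div d)) xs) = (\<Sum>i<m. edge_chain (g i) (g (Suc i)) xs)"
proof -
  have "(\<Sum>j\<in>{i * d..<i * d + d}. edge_chain (g (j div d)) (g (Suc j div d)) xs) = edge_chain (g i) (g (Suc i)) xs" for i
  proof -
    have zero: "edge_chain (g (j div d)) (g (Suc j div d)) xs = 0" if "i * d \<le> j" "j < i * d + (d - 1)" for j
    proof -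
      have "j div d = i" "Suc j div d = i" by (rule div_nat_eqI; use that assms in \<open>simp add: algebra_simps\<close>)+
      then show ?thesis by (simp add: edge_chain_self)
    qed
    have set: "{i * d..<i * d + d} = insert (i * d + (d - 1)) {i * d..<i * d + (d - 1)}"
      using assms by auto
    have "(i * d + (d - 1)) div d = i" by (rule div_nat_eqI; use assms in \<open>simp add: algebra_simps\<close>)
    moreover have "Suc (i * d + (d - 1)) div d = Suc i" 
      by (rule div_nat_eqI; use assms in \<open>simp add: algebra_simps\<close>)
    ultimately show ?thesis unfolding set using zero by simp
  qed
  then show ?thesis by (simp add: sum.nat_group[symmetric])
qed

context lf_graph
begin

lemma node_seg: "0 < j \<Longrightarrow> j < M \<Longrightarrow> node F M e j = seg M e j"
  by (simp add: node_def)

lemma seg_inj: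
  assumes F: "admissible F M" "e \<in> F" "0 < j" "j < M" "e' \<in> F" "0 < j'" "j' < M" and "seg M e j = seg M e' j'"
  shows "e = e' \<and> j = j'"
  using node_inj[OF F(1-5), of j'] node_seg[of j M F e] node_seg[of j' M F e'] assms by auto

lemma chain_map_flow_chain:
  assumes "finite F"
  shows "simplicial_chain_map r (flow_chain F M \<psi>) xs =
    (\<Sum>e\<in>F. \<psi> e * (\<Sum>j<M. edge_chain (r (node F M e j)) (r (node F M e (Suc j))) xs))"
proof -
  have path: "simplicial_chain_map r (\<lambda>xs. \<Sum>j<M. edge_chain (node F M e j) (node F M e (Suc j)) xs) =
    (\<lambda>xs. \<Sum>j<M. edge_chain (r (node F M e j)) (r (node F M e (Suc j))) xs)" for e
    by (simp add: simplicial_chain_map_sum finite_support_edge_chain simplicial_chain_map_edge_chain)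
  have "simplicial_chain_map r (flow_chain F M \<psi>) = (\<lambda>xs. \<Sum>e\<in>F. simplicial_chain_map r
      (\<lambda>xs. \<psi> e * (\<Sum>j<M. edge_chain (node F M e j) (node F M e (Suc j)) xs)) xs)"
    unfolding flow_chain_def[abs_def]
    by (rule simplicial_chain_map_sum[OF assms]) (rule finite_support_scale, rule finite_support_path_chain)
  then show ?thesis by (simp only: simplicial_chain_map_scale path)
qed

text \<open>An edge of \<open>F\<close> outside \<open>F'\<close> has both ends in \<open>K'\<close>
  or none, so its initial segment at \<open>K\<close> lies in the piece of \<open>K'\<close>. On an
  edge of \<open>F'\<close> the finer mesh gives a shorter segment.\<close>

lemma starset_mono:
  assumes FF: "F' \<subseteq> F" and F: "admissible F M" "admissible F' M'" "M' \<le> M" and K: "K \<in> comps G F" "K' \<in> comps G F'" "K \<subseteq> K'"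
  shows "starset F M K \<subseteq> starset F' M' K'"
proof
  fix p assume "p \<in> starset F M K"
  then consider "p \<in> piece F K" | e t where "p = epoint e t" "e \<in> F" "0 < t" "t < 1"
    "(src e \<in> K \<and> real M * t < 1) \<or> (tgt e \<in> K \<and> real M - 1 < real M * t)"
    by (auto simp: starset_def)
  then show "p \<in> starset F' M' K'"
  proof cases
    case 1
    then show ?thesis using piece_antimono[OF FF K(3)] by (auto simp: starset_def)
  next
    case 2
    have e: "e \<in> E" and FE: "F' \<subseteq> E" using 2 F by (auto simp: admissible_def)
    have le: "real M' * t \<le> real M * t" "real M' * (1 - t) \<le> real M * (1 - t)"
      using F 2 by (auto intro!: mult_right_mono)
    show ?thesis
    proof (cases "e \<in> F'")
      case True
      then show ?thesis using 2(5) K(3) le unfolding 2(1) epoint_starset[OF FE e 2(3,4)]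
        by (auto simp: algebra_simps)
    next
      case False
      then have "src e \<in> K' \<longleftrightarrow> tgt e \<in> K'"
        using comps_edge[OF K(2), of e] e endpts_eq[OF e] by (auto simp: insert_commute)
      then show ?thesis using 2(5) K(3) False unfolding 2(1) epoint_starset[OF FE e 2(3,4)] by auto
    qed
  qed
qed

text \<open>The projection sends node \<open>j\<close> of an edge to node \<open>j div d\<close> and
  contracts the edges outside \<open>F'\<close>. As \<open>M = M' * d\<close>, end nodes go to end
  nodes and each path covers the coarser path once, so coefficients are unchanged.\<close>

lemma refine_star_cover:
  assumes FF: "F' \<subseteq> F" and F: "admissible F M" "admissible F' M'" and M: "M = M' * d"
  obtains r where "refinement_projection (star_cover F M) (star_cover F' M') r"
    "\<And>\<psi>. simplicial_chain_map r (flow_chain F M \<psi>) = flow_chain F' M' \<psi>"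
proof -
  have d: "0 < d" and fin: "finite F" "finite F'" and FE: "F \<subseteq> E" "F' \<subseteq> E" and M3: "3 \<le> M'" "3 \<le> M"
    using F M by (auto simp: admissible_def intro: gr0I)
  have MM: "M' \<le> M" using M d by simp
  define im where "im e j = (if e \<in> F' then node F' M' e (j div d) else starset F' M' (comp_of G F' (src e)))" for e j
  \<comment> \<open>A star is recovered from its vertices, whereas a segment has none. This
    separates the two cases of a map whose arguments are bare sets of points.\<close>
  define vs where "vs X = {v. Vertex v \<in> X}" for X :: "('v, 'e) point set"
  define r where "r X = (if vs X \<noteq> {} then starset F' M' (comp_of G F' (SOME v. v \<in> vs X))
    else (let q = (SOME q. fst q \<in> F \<and> 0 < snd q \<and> snd q < M \<and> X = seg M (fst q) (snd q)) in im (fst q) (snd q)))" for X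
  have r_star: "r (starset F M K) = starset F' M' (comp_of G F' v)" if K: "K \<in> comps G F" and v: "v \<in> K" for K v
  proof -
    have vsK: "vs (starset F M K) = K" by (auto simp: vs_def)
    then have "(SOME v. v \<in> K) \<in> K" using v by (metis someI)
    then have "(SOME v. v \<in> K) \<in> comp_of G F v" using comps_mem_eq[OF K v] by simp
    then have "(SOME v. v \<in> K) \<in> comp_of G F' v" using comp_of_antimono[OF FF, of G v] by blast
    then have "comp_of G F' (SOME v. v \<in> K) = comp_of G F' v" by (rule comp_of_eqI)
    moreover have "K \<noteq> {}" using v by blast
    ultimately show ?thesis unfolding r_def vsK by simp
  qed
  have r_seg: "r (seg M e j) = im e j" if e: "e \<in> F" "0 < j" "j < M" for e j
  proof -
    have vs0: "vs (seg M e j) = {}" by (auto simp: vs_def seg_def Vertex_epoint_iff)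
    let ?P = "\<lambda>q. fst q \<in> F \<and> 0 < snd q \<and> snd q < M \<and> seg M e j = seg M (fst q) (snd q)"
    have "?P (e, j)" using e by simp
    then have "?P (Eps ?P)" by (rule someI)
    then have "e = fst (Eps ?P) \<and> j = snd (Eps ?P)" using seg_inj[OF F(1) e] by blast
    then show ?thesis unfolding r_def vs0 Let_def by simp
  qed
  have cle: "comp_of G F' (tgt e) = comp_of G F' (src e)" if "e \<in> F" "e \<notin> F'" for e
  proof -
    have "src e \<in> V" using that FE src_V by auto
    then have "tgt e \<in> comp_of G F' (src e)"
      using comps_edge[OF comp_of_in_comps[of "src e" G F'], of e "src e" "tgt e"] that FE endpts_eq[of e] by auto
    then show ?thesis by (rule comp_of_eqI)
  qed
  have r_node: "r (node F M e j) = im e j" if e: "e \<in> F" and j: "j \<le> M" for e j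
  proof -
    have V: "src e \<in> V" "tgt e \<in> V" using e FE src_V tgt_V by auto
    consider "j = 0" | "j = M" "j \<noteq> 0" | "0 < j" "j < M" using j by linarith
    then show ?thesis
    proof cases
      case 1
      then show ?thesis using r_star[OF comp_of_in_comps[OF V(1)] comp_of_self] by (simp add: node_def im_def)
    next
      case 2
      have "M div d = M'" using M d by simp
      then show ?thesis using r_star[OF comp_of_in_comps[OF V(2)] comp_of_self] 2 M3 cle[OF e] by (simp add: node_def im_def)
    next
      case 3
      then show ?thesis using r_seg[OF e] by (simp add: node_seg)
    qed
  qed
  have "r X \<in> star_cover F' M' \<and> X \<subseteq> r X" if X: "X \<in> star_cover F M" for X
    using X unfolding star_cover_def[of F]
  proof (elim UnE imageE)
    fix K assume K: "X = starset F M K" "K \<in> comps G F"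
    obtain v where v: "v \<in> K" "v \<in> V" using comps_nonempty[OF K(2)] comps_subset_V[OF K(2)] by blast
    have K': "comp_of G F' v \<in> comps G F'" using comp_of_in_comps[OF v(2)] .
    have "K \<subseteq> comp_of G F' v" using comps_mem_eq[OF K(2) v(1)] comp_of_antimono[OF FF, of G v] by simp
    then have "starset F M K \<subseteq> starset F' M' (comp_of G F' v)" using starset_mono[OF FF F MM K(2) K'] by simp
    then show ?thesis using r_star[OF K(2) v(1)] K K' by (auto simp: star_cover_def)
  next
    assume "X \<in> {seg M e j | e j. e \<in> F \<and> 0 < j \<and> j < M}"
    then obtain e j where e: "e \<in> F" "0 < j" "j < M" "X = seg M e j" by blast
    have eE: "e \<in> E" using e FE by auto
    have rX: "r X = im e j" using r_seg e by simp
    show ?thesis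
    proof (cases "e \<in> F'")
      case True
      have jd: "j div d \<le> M'" using e M d by (simp add: less_mult_imp_div_less less_imp_le)
      have inW: "node F' M' e (j div d) \<in> star_cover F' M'" using node_in_star_cover[OF F(2) True jd] .
      have "epoint e t \<in> node F' M' e (j div d)" if t: "0 < t" "t < 1" "\<bar>real M * t - real j\<bar> < 1" for t
      proof -
        \<comment> \<open>Write \<open>j = d q + s\<close> with
          \<open>0 \<le> s \<le> d - 1\<close>. A number at distance less than 1 from
          \<open>j\<close> is at distance less than \<open>d\<close> from \<open>d q\<close>;
          dividing by \<open>d\<close> gives distance less than 1 from \<open>q\<close>.\<close>
        have "real j = real (d * (j div d) + j mod d)" by (simp only: mult_div_mod_eq)
        then have j: "real j = real d * real (j div d) + real (j mod d)" by (simp only: of_nat_add of_nat_mult)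
        have s: "real (j mod d) \<le> real d - 1" "0 \<le> real (j mod d)" "1 \<le> real d"
          using mod_less_divisor[OF d, of j] d by linarith+
        have Mt: "real M * t = real d * (real M' * t)" using M by simp
        have "real d * (real M' * t) - (real d * real (j div d) + real (j mod d)) < 1"
          "- 1 < real d * (real M' * t) - (real d * real (j div d) + real (j mod d))"
          using t(3) unfolding Mt j by linarith+
        then have "real d * (real M' * t - real (j div d)) < real d * 1"
          "real d * (-1) < real d * (real M' * t - real (j div d))"
          using s unfolding right_diff_distrib by linarith+
        then have "real M' * t - real (j div d) < 1" "-1 < real M' * t - real (j div d)"
          using d mult_less_cancel_left_pos[of "real d" _ 1] mult_less_cancel_left_pos[of "real d" "-1"] by auto
        then have "\<bar>real M' * t - real (j div d)\<bar> < 1" by linarith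
        then show ?thesis using epoint_in_star_cover_iff[OF F(2) True t(1,2) inW] jd by blast
      qed
      then show ?thesis using inW rX True e by (auto simp: im_def seg_def)
    next
      case False
      let ?K = "comp_of G F' (src e)"
      have K: "?K \<in> comps G F'" using comp_of_in_comps[OF src_V[OF eE]] .
      have "src e \<in> ?K" "tgt e \<in> ?K" using cle[OF e(1) False] comp_of_self by metis+
      then have "seg M e j \<subseteq> starset F' M' ?K" using False epoint_starset[OF FE(2) eE] by (auto simp: seg_def)
      then show ?thesis using rX False e K by (auto simp: im_def star_cover_def)
    qed
  qed
  then have ref: "refinement_projection (star_cover F M) (star_cover F' M') r" by (simp add: refinement_projection_def)
  have "simplicial_chain_map r (flow_chain F M \<psi>) xs = flow_chain F' M' \<psi> xs" for \<psi> xs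
  proof -
    have inner: "(\<Sum>j<M. edge_chain (r (node F M e j)) (r (node F M e (Suc j))) xs) =
      (if e \<in> F' then \<Sum>j<M'. edge_chain (node F' M' e j) (node F' M' e (Suc j)) xs else 0)" if e: "e \<in> F" for e
    proof -
      have "(\<Sum>j<M. edge_chain (r (node F M e j)) (r (node F M e (Suc j))) xs) = (\<Sum>j<M. edge_chain (im e j) (im e (Suc j)) xs)"
        using r_node[OF e] by (intro sum.cong) auto
      then show ?thesis
        using sum_edge_chain_div[OF d, of "node F' M' e" xs M'] M
        by (auto simp: im_def edge_chain_self)
    qed
    have "simplicial_chain_map r (flow_chain F M \<psi>) xs = (\<Sum>e\<in>F. \<psi> e * (if e \<in> F' then \<Sum>j<M'. edge_chain (node F' M' e j) (node F' M' e (Suc j)) xs else 0))"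
      unfolding chain_map_flow_chain[OF fin(1)] using inner by (intro sum.cong) auto
    also have "\<dots> = (\<Sum>e\<in>F'. \<psi> e * (if e \<in> F' then \<Sum>j<M'. edge_chain (node F' M' e j) (node F' M' e (Suc j)) xs else 0))"
      using fin FF by (intro sum.mono_neutral_right) auto
    also have "\<dots> = flow_chain F' M' \<psi> xs" by (simp add: flow_chain_def)
    finally show ?thesis .
  qed
  then show thesis using that[OF ref] by (simp add: fun_eq_iff)
qed

text \<open>Summation by parts: grouping the terms by the components at the ends of the edges turns
  the sum into net inflows weighted by \<open>h\<close>.\<close>

lemma balanced_sum:
  fixes h :: "('v, 'e) point set \<Rightarrow> int"
  assumes F: "admissible F M" and b: "balanced F \<psi>"
  shows "(\<Sum>e\<in>F. \<psi> e * (h (node F M e M) - h (node F M e 0))) = 0"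
proof -
  have fin: "finite F" "F \<subseteq> E" using F by (auto simp: admissible_def)
  then have fc: "finite (comps G F)" by (rule finite_comps)
  have eval: "(\<Sum>K\<in>comps G F. of_bool (v \<in> K) * h (starset F M K)) = h (starset F M (comp_of G F v))" if v: "v \<in> V" for v
  proof -
    have "(v \<in> K) = (K = comp_of G F v)" if "K \<in> comps G F" for K
      using comps_mem_eq[OF that] comp_of_self by metis
    then have "(\<Sum>K\<in>comps G F. of_bool (v \<in> K) * h (starset F M K)) = (\<Sum>K\<in>comps G F. if K = comp_of G F v then h (starset F M K) else 0)"
      by (intro sum.cong) auto
    then show ?thesis using fc comp_of_in_comps[OF v] by simp
  qed
  have e: "h (node F M e M) - h (node F M e 0) = (\<Sum>K\<in>comps G F. crossing K e * h (starset F M K))"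
    if "e \<in> F" for e
    using eval[of "src e"] eval[of "tgt e"] src_V[of e] tgt_V[of e] that fin F
    by (auto simp: node_def left_diff_distrib sum_subtractf admissible_def)
  have "(\<Sum>e\<in>F. \<psi> e * (h (node F M e M) - h (node F M e 0))) =
    (\<Sum>e\<in>F. \<Sum>K\<in>comps G F. \<psi> e * crossing K e * h (starset F M K))"
    by (intro sum.cong) (simp_all add: e sum_distrib_left mult.assoc)
  also have "\<dots> = (\<Sum>K\<in>comps G F. (\<Sum>e\<in>F. \<psi> e * crossing K e) * h (starset F M K))"
    by (subst sum.swap) (simp add: sum_distrib_right)
  also have "\<dots> = 0" using b unfolding balanced_def by simp
  finally show ?thesis .
qed

text \<open>The prism over the edge path of \<open>e\<close> has as boundary the difference of the two images
  of the path, up to the two end faces, which cancel over a balanced chain.\<close>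

lemma contiguous_homologous:
  assumes F: "admissible F M" and b: "balanced F \<psi>"
    and p: "refinement_projection (star_cover F M) \<U> p" and q: "refinement_projection (star_cover F M) \<U> q"
  shows "(\<lambda>xs. simplicial_chain_map p (flow_chain F M \<psi>) xs - simplicial_chain_map q (flow_chain F M \<psi>) xs)
    \<in> simplicial_boundaries 1 (nerve \<U>)"
proof -
  have fin: "finite F" using F by (auto simp: admissible_def)
  define T where "T e j xs = tri_chain (p (node F M e j)) (p (node F M e (Suc j))) (q (node F M e (Suc j))) xs
    - tri_chain (p (node F M e j)) (q (node F M e j)) (q (node F M e (Suc j))) xs" for e j xs
  have Tch: "T e j \<in> simplicial_chains 2 (nerve \<U>)" if e: "e \<in> F" "j < M" for e j
  proof -
    let ?A = "node F M e j" and ?B = "node F M e (Suc j)"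
    have AB: "?A \<in> star_cover F M" "?B \<in> star_cover F M" "?A \<inter> ?B \<noteq> {}" using node_pair_nerve[OF F e] by (auto simp: nerve_def)
    then obtain x where x: "x \<in> ?A" "x \<in> ?B" by blast
    have "p ?A \<in> \<U>" "p ?B \<in> \<U>" "q ?A \<in> \<U>" "q ?B \<in> \<U>" "?A \<subseteq> p ?A" "?B \<subseteq> p ?B" "?A \<subseteq> q ?A" "?B \<subseteq> q ?B"
      using p q AB by (auto simp: refinement_projection_def)
    then have "{p ?A, p ?B, q ?B} \<in> nerve \<U>" "{p ?A, q ?A, q ?B} \<in> nerve \<U>"
      using x by (auto simp: nerve_def)
    then have "(\<lambda>xs. tri_chain (p ?A) (p ?B) (q ?B) xs + - tri_chain (p ?A) (q ?A) (q ?B) xs) \<in> simplicial_chains 2 (nerve \<U>)"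
      by (intro simplicial_chains_add simplicial_chains_uminus tri_chain_in_chains)
    then show ?thesis unfolding T_def[abs_def] by simp
  qed
  define D where "D = (\<lambda>xs. \<Sum>e\<in>F. \<psi> e * (\<Sum>j<M. T e j xs))"
  have D: "D \<in> simplicial_chains (Suc 1) (nerve \<U>)"
    unfolding D_def Suc_1 by (intro simplicial_chains_sum simplicial_chains_scale Tch fin) auto
  have bT: "simplicial_boundary (T e j) xs =
      edge_chain (p (node F M e j)) (p (node F M e (Suc j))) xs - edge_chain (q (node F M e j)) (q (node F M e (Suc j))) xs
      + (edge_chain (p (node F M e (Suc j))) (q (node F M e (Suc j))) xs - edge_chain (p (node F M e j)) (q (node F M e j)) xs)"
    (is "_ = ?R e j xs") for e j xs
  proof -
    have "finite {xs. tri_chain X Y Z xs \<noteq> 0}" for X Y Z :: "('v, 'e) point set"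
      unfolding tri_chain_def by (intro finite_support_add finite_support_diff finite_support_delta)
    then have "simplicial_boundary (T e j) xs =
       simplicial_boundary (tri_chain (p (node F M e j)) (p (node F M e (Suc j))) (q (node F M e (Suc j)))) xs
     - simplicial_boundary (tri_chain (p (node F M e j)) (q (node F M e j)) (q (node F M e (Suc j)))) xs"
      unfolding T_def[abs_def] by (subst simplicial_boundary_diff) simp_all
    then show ?thesis by (simp add: simplicial_boundary_tri_chain)
  qed
  have finT: "finite {xs. T e j xs \<noteq> 0}" if "e \<in> F" "j < M" for e j
    using simplicial_chainsD(1)[OF Tch[OF that]] .
  have "simplicial_boundary D = (\<lambda>xs. \<Sum>e\<in>F. \<psi> e * (\<Sum>j<M. simplicial_boundary (T e j) xs))"
  proof -
    have "simplicial_boundary D = (\<lambda>xs. \<Sum>e\<in>F. simplicial_boundary (\<lambda>xs. \<psi> e * (\<Sum>j<M. T e j xs)) xs)"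
      unfolding D_def by (rule simplicial_boundary_sum[OF fin]) (intro finite_support_scale finite_support_sum finT; simp)
    also have "\<dots> = (\<lambda>xs. \<Sum>e\<in>F. \<psi> e * (\<Sum>j<M. simplicial_boundary (T e j) xs))"
    proof (intro ext sum.cong refl)
      fix xs e assume e: "e \<in> F"
      have "simplicial_boundary (\<lambda>xs. \<Sum>j<M. T e j xs) = (\<lambda>xs. \<Sum>j<M. simplicial_boundary (T e j) xs)"
        by (rule simplicial_boundary_sum) (use finT[OF e] in auto)
      then show "simplicial_boundary (\<lambda>xs. \<psi> e * (\<Sum>j<M. T e j xs)) xs = \<psi> e * (\<Sum>j<M. simplicial_boundary (T e j) xs)"
        by (simp add: simplicial_boundary_scale)
    qed
    finally show ?thesis .
  qed
  also have "\<dots> = (\<lambda>xs. simplicial_chain_map p (flow_chain F M \<psi>) xs - simplicial_chain_map q (flow_chain F M \<psi>) xs)"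
  proof
    fix xs
    have "(\<Sum>j<M. simplicial_boundary (T e j) xs) =
       (\<Sum>j<M. edge_chain (p (node F M e j)) (p (node F M e (Suc j))) xs) - (\<Sum>j<M. edge_chain (q (node F M e j)) (q (node F M e (Suc j))) xs)
      + (edge_chain (p (node F M e M)) (q (node F M e M)) xs - edge_chain (p (node F M e 0)) (q (node F M e 0)) xs)" for e
      unfolding bT sum.distrib sum_subtractf[symmetric]
      using sum_lessThan_telescope[of "\<lambda>j. edge_chain (p (node F M e j)) (q (node F M e j)) xs" M] by simp
    then have "(\<Sum>e\<in>F. \<psi> e * (\<Sum>j<M. simplicial_boundary (T e j) xs)) =
      (\<Sum>e\<in>F. \<psi> e * (\<Sum>j<M. edge_chain (p (node F M e j)) (p (node F M e (Suc j))) xs))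
      - (\<Sum>e\<in>F. \<psi> e * (\<Sum>j<M. edge_chain (q (node F M e j)) (q (node F M e (Suc j))) xs))
      + (\<Sum>e\<in>F. \<psi> e * (edge_chain (p (node F M e M)) (q (node F M e M)) xs - edge_chain (p (node F M e 0)) (q (node F M e 0)) xs))"
      by (simp only: distrib_left right_diff_distrib sum.distrib sum_subtractf)
    also have "(\<Sum>e\<in>F. \<psi> e * (edge_chain (p (node F M e M)) (q (node F M e M)) xs - edge_chain (p (node F M e 0)) (q (node F M e 0)) xs)) = 0"
      by (rule balanced_sum[OF F b, of "\<lambda>X. edge_chain (p X) (q X) xs"])
    finally show "(\<Sum>e\<in>F. \<psi> e * (\<Sum>j<M. simplicial_boundary (T e j) xs)) =
      simplicial_chain_map p (flow_chain F M \<psi>) xs - simplicial_chain_map q (flow_chain F M \<psi>) xs"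
      by (simp add: chain_map_flow_chain[OF fin])
  qed
  finally show ?thesis using D unfolding simplicial_boundaries_def by (metis imageI)
qed

end

section \<open>Cofinality of the covers\<close>

context lf_graph
begin

text \<open>A cofinal chain of finite edge sets. Along it, the components form a finitely branching
  tree with one level for every natural number.\<close>

definition edges_lt :: "nat \<Rightarrow> 'e set" where
  "edges_lt n = {e \<in> E. to_nat_on E e < n}"

lemma edges_lt_subset: "edges_lt n \<subseteq> E"
  by (auto simp: edges_lt_def)

lemma finite_edges_lt: "finite (edges_lt n)"
proof (rule inj_on_finite)
  show "inj_on (to_nat_on E) (edges_lt n)"
    using inj_on_to_nat_on[OF countable_E] edges_lt_subset by (rule inj_on_subset)
  show "to_nat_on E ` edges_lt n \<subseteq> {..<n}" by (auto simp: edges_lt_def)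
qed simp

lemma edges_lt_mono: "m \<le> n \<Longrightarrow> edges_lt m \<subseteq> edges_lt n"
  by (auto simp: edges_lt_def)

lemma finite_subset_edges_lt:
  assumes "finite F" "F \<subseteq> E" obtains n where "F \<subseteq> edges_lt n"
proof -
  obtain n where "\<forall>m\<in>to_nat_on E ` F. m < n" using assms by (meson finite_imageI finite_nat_set_iff_bounded)
  then show thesis using that[of n] assms by (auto simp: edges_lt_def)
qed

lemma edges_lt_0 [simp]: "edges_lt 0 = {}"
  by (simp add: edges_lt_def)

lemma admissible_edges_lt: "3 \<le> M \<Longrightarrow> admissible (edges_lt n) M"
  by (simp add: admissible_def finite_edges_lt edges_lt_subset)

lemma comps_edges_lt_0: "comps G (edges_lt 0) = {V}"
  using comp_of_empty V_nonempty by (auto simp: comps_def)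

text \<open>Walking from every vertex of level \<open>n\<close> along a shortest path towards \<open>A (Suc n)\<close>
  strictly increases the pair (level, negated distance) lexicographically, so no vertex is repeated.\<close>

lemma descending_comps_ray:
  assumes A: "\<And>n. A n \<in> comps G (edges_lt n)" and dec: "\<And>n. A (Suc n) \<subseteq> A n" and empty: "(\<Inter>n. A n) = {}"
  obtains R where "R \<in> rays G" "\<And>n. tail_in R (A n)"
proof -
  have anti: "A n \<subseteq> A m" if "m \<le> n" for m n using dec that by (rule lift_Suc_antimono_le)
  have A0: "A 0 = V" using A[of 0] comps_edges_lt_0 by simp
  define lev where "lev x = (LEAST n. x \<notin> A (Suc n))" for x
  define ds where "ds x = (LEAST m. \<exists>z\<in>A (Suc (lev x)). (x, z) \<in> edge_adj G (edges_lt (lev x)) ^^ m)" for x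
  define better where "better x y \<longleftrightarrow> lev x < lev y \<or> (lev x = lev y \<and> ds y < ds x)" for x y
  have lev1: "x \<notin> A (Suc (lev x))" for x
  proof -
    obtain n where "x \<notin> A n" using empty by auto
    then have "x \<notin> A (Suc n)" using dec by blast
    then show ?thesis unfolding lev_def by (rule LeastI)
  qed
  have lev2: "x \<in> A (lev x)" if "x \<in> V" for x
  proof (cases "lev x")
    case 0
    then show ?thesis using that A0 by simp
  next
    case (Suc n)
    then have "n < lev x" by simp
    then have "\<not> x \<notin> A (Suc n)" unfolding lev_def by (rule not_less_Least)
    then show ?thesis using Suc by simp
  qed
  have lev3: "n \<le> lev x" if "x \<in> A n" for x n
    using that anti[of "Suc (lev x)" n] lev1[of x] by (meson not_less_eq_eq subsetD)
  have step: "\<exists>y e. e \<in> E \<and> endpts G e = {x, y} \<and> better x y" if x: "x \<in> V" for x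
  proof -
    let ?R = "edge_adj G (edges_lt (lev x))"
    obtain z where z: "z \<in> A (Suc (lev x))" using comps_nonempty[OF A] by blast
    then have "z \<in> comp_of G (edges_lt (lev x)) x" using comps_mem_eq[OF A lev2[OF x]] dec by blast
    then have "\<exists>m. \<exists>z\<in>A (Suc (lev x)). (x, z) \<in> ?R ^^ m" using z by (auto simp: comp_of_def rtrancl_power)
    then have "\<exists>z\<in>A (Suc (lev x)). (x, z) \<in> ?R ^^ ds x" unfolding ds_def by (rule LeastI_ex)
    then obtain z where z: "z \<in> A (Suc (lev x))" "(x, z) \<in> ?R ^^ ds x" by blast
    have "ds x \<noteq> 0" using z lev1[of x] by (metis relpow_0_E)
    then obtain m where m: "ds x = Suc m" using not0_implies_Suc by blast
    then obtain y where y: "(x, y) \<in> ?R" "(y, z) \<in> ?R ^^ m" using z(2) by (metis relpow_Suc_E2)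
    then obtain e where e: "e \<in> E - edges_lt (lev x)" "endpts G e = {x, y}" by (auto simp: edge_adj_def)
    have "y \<in> A (lev x)" using comps_edge[OF A e lev2[OF x]] .
    then have "lev x \<le> lev y" by (rule lev3)
    moreover have "ds y < ds x" if "lev y = lev x"
    proof -
      have "ds y \<le> m" unfolding ds_def that using z y by (intro Least_le) auto
      then show ?thesis using m by simp
    qed
    ultimately have "better x y" by (auto simp: better_def)
    then show ?thesis using e by blast
  qed
  then have "\<forall>x. \<exists>p. x \<in> V \<longrightarrow> snd p \<in> E \<and> endpts G (snd p) = {x, fst p} \<and> better x (fst p)" by fastforce
  then obtain nx where nx: "\<And>x. x \<in> V \<Longrightarrow> snd (nx x) \<in> E \<and> endpts G (snd (nx x)) = {x, fst (nx x)} \<and> better x (fst (nx x))"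
    by metis
  obtain r where r: "r \<in> V" using V_nonempty by blast
  define x where "x n = ((\<lambda>x. fst (nx x)) ^^ n) r" for n
  have xS: "x (Suc n) = fst (nx (x n))" for n by (simp add: x_def)
  have xV: "x n \<in> V" for n
  proof (induction n)
    case 0 show ?case using r by (simp add: x_def)
  next
    case (Suc n)
    then show ?case using nx[OF Suc] endpts_V xS[of n] by fastforce
  qed
  have bS: "better (x n) (x (Suc n))" for n using nx[OF xV[of n]] xS by simp
  have btr: "better a c" if "better a b" "better b c" for a b c using that by (auto simp: better_def)
  have b: "better (x m) (x n)" if "m < n" for m n
    using that bS by (induction n) (auto simp: less_Suc_eq intro: btr)
  define R where "R = (x, \<lambda>n. snd (nx (x n)))"
  have "inj x"
  proof (rule injI, rule ccontr)
    fix m n assume "x m = x n" "m \<noteq> n"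
    then have "better (x m) (x m)" using b[of m n] b[of n m] by (cases "m < n") auto
    then show False by (simp add: better_def)
  qed
  then have RG: "R \<in> rays G" using nx[OF xV] xS by (auto simp: R_def rays_def)
  have levm: "lev (x m) \<le> lev (x n)" if "m \<le> n" for m n
    using b[of m n] that by (cases "m = n") (auto simp: better_def)
  have lev_unbounded: "\<exists>k. \<forall>j\<ge>k. n \<le> lev (x j)" for n
  proof (induction n)
    case (Suc n)
    then obtain k where k: "\<forall>j\<ge>k. n \<le> lev (x j)" by blast
    show ?case
    proof (cases "\<exists>j\<ge>k. Suc n \<le> lev (x j)")
      case True
      then show ?thesis using levm by (meson order_trans)
    next
      case False
      then have eq: "lev (x j) = n" if "j \<ge> k" for j using k that by (meson le_antisym not_less_eq_eq)
      \<comment> \<open>While the level stays constant, the distance drops by at least one in each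
        step, which cannot go on for more than \<open>ds (x k)\<close> steps.\<close>
      have "ds (x (k + i)) + i \<le> ds (x k)" for i
      proof (induction i)
        case (Suc i)
        then show ?case using bS[of "k + i"] eq[of "k + i"] eq[of "k + Suc i"] by (auto simp: better_def)
      qed simp
      from this[of "Suc (ds (x k))"] show ?thesis by simp
    qed
  qed simp
  have "tail_in R (A n)" for n
  proof -
    obtain k where "\<forall>j\<ge>k. n \<le> lev (x j)" using lev_unbounded by blast
    then have "\<forall>j\<ge>k. x j \<in> A n" using lev2[OF xV] anti by blast
    then show ?thesis by (auto simp: tail_in_def R_def)
  qed
  then show thesis using that RG by blast
qed

section \<open>Choosing the mesh along an edge\<close>

lemma open_trace_near:
  assumes "open_trace e U" "epoint e a \<in> U" "a \<in> {0..1}"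
  obtains \<epsilon> where "0 < \<epsilon>" "\<And>t. t \<in> {0..1} \<Longrightarrow> \<bar>t - a\<bar> < \<epsilon> \<Longrightarrow> epoint e t \<in> U"
proof -
  have "\<exists>\<epsilon>>0. ball a \<epsilon> \<inter> {0..1} \<subseteq> edge_trace e U"
    using assms unfolding open_trace_def openin_contains_ball by (auto simp: edge_trace_def)
  then obtain \<epsilon> where "\<epsilon> > 0" "ball a \<epsilon> \<inter> {0..1} \<subseteq> edge_trace e U" by blast
  then show thesis using that[of \<epsilon>] by (auto simp: edge_trace_def dist_real_def abs_minus_commute subset_iff)
qed

text \<open>Openness of the trace at the vertex gives some \<epsilon>, and \<open>1 / M\<close>
  below \<epsilon> is fine enough. The eventual form lets finitely many edges be combined.\<close>

lemma eventually_vertex_star: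
  assumes e: "e \<in> E" and U: "open_trace e U" "Vertex v \<in> U"
  shows "\<forall>\<^sub>F M in sequentially. \<forall>t. 0 < t \<and> t < 1 \<longrightarrow>
     ((src e = v \<and> real M * t < 1) \<or> (tgt e = v \<and> real M - 1 < real M * t)) \<longrightarrow> epoint e t \<in> U"
proof -
  have 1: "\<forall>\<^sub>F M in sequentially. \<forall>t. 0 < t \<and> t < 1 \<longrightarrow> src e = v \<and> real M * t < 1 \<longrightarrow> epoint e t \<in> U"
  proof (cases "src e = v")
    case True
    then obtain \<epsilon> where eps: "0 < \<epsilon>" "\<And>t. t \<in> {0..1} \<Longrightarrow> \<bar>t - 0\<bar> < \<epsilon> \<Longrightarrow> epoint e t \<in> U"
      using open_trace_near[OF U(1), of 0] U(2) by auto
    obtain M0 where M0: "1 / \<epsilon> < real M0" using reals_Archimedean2 by blast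
    have "epoint e t \<in> U" if M: "M0 \<le> M" and t: "0 < t" "t < 1" "real M * t < 1" for M t
    proof -
      have "1 / \<epsilon> < real M" using M M0 by linarith
      then have "1 < \<epsilon> * real M" using eps(1) by (simp add: field_simps)
      then have "t * real M < \<epsilon> * real M" using t by (simp add: mult.commute)
      then have "t < \<epsilon>" by (rule mult_right_less_imp_less) simp
      then show ?thesis using eps(2)[of t] t by simp
    qed
    then show ?thesis unfolding eventually_sequentially by blast
  qed simp
  have 2: "\<forall>\<^sub>F M in sequentially. \<forall>t. 0 < t \<and> t < 1 \<longrightarrow> tgt e = v \<and> real M - 1 < real M * t \<longrightarrow> epoint e t \<in> U"
  proof (cases "tgt e = v")
    case True
    then obtain \<epsilon> where eps: "0 < \<epsilon>" "\<And>t. t \<in> {0..1} \<Longrightarrow> \<bar>t - 1\<bar> < \<epsilon> \<Longrightarrow> epoint e t \<in> U"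
      using open_trace_near[OF U(1), of 1] U(2) by auto
    obtain M0 where M0: "1 / \<epsilon> < real M0" using reals_Archimedean2 by blast
    have "epoint e t \<in> U" if M: "M0 \<le> M" and t: "0 < t" "t < 1" "real M - 1 < real M * t" for M t
    proof -
      have "1 / \<epsilon> < real M" using M M0 by linarith
      then have "1 < \<epsilon> * real M" using eps(1) by (simp add: field_simps)
      then have "(1 - t) * real M < \<epsilon> * real M" using t by (simp add: algebra_simps)
      then have "1 - t < \<epsilon>" by (rule mult_right_less_imp_less) simp
      then show ?thesis using eps(2)[of t] t by simp
    qed
    then show ?thesis unfolding eventually_sequentially by blast
  qed simp
  show ?thesis using 1 2 by eventually_elim blast
qed

text \<open>A Lebesgue number of the cover pulled back to the unit interval: a segment has centre
  \<open>j / M\<close> and radius \<open>1 / M\<close>.\<close>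

lemma eventually_segments:
  assumes e: "e \<in> E" and \<U>: "\<U> \<in> open_covers (freudenthal G)"
  shows "\<forall>\<^sub>F M in sequentially. \<forall>j. 0 < j \<and> j < M \<longrightarrow> (\<exists>U\<in>\<U>. seg M e j \<subseteq> U)"
proof -
  have op: "open_trace e U" if "U \<in> \<U>" for U
    using \<U> that e by (auto simp: open_covers_def openin_freudenthal_iff)
  then have "\<exists>T. open T \<and> edge_trace e U = {0..1} \<inter> T" if "U \<in> \<U>" for U
    using that unfolding open_trace_def openin_open by blast
  then obtain T where T: "\<And>U. U \<in> \<U> \<Longrightarrow> open (T U)" "\<And>U. U \<in> \<U> \<Longrightarrow> edge_trace e U = {0..1} \<inter> T U" by metis
  have cov: "{0..1} \<subseteq> \<Union>(T ` \<U>)"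
  proof
    fix t :: real assume t: "t \<in> {0..1}"
    then have "epoint e t \<in> \<Union>\<U>" using epoint_points[OF e t] \<U> by (simp add: open_covers_def)
    then show "t \<in> \<Union>(T ` \<U>)" using T(2) t by (auto simp: edge_trace_def)
  qed
  obtain \<epsilon> where eps: "\<epsilon> > 0" "\<And>t. t \<in> {0..1} \<Longrightarrow> \<exists>B\<in>T ` \<U>. ball t \<epsilon> \<subseteq> B"
    using Heine_Borel_lemma[of "{0..1::real}" "T ` \<U>"] cov T(1) by (metis (no_types, lifting) compact_Icc imageE)
  obtain M0 where M0: "1 / \<epsilon> < real M0" using reals_Archimedean2 by blast
  have "\<exists>U\<in>\<U>. seg M e j \<subseteq> U" if M: "M0 \<le> M" and j: "0 < j" "j < M" for M j
  proof -
    have "1 / \<epsilon> < real M" using M M0 by linarith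
    then have Meps: "1 < \<epsilon> * real M" using eps(1) by (simp add: field_simps)
    have "real j / real M \<in> {0..1}" using j by simp
    then obtain U where U: "U \<in> \<U>" "ball (real j / real M) \<epsilon> \<subseteq> T U" using eps(2) by blast
    have "epoint e t \<in> U" if t: "0 < t" "t < 1" "\<bar>real M * t - real j\<bar> < 1" for t
    proof -
      have "\<bar>t - real j / real M\<bar> * real M = \<bar>real M * t - real j\<bar>"
        using j by (simp add: abs_mult_pos' algebra_simps flip: abs_mult_pos) 
      then have "\<bar>t - real j / real M\<bar> * real M < \<epsilon> * real M" using t Meps by linarith
      then have "\<bar>t - real j / real M\<bar> < \<epsilon>" by (rule mult_right_less_imp_less) simp
      then have "t \<in> T U" using U by (auto simp: dist_real_def abs_minus_commute)
      then have "t \<in> edge_trace e U" using T(2)[OF U(1)] t by simp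
      then show ?thesis by (simp add: edge_trace_def)
    qed
    then show ?thesis using U by (auto simp: seg_def)
  qed
  then show ?thesis unfolding eventually_sequentially by blast
qed

text \<open>The mesh may depend on the component here; \<open>starset_mono\<close> makes it uniform
  in \<open>cofinal_star_cover\<close>.\<close>

definition subordinate :: "('v, 'e) point set set \<Rightarrow> nat \<Rightarrow> 'v set \<Rightarrow> bool" where
  "subordinate \<U> n K \<longleftrightarrow> (\<exists>M\<ge>3. \<exists>U\<in>\<U>. starset (edges_lt n) M K \<subseteq> U)"

lemma subordinate_mono:
  assumes "subordinate \<U> m L" "m \<le> n" "L \<in> comps G (edges_lt m)" "K \<in> comps G (edges_lt n)" "K \<subseteq> L"
  shows "subordinate \<U> n K"
proof -
  obtain M U where "3 \<le> M" "U \<in> \<U>" "starset (edges_lt m) M L \<subseteq> U" using assms by (auto simp: subordinate_def)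
  then show ?thesis using starset_mono[OF edges_lt_mono[OF assms(2)] admissible_edges_lt admissible_edges_lt _ assms(4,3,5)]
    unfolding subordinate_def by (meson order_refl subset_trans)
qed

text \<open>The property carried down the tree: failures below \<open>K\<close> occur at every later
  level. Unlike the mere failure of \<open>K\<close>, it always passes to some child.\<close>

definition unsubordinate :: "('v, 'e) point set set \<Rightarrow> nat \<Rightarrow> 'v set \<Rightarrow> bool" where
  "unsubordinate \<U> n K \<longleftrightarrow> (\<forall>n'\<ge>n. \<exists>K'\<in>comps G (edges_lt n'). K' \<subseteq> K \<and> \<not> subordinate \<U> n' K')"

text \<open>Otherwise each of the finitely many children \<open>K'\<close> has a level
  \<open>h K'\<close> at which all components inside it are subordinate. By
  \<open>subordinate_mono\<close> this persists up to the maximum \<open>N\<close> of these levels,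
  so nothing fails below \<open>K\<close> at level \<open>N\<close>.\<close>

lemma unsubordinate_child:
  assumes "unsubordinate \<U> n K" and K: "K \<in> comps G (edges_lt n)"
  obtains K' where "K' \<in> comps G (edges_lt (Suc n))" "K' \<subseteq> K" "unsubordinate \<U> (Suc n) K'"
proof (rule ccontr)
  note thesis' = that
  assume "\<not> thesis"
  then have nb: "\<not> unsubordinate \<U> (Suc n) K'" if "K' \<in> comps G (edges_lt (Suc n))" "K' \<subseteq> K" for K'
    using thesis' that by blast
  have "\<exists>h\<ge>Suc n. \<forall>L\<in>comps G (edges_lt h). L \<subseteq> K' \<longrightarrow> subordinate \<U> h L" if "K' \<in> comps G (edges_lt (Suc n))" "K' \<subseteq> K" for K'
    using nb[OF that] unfolding unsubordinate_def by blast
  then obtain h where h: "\<And>K'. K' \<in> comps G (edges_lt (Suc n)) \<Longrightarrow> K' \<subseteq> K \<Longrightarrow> h K' \<ge> Suc n \<and> (\<forall>L\<in>comps G (edges_lt (h K')). L \<subseteq> K' \<longrightarrow> subordinate \<U> (h K') L)"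
    by metis
  define N where "N = Max (insert (Suc n) (h ` comps G (edges_lt (Suc n))))"
  have fin: "finite (insert (Suc n) (h ` comps G (edges_lt (Suc n))))"
    using finite_comps[OF finite_edges_lt edges_lt_subset] by simp
  have N: "Suc n \<le> N" "\<And>K'. K' \<in> comps G (edges_lt (Suc n)) \<Longrightarrow> h K' \<le> N"
    unfolding N_def using fin by (auto intro: Max_ge)
  then have "n \<le> N" by simp
  then obtain L where L: "L \<in> comps G (edges_lt N)" "L \<subseteq> K" "\<not> subordinate \<U> N L"
    using assms(1) unfolding unsubordinate_def by blast
  obtain v where v: "v \<in> L" "v \<in> V" using comps_nonempty[OF L(1)] comps_subset_V[OF L(1)] by blast
  define K' where "K' = comp_of G (edges_lt (Suc n)) v"
  have Kv: "K = comp_of G (edges_lt n) v" using comps_mem_eq[OF K] v L by blast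
  have K': "K' \<in> comps G (edges_lt (Suc n))" "K' \<subseteq> K"
    using comp_of_in_comps[OF v(2)] comp_of_antimono[OF edges_lt_mono[of n "Suc n"], of G v] by (auto simp: K'_def Kv)
  define L' where "L' = comp_of G (edges_lt (h K')) v"
  have L': "L' \<in> comps G (edges_lt (h K'))" "L' \<subseteq> K'"
    using comp_of_in_comps[OF v(2)] comp_of_antimono[OF edges_lt_mono, of "Suc n" "h K'" G v] h[OF K'] by (auto simp: L'_def K'_def)
  have "L \<subseteq> L'" using comps_mem_eq[OF L(1) v(1)] comp_of_antimono[OF edges_lt_mono[OF N(2)[OF K'(1)]], of G v] by (simp add: L'_def)
  then have "subordinate \<U> N L" using subordinate_mono[OF _ N(2)[OF K'(1)] L'(1) L(1)] h[OF K'] L' by blast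
  then show False using L by blast
qed

lemma all_comps_subordinate:
  assumes \<U>: "\<U> \<in> open_covers (freudenthal G)"
  shows "\<exists>n. \<forall>K\<in>comps G (edges_lt n). subordinate \<U> n K"
proof (rule ccontr)
  assume "\<not> ?thesis"
  then have ex: "\<exists>K\<in>comps G (edges_lt n). \<not> subordinate \<U> n K" for n by blast
  have bad0: "unsubordinate \<U> 0 V" unfolding unsubordinate_def
  proof (intro allI impI)
    fix n
    obtain K where K: "K \<in> comps G (edges_lt n)" "\<not> subordinate \<U> n K" using ex by blast
    then show "\<exists>K'\<in>comps G (edges_lt n). K' \<subseteq> V \<and> \<not> subordinate \<U> n K'" using comps_subset_V[OF K(1)] by blast
  qed
  have "\<exists>A. \<forall>n. (A n \<in> comps G (edges_lt n) \<and> unsubordinate \<U> n (A n)) \<and> A (Suc n) \<subseteq> A n"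
  proof (rule dependent_nat_choice)
    show "\<exists>K. K \<in> comps G (edges_lt 0) \<and> unsubordinate \<U> 0 K" using bad0 comps_edges_lt_0 by blast
    show "\<exists>K'. (K' \<in> comps G (edges_lt (Suc n)) \<and> unsubordinate \<U> (Suc n) K') \<and> K' \<subseteq> K" if "K \<in> comps G (edges_lt n) \<and> unsubordinate \<U> n K" for K n
      using unsubordinate_child that by metis
  qed
  then obtain A where A: "\<And>n. A n \<in> comps G (edges_lt n)" "\<And>n. unsubordinate \<U> n (A n)" "\<And>n. A (Suc n) \<subseteq> A n" by blast
  have anti: "A n \<subseteq> A m" if "m \<le> n" for m n using A(3) that by (rule lift_Suc_antimono_le)
  \<comment> \<open>Components of one level are disjoint, so the failure inside \<open>A n\<close>
    at level \<open>n\<close> is \<open>A n\<close> itself.\<close>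
  have ng: "\<not> subordinate \<U> n (A n)" for n
  proof -
    obtain K where K: "K \<in> comps G (edges_lt n)" "K \<subseteq> A n" "\<not> subordinate \<U> n K" using A(2) unfolding unsubordinate_def by blast
    then have "K = A n" using comps_nonempty[OF K(1)] comps_eqI[OF K(1) A(1)] by blast
    then show ?thesis using K by simp
  qed
  have op: "open_trace e U" if "U \<in> \<U>" "e \<in> E" for U e
    using \<U> that by (auto simp: open_covers_def openin_freudenthal_iff)
  have cov: "p \<in> \<Union>\<U>" if "p \<in> points" for p using \<U> that by (simp add: open_covers_def)
  show False
  proof (cases "(\<Inter>n. A n) = {}")
    case False
    then obtain v where v: "\<And>n. v \<in> A n" by blast
    have vV: "v \<in> V" using comps_subset_V[OF A(1)] v by blast
    have "Vertex v \<in> \<Union>\<U>" using cov[of "Vertex v"] vV by (simp only: Vertex_points)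
    then obtain U where U: "U \<in> \<U>" "Vertex v \<in> U" by (rule UnionE)
    have S: "finite (star_edges G {v})" "star_edges G {v} \<subseteq> E"
      using finite_star_edges[of "{v}"] vV star_edges_subset by auto
    \<comment> \<open>Once all edges at \<open>v\<close> are deleted, \<open>A n\<close> shrinks to
      \<open>v\<close>, and its star fits into \<open>U\<close> for a fine mesh.\<close>
    then obtain n where n: "star_edges G {v} \<subseteq> edges_lt n" using finite_subset_edges_lt by blast
    have "A n = comp_of G (edges_lt n) v" using comps_mem_eq[OF A(1) v] .
    then have An: "A n = {v}" using comp_of_antimono[OF n, of G v] comp_of_star_single[of v "{v}"] comp_of_self[of v G "edges_lt n"] by auto
    have "\<forall>\<^sub>F M in sequentially. \<forall>e\<in>star_edges G {v}. \<forall>t. 0 < t \<and> t < 1 \<longrightarrow>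
     ((src e = v \<and> real M * t < 1) \<or> (tgt e = v \<and> real M - 1 < real M * t)) \<longrightarrow> epoint e t \<in> U"
      by (rule eventually_ball_finite[OF S(1)]) (use eventually_vertex_star[OF _ op[OF U(1)] U(2)] S(2) in blast)
    then have "\<forall>\<^sub>F M in sequentially. 3 \<le> M \<and> (\<forall>e\<in>star_edges G {v}. \<forall>t. 0 < t \<and> t < 1 \<longrightarrow>
     ((src e = v \<and> real M * t < 1) \<or> (tgt e = v \<and> real M - 1 < real M * t)) \<longrightarrow> epoint e t \<in> U)"
      by (intro eventually_conj eventually_ge_at_top)
    from eventually_happens'[OF sequentially_bot this]
    obtain M where M: "3 \<le> M" "\<And>e t. e \<in> star_edges G {v} \<Longrightarrow> 0 < t \<Longrightarrow> t < 1 \<Longrightarrow>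
     ((src e = v \<and> real M * t < 1) \<or> (tgt e = v \<and> real M - 1 < real M * t)) \<Longrightarrow> epoint e t \<in> U"
      by blast
    have "starset (edges_lt n) M {v} \<subseteq> U"
    proof
      fix p assume p: "p \<in> starset (edges_lt n) M {v}"
      then have "p \<in> points" using starset_points[OF admissible_edges_lt[OF M(1)] A(1), of n] An by auto
      then show "p \<in> U"
      proof (cases rule: points_cases)
        case (V u)
        then show ?thesis using p U by simp
      next
        case (E e t)
        then have *: "(src e = v \<and> real M * t < 1) \<or> (tgt e = v \<and> real M - 1 < real M * t)"
          using p epoint_starset[OF edges_lt_subset E(1-3), of n M "{v}"] src_neq_tgt[of e] by (auto split: if_splits)
        then have "e \<in> star_edges G {v}" using E endpts_eq[of e] by (auto simp: star_edges_def)
        then show ?thesis using M(2)[OF _ E(2,3) *] E(4) by simp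
      next
        case (End w)
        then show ?thesis using p end_not_finite[of w "{v}"] by simp
      qed
    qed
    then have "subordinate \<U> n (A n)" using M U unfolding subordinate_def An by blast
    then show False using ng by blast
  next
    case True
    obtain R where R: "R \<in> rays G" "\<And>n. tail_in R (A n)" using descending_comps_ray[OF A(1,3) True] by blast
    define w where "w = ray_equiv G `` {R}"
    have w: "w \<in> graph_ends G" using R by (auto simp: w_def graph_ends_def quotient_def)
    have wA: "end_in w (A n)" for n
      using ray_equiv_tail[OF _ finite_edges_lt edges_lt_subset A(1) R(2)] unfolding end_in_def w_def by auto
    have "End w \<in> \<Union>\<U>" using cov[of "End w"] w by (simp only: End_points)
    then obtain U where U: "U \<in> \<U>" "End w \<in> U" by (rule UnionE)
    then have "end_nbhd U w" using \<U> by (auto simp: open_covers_def openin_freudenthal_iff)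
    then obtain F K where F: "finite F" "F \<subseteq> E" "K \<in> comps G F" "end_in w K" "piece F K \<subseteq> U"
      by (auto simp: end_nbhd_def)
    obtain n1 where n1: "F \<subseteq> edges_lt n1" using finite_subset_edges_lt[OF F(1,2)] .
    define S where "S = (\<Union>e\<in>F. endpts G e)"
    have "finite S" using F finite_endpts by (auto simp: S_def)
    moreover have "\<forall>\<^sub>F n in sequentially. v \<notin> A n" for v
    proof -
      obtain m where "v \<notin> A m" using True by blast
      then show ?thesis unfolding eventually_sequentially using anti by blast
    qed
    ultimately have "\<forall>\<^sub>F n in sequentially. \<forall>v\<in>S. v \<notin> A n" by (simp add: eventually_ball_finite)
    then have "\<forall>\<^sub>F n in sequentially. n1 \<le> n \<and> (\<forall>v\<in>S. v \<notin> A n)"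
      by (intro eventually_conj eventually_ge_at_top)
    from eventually_happens'[OF sequentially_bot this]
    obtain n where n: "n1 \<le> n" "\<And>v. v \<in> S \<Longrightarrow> v \<notin> A n"
      by blast
    have edges_lt: "F \<subseteq> edges_lt n" using n1 edges_lt_mono[OF n(1)] by blast
    have AK: "A n \<subseteq> K"
    proof -
      obtain v where "v \<in> A n" "v \<in> K" using end_in_meet[OF w wA F(4)] by blast
      then show ?thesis using comps_mem_eq[OF A(1)] comps_mem_eq[OF F(3)] comp_of_antimono[OF edges_lt, of G v] by metis
    qed
    \<comment> \<open>No end of an edge of \<open>F\<close> is left in \<open>A n\<close>, so the
      segments that the star adds lie on edges inside \<open>K\<close> which \<open>F\<close> leaves
      intact. They fit for any mesh; 3 is the least admissible number.\<close>
    have "starset (edges_lt n) 3 (A n) \<subseteq> piece F K"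
    proof
      fix p assume p: "p \<in> starset (edges_lt n) 3 (A n)"
      then consider "p \<in> piece (edges_lt n) (A n)" | e t where "p = epoint e t" "e \<in> edges_lt n" "0 < t" "t < 1" "src e \<in> A n \<or> tgt e \<in> A n"
        by (auto simp: starset_def)
      then show "p \<in> piece F K"
      proof cases
        case 1
        then show ?thesis using piece_antimono[OF edges_lt AK] by blast
      next
        case 2
        have e: "e \<in> E" using 2 edges_lt_subset by blast
        have "e \<notin> F" using 2(5) n(2) endpts_eq[OF e] by (auto simp: S_def)
        then have "src e \<in> K \<longleftrightarrow> tgt e \<in> K"
          using comps_edge[OF F(3), of e] e endpts_eq[OF e] by (auto simp: insert_commute)
        then show ?thesis using 2 AK epoint_piece[OF e 2(3,4)] \<open>e \<notin> F\<close> by auto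
      qed
    qed
    then have "subordinate \<U> n (A n)" using F U unfolding subordinate_def by blast
    then show False using ng by blast
  qed
qed

text \<open>Finitely many components and edges are involved, so one large \<open>M\<close> serves
  all: refining the mesh keeps each star inside its member of the cover and makes the segments small
  enough.\<close>

lemma cofinal_star_cover:
  assumes \<U>: "\<U> \<in> open_covers (freudenthal G)"
  obtains F M p where "admissible F M" "refinement_projection (star_cover F M) \<U> p"
proof -
  obtain n where n: "\<And>K. K \<in> comps G (edges_lt n) \<Longrightarrow> subordinate \<U> n K" using all_comps_subordinate[OF \<U>] by blast
  have "\<forall>\<^sub>F M in sequentially. \<forall>e\<in>edges_lt n. \<forall>j. 0 < j \<and> j < M \<longrightarrow> (\<exists>U\<in>\<U>. seg M e j \<subseteq> U)"
    by (rule eventually_ball_finite[OF finite_edges_lt]) (use eventually_segments[OF _ \<U>] edges_lt_subset in blast)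
  moreover have "\<forall>\<^sub>F M in sequentially. \<forall>K\<in>comps G (edges_lt n). \<exists>U\<in>\<U>. starset (edges_lt n) M K \<subseteq> U"
  proof (rule eventually_ball_finite[OF finite_comps[OF finite_edges_lt edges_lt_subset]], rule ballI)
    fix K assume K: "K \<in> comps G (edges_lt n)"
    obtain M0 U where M0: "3 \<le> M0" "U \<in> \<U>" "starset (edges_lt n) M0 K \<subseteq> U" using n[OF K] by (auto simp: subordinate_def)
    have "starset (edges_lt n) M K \<subseteq> U" if "M0 \<le> M" for M
      using starset_mono[OF order_refl admissible_edges_lt admissible_edges_lt that K K order_refl] M0 that by auto
    then show "\<forall>\<^sub>F M in sequentially. \<exists>U\<in>\<U>. starset (edges_lt n) M K \<subseteq> U"
      using M0 unfolding eventually_sequentially by blast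
  qed
  ultimately have "\<forall>\<^sub>F M in sequentially. 3 \<le> M \<and> (\<forall>X\<in>star_cover (edges_lt n) M. \<exists>U\<in>\<U>. X \<subseteq> U)"
    using eventually_ge_at_top[of 3] by eventually_elim (auto simp: star_cover_def)
  from eventually_happens'[OF sequentially_bot this]
  obtain M where M: "3 \<le> M" "\<And>X. X \<in> star_cover (edges_lt n) M \<Longrightarrow> \<exists>U\<in>\<U>. X \<subseteq> U"
    by blast
  then obtain p where "\<And>X. X \<in> star_cover (edges_lt n) M \<Longrightarrow> p X \<in> \<U> \<and> X \<subseteq> p X" by metis
  then show thesis by (intro that[OF admissible_edges_lt[OF M(1)], of n p]) (simp add: refinement_projection_def)
qed

end

section \<open>The first Cech homology group as an edge space\<close>

lemma simplicial_chain_map_id: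
  assumes "finite {xs. c xs \<noteq> 0}" "\<And>x. f x = x" shows "simplicial_chain_map f c = c"
proof
  fix ys
  have "f = (\<lambda>x. x)" using assms(2) by auto
  then have "map f xs = xs" for xs by simp
  then have "{xs. c xs \<noteq> 0 \<and> map f xs = ys} = (if c ys \<noteq> 0 then {ys} else {})" by auto
  then show "simplicial_chain_map f c ys = c ys" by (simp add: simplicial_chain_map_def)
qed

lemma refinement_projection_comp:
  assumes "refinement_projection \<U> \<V> p" "refinement_projection \<V> \<W> q"
  shows "refinement_projection \<U> \<W> (q \<circ> p)"
  using assms unfolding refinement_projection_def by fastforce

lemma carrier_cech: "x \<in> carrier (cech_homology n X) \<longleftrightarrow>
    x \<in> extensional (open_covers X) \<and> (\<forall>\<U>\<in>open_covers X. x \<U> \<in> hclass n (nerve \<U>) ` cycles n (nerve \<U>)) \<and>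
    (\<forall>\<U>\<in>open_covers X. \<forall>\<U>'\<in>open_covers X. \<forall>p. refinement_projection \<U>' \<U> p \<longrightarrow>
             simplicial_hom_induced n (nerve \<U>) p (x \<U>') = x \<U>)"
  by (auto simp: cech_homology_def Let_def product_group_def carrier_homology PiE_iff)

lemma mult_cech: "\<U> \<in> open_covers X \<Longrightarrow>
  (x \<otimes>\<^bsub>cech_homology n X\<^esub> y) \<U> = x \<U> \<otimes>\<^bsub>simplicial_homology n (nerve \<U>)\<^esub> y \<U>"
  by (simp add: cech_homology_def Let_def product_group_def)

context lf_graph
begin

definition flows :: "('e \<Rightarrow> int) set" where
  "flows = {\<psi>. \<forall>F. finite F \<and> F \<subseteq> E \<longrightarrow> balanced F \<psi>}"

definition orient :: "('e \<Rightarrow> int) \<Rightarrow> 'e \<times> 'v \<times> 'v \<Rightarrow> int" where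
  "orient \<psi> = (\<lambda>(e, u, v). if e \<in> E \<and> u = src e \<and> v = tgt e then \<psi> e
     else if e \<in> E \<and> u = tgt e \<and> v = src e then - \<psi> e else 0)"

lemma orient_apply: "orient \<psi> (e, u, v) = (if e \<in> E \<and> u = src e \<and> v = tgt e then \<psi> e
     else if e \<in> E \<and> u = tgt e \<and> v = src e then - \<psi> e else 0)"
  unfolding orient_def by (rule prod.case[THEN trans]) (rule prod.case)

lemma orient_at: "e \<in> E \<Longrightarrow> orient \<psi> (e, src e, tgt e) = \<psi> e"
  unfolding orient_apply by simp

lemma orient_add: "orient (\<lambda>e. \<psi> e + \<theta> e) = (\<lambda>a. orient \<psi> a + orient \<theta> a)"
proof
  fix a :: "'e \<times> 'v \<times> 'v"
  obtain e u v where a: "a = (e, u, v)" by (cases a)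
  consider "e \<in> E \<and> u = src e \<and> v = tgt e" | "\<not> (e \<in> E \<and> u = src e \<and> v = tgt e)" "e \<in> E \<and> u = tgt e \<and> v = src e"
    | "\<not> (e \<in> E \<and> u = src e \<and> v = tgt e)" "\<not> (e \<in> E \<and> u = tgt e \<and> v = src e)" by blast
  then show "orient (\<lambda>e. \<psi> e + \<theta> e) a = orient \<psi> a + orient \<theta> a"
    unfolding a orient_apply by cases (simp_all only: if_True if_False simp_thms add_0 minus_add_distrib)
qed

lemma orient_cong: "(\<And>e. e \<in> E \<Longrightarrow> \<psi> e = \<theta> e) \<Longrightarrow> orient \<psi> = orient \<theta>"
  by (auto simp: orient_def fun_eq_iff)

lemma flow_chain_cong: "(\<And>e. e \<in> F \<Longrightarrow> \<psi> e = \<theta> e) \<Longrightarrow> flow_chain F M \<psi> = flow_chain F M \<theta>"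
  by (simp add: flow_chain_def[abs_def])

lemma balanced_cong: "(\<And>e. e \<in> F \<Longrightarrow> \<psi> e = \<theta> e) \<Longrightarrow> balanced F \<psi> \<longleftrightarrow> balanced F \<theta>"
  by (simp add: balanced_def)

text \<open>The smallest cover that sees \<open>e\<close> deletes only \<open>e\<close>. Its classes
  are singletons, so \<open>the_elem\<close> returns the cycle itself, and the coefficient on the
  first edge of its path is the flow through \<open>e\<close>.\<close>

definition cech_coef :: "(('v, 'e) point set set \<Rightarrow> (('v, 'e) point set list \<Rightarrow> int) set) \<Rightarrow> 'e \<Rightarrow> int" where
  "cech_coef x e = the_elem (x (star_cover {e} 3)) [node {e} 3 e 0, node {e} 3 e 1]"

abbreviation "cech_H1 \<equiv> cech_homology 1 (freudenthal G)"

lemma cech_restrict: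
  assumes x: "x \<in> carrier cech_H1" and F: "F' \<subseteq> F" "admissible F M" "admissible F' M'" "M = M' * d" and eq: "x (star_cover F M) = {flow_chain F M \<psi>}"
  shows "x (star_cover F' M') = {flow_chain F' M' \<psi>}"
proof -
  obtain r where r: "refinement_projection (star_cover F M) (star_cover F' M') r" "simplicial_chain_map r (flow_chain F M \<psi>) = flow_chain F' M' \<psi>"
    using refine_star_cover[OF F] by metis
  have "x (star_cover F' M') = simplicial_hom_induced 1 (nerve (star_cover F' M')) r (x (star_cover F M))"
    using x r star_cover_open_cover F unfolding carrier_cech by metis
  also have "x (star_cover F M) = hclass 1 (nerve (star_cover F M)) (flow_chain F M \<psi>)" using eq hclass_star_cover[OF F(2)] by simp
  also have "simplicial_hom_induced 1 (nerve (star_cover F' M')) r \<dots> = hclass 1 (nerve (star_cover F' M')) (simplicial_chain_map r (flow_chain F M \<psi>))"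
    by (rule hom_induced_hclass) (use nerve_projection[OF r(1)] finite_support_flow_chain F(2) in \<open>auto simp: admissible_def\<close>)
  finally show ?thesis using r hclass_star_cover[OF F(3)] by simp
qed

lemma cech_star_cover:
  assumes x: "x \<in> carrier cech_H1" and F: "admissible F M"
  shows "x (star_cover F M) = {flow_chain F M (cech_coef x)}" "balanced F (cech_coef x)"
proof -
  have ex: "\<exists>\<psi>. x (star_cover F M) = {flow_chain F M \<psi>} \<and> balanced F \<psi>" if F: "admissible F M" for F M
  proof -
    obtain c where c: "c \<in> cycles 1 (nerve (star_cover F M))" "x (star_cover F M) = hclass 1 (nerve (star_cover F M)) c"
      using x star_cover_open_cover[OF F] unfolding carrier_cech by blast
    obtain \<psi> where "c = flow_chain F M \<psi>" using cycles_star_cover_eq[OF F c(1)] by blast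
    then show ?thesis using c flow_chain_cycle_iff[OF F] hclass_star_cover[OF F] by auto
  qed
  \<comment> \<open>The factor 3 makes this cover finer than the given one and also finer than the
    covers in \<open>cech_coef\<close>.\<close>
  have M: "admissible F (3 * M)" using F by (auto simp: admissible_def)
  then obtain \<psi> where \<psi>: "x (star_cover F (3 * M)) = {flow_chain F (3 * M) \<psi>}" "balanced F \<psi>" using ex by blast
  have "\<psi> e = cech_coef x e" if e: "e \<in> F" for e
  proof -
    have e3: "admissible {e} 3" using F e by (auto simp: admissible_def)
    have "x (star_cover {e} 3) = {flow_chain {e} 3 \<psi>}" by (rule cech_restrict[OF x _ M e3 _ \<psi>(1)]) (use e in auto)
    then show ?thesis using flow_chain_at[OF e3, of e 0] by (simp add: cech_coef_def)
  qed
  then have eq: "flow_chain F M \<psi> = flow_chain F M (cech_coef x)" "balanced F (cech_coef x)"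
    using flow_chain_cong[of F \<psi> "cech_coef x"] balanced_cong[of F \<psi> "cech_coef x"] \<psi>(2) by simp_all
  have "x (star_cover F M) = {flow_chain F M \<psi>}" by (rule cech_restrict[OF x _ M F _ \<psi>(1), of 3]) auto
  then show "x (star_cover F M) = {flow_chain F M (cech_coef x)}" "balanced F (cech_coef x)" using eq by simp_all
qed

lemma cech_coef_flow: "x \<in> carrier cech_H1 \<Longrightarrow> cech_coef x \<in> flows"
  unfolding flows_def using cech_star_cover(2)[of x _ 3] by (simp add: admissible_def)

text \<open>The source of injectivity: every open cover is refined by a star cover, through which
  the coefficients determine the component of \<open>x\<close>.\<close>

lemma cech_value:
  assumes x: "x \<in> carrier cech_H1" and F: "admissible F M" and p: "refinement_projection (star_cover F M) \<U> p"
    and \<U>: "\<U> \<in> open_covers (freudenthal G)"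
  shows "x \<U> = hclass 1 (nerve \<U>) (simplicial_chain_map p (flow_chain F M (cech_coef x)))"
proof -
  have "x \<U> = simplicial_hom_induced 1 (nerve \<U>) p (x (star_cover F M))"
    using x p \<U> star_cover_open_cover[OF F] unfolding carrier_cech by metis
  also have "x (star_cover F M) = hclass 1 (nerve (star_cover F M)) (flow_chain F M (cech_coef x))" using cech_star_cover(1)[OF x F] hclass_star_cover[OF F] by simp
  also have "simplicial_hom_induced 1 (nerve \<U>) p \<dots> = hclass 1 (nerve \<U>) (simplicial_chain_map p (flow_chain F M (cech_coef x)))"
    by (rule hom_induced_hclass) (use nerve_projection[OF p] finite_support_flow_chain F in \<open>auto simp: admissible_def\<close>)
  finally show ?thesis .
qed

lemma cech_coef_mult:
  assumes x: "x \<in> carrier cech_H1" "y \<in> carrier cech_H1" and e: "e \<in> E"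
  shows "cech_coef (x \<otimes>\<^bsub>cech_H1\<^esub> y) e = cech_coef x e + cech_coef y e"
proof -
  have e3: "admissible {e} 3" using e by (auto simp: admissible_def)
  let ?K = "nerve (star_cover {e} 3)"
  have "(x \<otimes>\<^bsub>cech_H1\<^esub> y) (star_cover {e} 3) = hclass 1 ?K (flow_chain {e} 3 (cech_coef x)) \<otimes>\<^bsub>simplicial_homology 1 ?K\<^esub> hclass 1 ?K (flow_chain {e} 3 (cech_coef y))"
    using mult_cech[OF star_cover_open_cover[OF e3]] cech_star_cover(1)[OF x(1) e3] cech_star_cover(1)[OF x(2) e3] hclass_star_cover[OF e3] by simp
  also have "\<dots> = {\<lambda>xs. flow_chain {e} 3 (cech_coef x) xs + flow_chain {e} 3 (cech_coef y) xs}"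
    unfolding mult_homology by (rule hclass_star_cover[OF e3])
  finally show ?thesis using flow_chain_at[OF e3, of e 0] by (simp add: cech_coef_def)
qed

text \<open>On the common refinement with edge set \<open>F \<union> F'\<close> and mesh number
  \<open>M * M'\<close>, both sides come from projections of the same cover, and these agree up to a
  boundary on a flow.\<close>

lemma projections_agree:
  assumes \<psi>: "\<psi> \<in> flows"
    and F: "admissible F M" "refinement_projection (star_cover F M) \<U> p" and F': "admissible F' M'" "refinement_projection (star_cover F' M') \<U> p'"
  shows "hclass 1 (nerve \<U>) (simplicial_chain_map p (flow_chain F M \<psi>)) = hclass 1 (nerve \<U>) (simplicial_chain_map p' (flow_chain F' M' \<psi>))"
proof -
  have "M \<le> M * M'" using F' by (simp add: admissible_def)
  then have M2: "3 \<le> M * M'" using F(1) unfolding admissible_def by linarith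
  then have FF: "admissible (F \<union> F') (M * M')" using F F' M2 by (simp add: admissible_def)
  obtain r where r: "refinement_projection (star_cover (F \<union> F') (M * M')) (star_cover F M) r"
    "simplicial_chain_map r (flow_chain (F \<union> F') (M * M') \<psi>) = flow_chain F M \<psi>"
    using refine_star_cover[OF _ FF F(1), of M'] by blast
  obtain r' where r': "refinement_projection (star_cover (F \<union> F') (M * M')) (star_cover F' M') r'"
    "simplicial_chain_map r' (flow_chain (F \<union> F') (M * M') \<psi>) = flow_chain F' M' \<psi>"
    using refine_star_cover[OF _ FF F'(1), of M] by (auto simp: mult.commute)
  have fin: "finite {xs. flow_chain (F \<union> F') (M * M') \<psi> xs \<noteq> 0}" using FF finite_support_flow_chain by (simp add: admissible_def)
  have b: "balanced (F \<union> F') \<psi>" using \<psi> FF by (simp add: flows_def admissible_def)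
  have "(\<lambda>xs. simplicial_chain_map (p \<circ> r) (flow_chain (F \<union> F') (M * M') \<psi>) xs
      - simplicial_chain_map (p' \<circ> r') (flow_chain (F \<union> F') (M * M') \<psi>) xs) \<in> simplicial_boundaries 1 (nerve \<U>)"
    by (rule contiguous_homologous[OF FF b]) (use refinement_projection_comp r(1) r'(1) F(2) F'(2) in blast)+
  then have "(\<lambda>xs. simplicial_chain_map p (flow_chain F M \<psi>) xs - simplicial_chain_map p' (flow_chain F' M' \<psi>) xs) \<in> simplicial_boundaries 1 (nerve \<U>)"
    by (simp add: simplicial_chain_map_comp[OF fin, symmetric] r(2) r'(2))
  then show ?thesis by (rule hclass_eqI)
qed

text \<open>Surjectivity: each cover receives the image of the flow from some finer star cover. By
  \<open>projections_agree\<close> the value is independent of this choice, and the independence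
  also yields compatibility of the family.\<close>

lemma flow_cech:
  assumes \<psi>: "\<psi> \<in> flows" obtains x where "x \<in> carrier cech_H1" "\<And>e. e \<in> E \<Longrightarrow> cech_coef x e = \<psi> e"
proof -
  let ?O = "open_covers (freudenthal G)"
  have "\<forall>\<U>\<in>?O. \<exists>q. admissible (fst q) (fst (snd q)) \<and> refinement_projection (star_cover (fst q) (fst (snd q))) \<U> (snd (snd q))"
  proof
    fix \<U> assume U: "\<U> \<in> ?O"
    obtain F M p where F: "admissible F M" "refinement_projection (star_cover F M) \<U> p" using cofinal_star_cover[OF U] .
    show "\<exists>q. admissible (fst q) (fst (snd q)) \<and> refinement_projection (star_cover (fst q) (fst (snd q))) \<U> (snd (snd q))"
      by (rule exI[of _ "(F, M, p)"]) (simp add: F)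
  qed
  from bchoice[OF this] obtain q where q: "\<And>\<U>. \<U> \<in> ?O \<Longrightarrow> admissible (fst (q \<U>)) (fst (snd (q \<U>))) \<and>
      refinement_projection (star_cover (fst (q \<U>)) (fst (snd (q \<U>)))) \<U> (snd (snd (q \<U>)))"
    by blast
  define x where "x = restrict (\<lambda>\<U>. hclass 1 (nerve \<U>) (simplicial_chain_map (snd (snd (q \<U>))) (flow_chain (fst (q \<U>)) (fst (snd (q \<U>))) \<psi>))) ?O"
  have x: "x \<U> = hclass 1 (nerve \<U>) (simplicial_chain_map p (flow_chain F M \<psi>))"
    if "\<U> \<in> ?O" "admissible F M" "refinement_projection (star_cover F M) \<U> p" for \<U> F M p
  proof -
    have "x \<U> = hclass 1 (nerve \<U>) (simplicial_chain_map (snd (snd (q \<U>))) (flow_chain (fst (q \<U>)) (fst (snd (q \<U>))) \<psi>))"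
      unfolding x_def using that(1) by (rule restrict_apply')
    also have "\<dots> = hclass 1 (nerve \<U>) (simplicial_chain_map p (flow_chain F M \<psi>))"
      by (rule projections_agree[OF \<psi>]) (use q[OF that(1)] that in blast)+
    finally show ?thesis .
  qed
  have flow_chain: "flow_chain F M \<psi> \<in> cycles 1 (nerve (star_cover F M))" if "admissible F M" for F M
    using flow_chain_cycle_iff[OF that] \<psi> that by (simp add: flows_def admissible_def)
  have fin: "finite {xs. flow_chain F M \<psi> xs \<noteq> 0}" if "admissible F M" for F M
    using finite_support_flow_chain that by (simp add: admissible_def)
  have xC: "x \<in> carrier cech_H1"
    unfolding carrier_cech
  proof (intro conjI ballI allI impI)
    show "x \<in> extensional ?O" by (simp add: x_def)
    fix \<U> assume U: "\<U> \<in> ?O"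
    obtain F M p where F: "admissible F M" "refinement_projection (star_cover F M) \<U> p" using cofinal_star_cover[OF U] .
    show "x \<U> \<in> hclass 1 (nerve \<U>) ` cycles 1 (nerve \<U>)"
      unfolding x[OF U F] by (intro imageI chain_map_cycles[OF flow_chain[OF F(1)]] nerve_projection[OF F(2)])
  next
    fix \<U> \<U>' p assume U: "\<U> \<in> ?O" "\<U>' \<in> ?O" and p: "refinement_projection \<U>' \<U> p"
    obtain F M q where F: "admissible F M" "refinement_projection (star_cover F M) \<U>' q" using cofinal_star_cover[OF U(2)] .
    have "simplicial_hom_induced 1 (nerve \<U>) p (x \<U>') =
        hclass 1 (nerve \<U>) (simplicial_chain_map p (simplicial_chain_map q (flow_chain F M \<psi>)))"
      unfolding x[OF U(2) F]
      by (rule hom_induced_hclass) (use nerve_projection[OF p] finite_support_chain_map[OF fin[OF F(1)]] in auto)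
    also have "\<dots> = x \<U>"
      unfolding simplicial_chain_map_comp[OF fin[OF F(1)]]
      using x[OF U(1) F(1) refinement_projection_comp[OF F(2) p]] by simp
    finally show "simplicial_hom_induced 1 (nerve \<U>) p (x \<U>') = x \<U>" .
  qed
  have "cech_coef x e = \<psi> e" if e: "e \<in> E" for e
  proof -
    have e3: "admissible {e} 3" using e by (auto simp: admissible_def)
    have "x (star_cover {e} 3) = {flow_chain {e} 3 \<psi>}"
      using x[OF star_cover_open_cover[OF e3] e3, of "\<lambda>X. X"] hclass_star_cover[OF e3] simplicial_chain_map_id[OF fin[OF e3], of "\<lambda>X. X"]
      by (simp add: refinement_projection_def)
    then show ?thesis using flow_chain_at[OF e3, of e 0] by (simp add: cech_coef_def)
  qed
  then show thesis using that xC by blast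
qed

lemma cech_iso_flows:
  assumes C: "carrier (oriented_cycle_space G) = orient ` flows"
  shows "cech_H1 \<cong> oriented_cycle_space G"
proof -
  define h where "h x = orient (cech_coef x)" for x
  have mult: "\<phi> \<otimes>\<^bsub>oriented_cycle_space G\<^esub> \<phi>' = (\<lambda>a. \<phi> a + \<phi>' a)" for \<phi> \<phi>'
    by (simp add: oriented_cycle_space_def oriented_edge_space_def)
  have "h (x \<otimes>\<^bsub>cech_H1\<^esub> y) = h x \<otimes>\<^bsub>oriented_cycle_space G\<^esub> h y" if "x \<in> carrier cech_H1" "y \<in> carrier cech_H1" for x y
    unfolding h_def mult orient_add[symmetric] using cech_coef_mult[OF that] by (intro orient_cong) simp
  then have hom: "h \<in> hom cech_H1 (oriented_cycle_space G)"
    using cech_coef_flow by (auto simp: hom_def C h_def)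
  have "inj_on h (carrier cech_H1)"
  proof
    fix x y assume x: "x \<in> carrier cech_H1" and y: "y \<in> carrier cech_H1" and eq: "h x = h y"
    have ce: "cech_coef x e = cech_coef y e" if "e \<in> E" for e
      using orient_at[OF that, of "cech_coef x"] orient_at[OF that, of "cech_coef y"] eq by (simp add: h_def)
    show "x = y"
    proof (rule extensionalityI)
      show "x \<in> extensional (open_covers (freudenthal G))" "y \<in> extensional (open_covers (freudenthal G))"
        using x y by (auto simp: carrier_cech)
      fix \<U> assume U: "\<U> \<in> open_covers (freudenthal G)"
      obtain F M p where F: "admissible F M" "refinement_projection (star_cover F M) \<U> p" using cofinal_star_cover[OF U] .
      have "flow_chain F M (cech_coef x) = flow_chain F M (cech_coef y)" using ce F(1) by (intro flow_chain_cong) (auto simp: admissible_def)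
      then show "x \<U> = y \<U>" using cech_value[OF x F U] cech_value[OF y F U] by simp
    qed
  qed
  moreover have "h ` carrier cech_H1 = orient ` flows"
  proof
    show "h ` carrier cech_H1 \<subseteq> orient ` flows" using cech_coef_flow by (auto simp: h_def)
    show "orient ` flows \<subseteq> h ` carrier cech_H1"
    proof
      fix \<phi> assume "\<phi> \<in> orient ` flows"
      then obtain \<psi> where psi: "\<psi> \<in> flows" "\<phi> = orient \<psi>" by blast
      obtain x where x: "x \<in> carrier cech_H1" "\<And>e. e \<in> E \<Longrightarrow> cech_coef x e = \<psi> e" using flow_cech[OF psi(1)] by blast
      then have "h x = \<phi>" using psi orient_cong[of "cech_coef x" \<psi>] by (simp add: h_def)
      then show "\<phi> \<in> h ` carrier cech_H1" using x by blast
    qed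
  qed
  ultimately have "h \<in> iso cech_H1 (oriented_cycle_space G)" using hom by (simp add: iso_def bij_betw_def C)
  then show ?thesis by (auto simp: is_iso_def)
qed

end

section \<open>Circles cross every finite cut in a balanced way\<close>

text \<open>If \<open>k\<close> leaves the common value at a point \<open>m\<close>, then the value
  halfway between \<open>k a\<close> and \<open>k m\<close> is attained on both sides of
  \<open>m\<close>.\<close>

lemma not_inj_on_same_ends:
  fixes k :: "real \<Rightarrow> real"
  assumes ab: "a < b" and k: "continuous_on {a..b} k" "k a = k b"
  shows "\<not> inj_on k {a<..<b}"
proof
  assume inj: "inj_on k {a<..<b}"
  \<comment> \<open>Otherwise \<open>k\<close> is constant inside, and the points at one third and
    two thirds of the interval refute injectivity.\<close>
  have "\<exists>m. a < m \<and> m < b \<and> k m \<noteq> k a"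
  proof (rule ccontr)
    assume "\<not> ?thesis"
    then have "k ((2 * a + b) / 3) = k ((a + 2 * b) / 3)" using ab by (simp add: field_simps)
    then have "(2 * a + b) / 3 = (a + 2 * b) / 3" by (rule inj_onD[OF inj]) (use ab in auto)
    then show False using ab by simp
  qed
  then obtain m where m: "a < m" "m < b" "k m \<noteq> k a" by blast
  define y where "y = (k a + k m) / 2"
  have c1: "continuous_on {a..m} k" and c2: "continuous_on {m..b} k"
    using k(1) m by (auto intro: continuous_on_subset)
  have "\<exists>x1. a \<le> x1 \<and> x1 \<le> m \<and> k x1 = y"
  proof (cases "k a \<le> k m")
    case True
    then show ?thesis using IVT'[of k a y m] m c1 by (auto simp: y_def)
  next
    case False
    then show ?thesis using IVT2'[of k m y a] m c1 by (auto simp: y_def)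
  qed
  moreover have "\<exists>x2. m \<le> x2 \<and> x2 \<le> b \<and> k x2 = y"
  proof (cases "k a \<le> k m")
    case True
    then show ?thesis using IVT2'[of k b y m] m c2 k(2) by (auto simp: y_def)
  next
    case False
    then show ?thesis using IVT'[of k m y b] m c2 k(2) by (auto simp: y_def)
  qed
  ultimately obtain x1 x2 where x: "a \<le> x1" "x1 \<le> m" "k x1 = y" "m \<le> x2" "x2 \<le> b" "k x2 = y" by blast
  have "y \<noteq> k a" "y \<noteq> k m" using m by (auto simp: y_def)
  then have ne: "a \<noteq> x1" "x1 \<noteq> m" "m \<noteq> x2" "x2 \<noteq> b" using x(3,6) k(2) by metis+
  have "a < x1" "x1 < m" "m < x2" "x2 < b" using x(1,2,4,5) ne by linarith+
  then have "x1 \<in> {a<..<b}" "x2 \<in> {a<..<b}" "x1 \<noteq> x2" by simp_all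
  then show False using inj_onD[OF inj, of x1 x2] x(3,6) by simp
qed

text \<open>A closed path becomes a periodic map on the line, so that cyclic intervals turn into
  ordinary ones. Care is required only at integers, whose left neighbours have fractional part near
  1; there \<open>h 0 = h 1\<close> is used.\<close>

lemma continuous_map_frac:
  assumes h: "pathin X h" "h 0 = h 1" shows "continuous_map euclideanreal X (\<lambda>x. h (frac x))"
proof -
  have top: "h t \<in> topspace X" if "t \<in> {0..1}" for t
    using h that by (auto simp: pathin_def continuous_map_def)
  have fr: "frac x \<in> {0..1}" for x :: real using frac_ge_0[of x] frac_lt_1[of x] by simp
  have "open {x. h (frac x) \<in> U}" if U: "openin X U" for U
  proof -
    define P where "P = {t \<in> {0..1}. h t \<in> U}"
    have "openin (top_of_set {0..1}) P"
      using openin_continuous_map_preimage[OF h(1)[unfolded pathin_def] U] by (simp add: P_def)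
    then have P: "\<exists>d>0. \<forall>z\<in>{0..1}. \<bar>z - y\<bar> < d \<longrightarrow> h z \<in> U" if "y \<in> {0..1}" "h y \<in> U" for y
      using that unfolding openin_contains_ball P_def
      by (fastforce simp: dist_real_def abs_minus_commute subset_iff)
    show ?thesis unfolding open_dist
    proof (intro ballI)
      fix x assume "x \<in> {x. h (frac x) \<in> U}"
      then have hx: "h (frac x) \<in> U" by simp
      obtain d where d: "d > 0" "\<And>z. z \<in> {0..1} \<Longrightarrow> \<bar>z - frac x\<bar> < d \<Longrightarrow> h z \<in> U" using P[OF fr hx] by blast
      show "\<exists>e>0. \<forall>y. dist y x < e \<longrightarrow> y \<in> {x. h (frac x) \<in> U}"
      proof (cases "frac x = 0")
        case False
        then have pos: "0 < frac x" using frac_ge_0[of x] by simp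
        define e where "e = min d (min (frac x) (1 - frac x))"
        have "h (frac y) \<in> U" if "dist y x < e" for y
        proof -
          have "\<bar>y - x\<bar> < frac x" "\<bar>y - x\<bar> < 1 - frac x" "\<bar>y - x\<bar> < d" using that by (auto simp: e_def dist_real_def)
          then have "\<lfloor>y\<rfloor> = \<lfloor>x\<rfloor>" unfolding frac_def by linarith
          then have "frac y - frac x = y - x" by (simp add: frac_def)
          then show ?thesis using d(2)[OF fr] \<open>\<bar>y - x\<bar> < d\<close> by simp
        qed
        moreover have "e > 0" using d pos frac_lt_1[of x] by (simp add: e_def)
        ultimately show ?thesis by blast
      next
        case True
        then have "h 1 \<in> U" using hx h(2) by metis
        then obtain d' where d': "d' > 0" "\<And>z. z \<in> {0..1} \<Longrightarrow> \<bar>z - 1\<bar> < d' \<Longrightarrow> h z \<in> U" using P[of 1] by auto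
        define e where "e = min d (min d' 1)"
        have "h (frac y) \<in> U" if "dist y x < e" for y
        proof -
          have yx: "\<bar>y - x\<bar> < 1" "\<bar>y - x\<bar> < d'" "\<bar>y - x\<bar> < d" using that by (auto simp: e_def dist_real_def)
          have xf: "x = of_int \<lfloor>x\<rfloor>" using True by (simp add: frac_def)
          show ?thesis
          proof (cases "x \<le> y")
            case True
            then have "\<lfloor>y\<rfloor> = \<lfloor>x\<rfloor>" using yx xf by linarith
            then have "frac y = y - x" using xf by (simp add: frac_def)
            then show ?thesis using d(2)[OF fr, of y] yx \<open>frac x = 0\<close> by simp
          next
            case False
            then have "\<lfloor>y\<rfloor> = \<lfloor>x\<rfloor> - 1" using yx xf by linarith
            then have "frac y - 1 = y - x" using xf by (simp add: frac_def)
            then show ?thesis using d'(2)[OF fr, of y] yx by simp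
          qed
        qed
        moreover have "e > 0" using d d' by (simp add: e_def)
        ultimately show ?thesis by blast
      qed
    qed
  qed
  then show ?thesis using top fr by (auto simp: continuous_map_def)
qed

lemma frac_eq_iff: "frac (x::real) = frac y \<longleftrightarrow> (\<exists>n::int. x = y + of_int n)"
proof
  assume "frac x = frac y"
  then have "x = y + of_int (\<lfloor>x\<rfloor> - \<lfloor>y\<rfloor>)" by (simp add: frac_def)
  then show "\<exists>n::int. x = y + of_int n" by blast
next
  assume "\<exists>n::int. x = y + of_int n"
  then obtain n :: int where "x = y + of_int n" by blast
  then have "\<lfloor>x\<rfloor> = \<lfloor>y\<rfloor> + n" by simp
  then show "frac x = frac y" using \<open>x = y + of_int n\<close> by (simp add: frac_def)
qed

context lf_graph
begin

text \<open>The indicator of one side of a cut on vertices and ends, extended linearly along the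
  edges. Barycentric coordinates make it independent of the reference orientation.\<close>

fun height :: "'v set \<Rightarrow> ('v, 'e) point \<Rightarrow> real" where
  "height K (Vertex w) = of_bool (w \<in> K)"
| "height K (Inner e b) = (\<Sum>w\<in>endpts G e. b w * of_bool (w \<in> K))"
| "height K (End w) = of_bool (end_in w K)"

lemma height_epoint:
  assumes e: "e \<in> E" and t: "t \<in> {0..1}"
  shows "height K (epoint e t) = (1 - t) * of_bool (src e \<in> K) + t * of_bool (tgt e \<in> K)"
proof -
  consider "t = 0" | "t = 1" | "0 < t" "t < 1" using t by fastforce
  then show ?thesis
  proof cases
    case 3
    then show ?thesis using epoint_Inner[OF 3, of e] endpts_eq[OF e] src_neq_tgt[OF e] by auto
  qed auto
qed

lemma height_piece:
  assumes F: "finite F" "F \<subseteq> E" and K: "K \<in> comps G F" "K' \<in> comps G F" and p: "p \<in> piece F K'"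
  shows "height K p = of_bool (K' = K)"
proof -
  have mem: "v \<in> K' \<Longrightarrow> v \<in> K \<longleftrightarrow> K' = K" for v using comps_eqI[OF K] by blast
  have "p \<in> points" using piece_points K p by blast
  then show ?thesis
  proof (cases rule: points_cases)
    case (V v)
    then show ?thesis using p mem by simp
  next
    case (E e t)
    then have "src e \<in> K'" "tgt e \<in> K'" using p epoint_piece by auto
    then show ?thesis using E mem height_epoint[of e t K] by (auto simp: algebra_simps)
  next
    case (End w)
    then show ?thesis using p end_in_unique[of w K K'] K by auto
  qed
qed

text \<open>On an edge the height is affine, and near an end it is constant because it is constant
  on every piece.\<close>

lemma continuous_height:
  assumes F: "finite F" "F \<subseteq> E" and K: "K \<in> comps G F"
  shows "continuous_map (freudenthal G) euclideanreal (height K)"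
proof -
  have "openin (freudenthal G) {p \<in> points. height K p \<in> T}" if T: "open T" for T
    unfolding openin_freudenthal_iff
  proof (intro conjI ballI allI impI)
    fix e assume e: "e \<in> E"
    have "continuous_on {0..1} (\<lambda>t. (1 - t) * of_bool (src e \<in> K) + t * of_bool (tgt e \<in> K) :: real)"
      by (intro continuous_intros)
    then have "openin (top_of_set {0..1}) {t \<in> {0..1}. (1 - t) * of_bool (src e \<in> K) + t * of_bool (tgt e \<in> K) \<in> T}"
      by (rule continuous_openin_preimage_gen[OF _ T, unfolded vimage_def Int_def mem_Collect_eq])
    moreover have "edge_trace e {p \<in> points. height K p \<in> T} = {t \<in> {0..1}. (1 - t) * of_bool (src e \<in> K) + t * of_bool (tgt e \<in> K) \<in> T}"
      using height_epoint[OF e, of _ K] epoint_points[OF e] by (auto simp: edge_trace_def)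
    ultimately show "open_trace e {p \<in> points. height K p \<in> T}" by (simp add: open_trace_def)
  next
    fix w assume w: "End w \<in> {p \<in> points. height K p \<in> T}"
    then have we: "w \<in> graph_ends G" using End_points by blast
    obtain K' where K': "K' \<in> comps G F" "end_in w K'" using end_comp[OF we F] .
    have *: "End w \<in> piece F K'" using we K' by simp
    have "height K p = height K (End w)" if "p \<in> piece F K'" for p
      unfolding height_piece[OF F K K'(1) *] by (rule height_piece[OF F K K'(1) that])
    then have "piece F K' \<subseteq> {p \<in> points. height K p \<in> T}" using w piece_points[OF K'(1)] by auto
    then show "end_nbhd {p \<in> points. height K p \<in> T} w" using F K' unfolding end_nbhd_def by blast
  qed auto
  then show ?thesis by (simp add: continuous_map_def)
qed

section \<open>How a circle runs through the edges that it visits\<close>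

lemma openin_open_edge: assumes e: "e \<in> E" shows "openin (freudenthal G) (open_edge G e)"
  unfolding openin_freudenthal_iff
proof (intro conjI ballI allI impI)
  show "open_edge G e \<subseteq> points" using e by (auto simp: points_def graph_points_def)
  show "end_nbhd (open_edge G e) w" if "End w \<in> open_edge G e" for w using that open_edge_eq[OF e] by auto
  fix e' assume "e' \<in> E"
  have "epoint e' t \<in> open_edge G e \<longleftrightarrow> e' = e \<and> t \<in> {0<..<1}" if t: "t \<in> {0..1}" for t
    using epoint_inj[of e _ e' t] unfolding open_edge_eq[OF e] by auto
  then have "edge_trace e' (open_edge G e) = {0..1} \<inter> (if e' = e then {0<..<1} else {})" by (auto simp: edge_trace_def)
  then show "open_trace e' (open_edge G e)" unfolding open_trace_def openin_open by auto
qed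

definition closed_edge :: "'e \<Rightarrow> ('v, 'e) point set" where
  "closed_edge e = epoint e ` {0..1}"

lemma closed_edge_eq: "e \<in> E \<Longrightarrow> closed_edge e = insert (Vertex (src e)) (insert (Vertex (tgt e)) (open_edge G e))"
proof -
  assume e: "e \<in> E"
  have "{0..1} = insert 0 (insert 1 {0<..<1::real})" by auto
  then show ?thesis unfolding closed_edge_def open_edge_eq[OF e] by simp
qed

text \<open>At an end, deleting all edges at the two endvertices of \<open>e\<close> leaves a piece
  that misses the closed edge.\<close>

lemma openin_closed_edge_complement: assumes e: "e \<in> E" shows "openin (freudenthal G) (points - closed_edge e)"
  unfolding openin_freudenthal_iff
proof (intro conjI ballI allI impI)
  fix e' assume e': "e' \<in> E"
  show "open_trace e' (points - closed_edge e)"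
  proof (cases "e' = e")
    case True
    then have "edge_trace e' (points - closed_edge e) = {}" by (auto simp: edge_trace_def closed_edge_def)
    then show ?thesis by (simp add: open_trace_def)
  next
    case False
    have "epoint e' t \<notin> closed_edge e" if "0 < t" "t < 1" for t
      using epoint_inj[of e' t e] that False by (auto simp: closed_edge_def)
    then have "edge_trace e' (points - closed_edge e) = {0..1} \<inter> - {t \<in> {0, 1}. epoint e' t \<in> closed_edge e}"
      using epoint_points[OF e'] by (force simp: edge_trace_def)
    moreover have "open (- {t \<in> {0, 1}. epoint e' t \<in> closed_edge e})"
      by (intro open_Compl finite_imp_closed) simp
    ultimately show ?thesis unfolding open_trace_def openin_open by blast
  qed
next
  fix w assume "End w \<in> points - closed_edge e"
  then have w: "w \<in> graph_ends G" using End_points by blast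
  define S where "S = {src e, tgt e}"
  have S: "finite S" "S \<subseteq> V" using src_V tgt_V e by (auto simp: S_def)
  have F: "finite (star_edges G S)" "star_edges G S \<subseteq> E" using finite_star_edges[OF S] star_edges_subset by auto
  obtain K where K: "K \<in> comps G (star_edges G S)" "end_in w K" using end_comp[OF w F] .
  have KS: "K \<inter> S = {}"
  proof (rule ccontr)
    assume "K \<inter> S \<noteq> {}"
    then obtain s where "s \<in> K" "s \<in> S" by blast
    then have "K = {s}" using comps_mem_eq[OF K(1)] comp_of_star_single[of s S] by simp
    then show False using end_not_finite[OF w K(2)] by simp
  qed
  have "e \<in> star_edges G S" using e endpts_eq[OF e] by (auto simp: star_edges_def S_def)
  then have "epoint e t \<notin> piece (star_edges G S) K" if t: "t \<in> {0..1}" for t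
  proof -
    consider "t = 0" | "t = 1" | "0 < t" "t < 1" using t by fastforce
    then show ?thesis using KS epoint_piece[OF e] \<open>e \<in> star_edges G S\<close> by cases (auto simp: S_def)
  qed
  then have "piece (star_edges G S) K \<subseteq> points - closed_edge e" using piece_points[OF K(1)] by (auto simp: closed_edge_def)
  then show "end_nbhd (points - closed_edge e) w" using F K unfolding end_nbhd_def by blast
qed auto

text \<open>The cut around the single vertex \<open>tgt e\<close> extends the parameter of
  \<open>e\<close> to a continuous function on the whole space.\<close>

lemma height_tgt:
  assumes e: "e \<in> E" shows "continuous_map (freudenthal G) euclideanreal (height {tgt e})"
    "t \<in> {0..1} \<Longrightarrow> height {tgt e} (epoint e t) = t"
proof -
  have F: "finite (star_edges G {tgt e})" "star_edges G {tgt e} \<subseteq> E"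
    using finite_star_edges[of "{tgt e}"] tgt_V[OF e] star_edges_subset by auto
  have "{tgt e} \<in> comps G (star_edges G {tgt e})"
    using comp_of_in_comps[OF tgt_V[OF e], of "star_edges G {tgt e}"] comp_of_star_single[of "tgt e" "{tgt e}"] by simp
  then show "continuous_map (freudenthal G) euclideanreal (height {tgt e})" using continuous_height F by blast
  show "t \<in> {0..1} \<Longrightarrow> height {tgt e} (epoint e t) = t" using height_epoint[OF e] src_neq_tgt[OF e] by simp
qed

lemma circle_eq_iff:
  assumes c: "circle G \<alpha>" shows "\<alpha> (frac x) = \<alpha> (frac y) \<longleftrightarrow> (\<exists>n::int. x = y + of_int n)"
proof -
  have "frac z \<in> {0..<1}" for z :: real using frac_ge_0[of z] frac_lt_1[of z] by simp
  then have "\<alpha> (frac x) = \<alpha> (frac y) \<longleftrightarrow> frac x = frac y"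
    using c unfolding circle_def by (metis inj_on_eq_iff)
  then show ?thesis using frac_eq_iff by simp
qed

lemma circle_continuous:
  assumes c: "circle G \<alpha>" shows "continuous_map euclideanreal (freudenthal G) (\<lambda>x. \<alpha> (frac x))"
  using c continuous_map_frac unfolding circle_def by blast

lemma circle_height_continuous:
  assumes c: "circle G \<alpha>" and h: "continuous_map (freudenthal G) euclideanreal h"
  shows "continuous_on S (\<lambda>x. h (\<alpha> (frac x)))"
proof -
  have "continuous_map euclideanreal euclideanreal (h \<circ> (\<lambda>x. \<alpha> (frac x)))"
    using continuous_map_compose[OF circle_continuous[OF c] h] .
  then show ?thesis by (simp add: o_def continuous_on_subset[OF _ subset_UNIV])
qed

text \<open>Take the maximal interval around \<open>x0\<close> that stays in the open edge. It
  begins and ends at endvertices since the closed edge is a closed set. The edge parameter is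
  injective inside, so these endvertices differ, and the intermediate value theorem yields every
  point of the edge.\<close>

lemma visited_edge_traversed:
  assumes c: "circle G \<alpha>" and e: "e \<in> E" and x0: "\<alpha> (frac x0) \<in> open_edge G e"
  shows "traverses G \<alpha> (e, src e, tgt e) \<or> traverses G \<alpha> (e, tgt e, src e)"
proof -
  define \<beta> where "\<beta> x = \<alpha> (frac x)" for x
  define k where "k x = height {tgt e} (\<beta> x)" for x
  have bc: "continuous_map euclideanreal (freudenthal G) \<beta>"
    using circle_continuous[OF c] by (simp add: \<beta>_def[abs_def])
  have kc: "continuous_on S k" for S
    using circle_height_continuous[OF c height_tgt(1)[OF e]] by (simp add: k_def[abs_def] \<beta>_def)
  have bper: "\<beta> (x + of_int n) = \<beta> x" for x and n :: int
    unfolding \<beta>_def circle_eq_iff[OF c] by blast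
  have kpt: "k x = t" if "\<beta> x = epoint e t" "t \<in> {0..1}" for x t
    using height_tgt(2)[OF e that(2)] that(1) by (simp add: k_def)
  have binj: "x = y" if "\<beta> x = \<beta> y" "\<bar>x - y\<bar> < 1" for x y
  proof -
    have "\<exists>n::int. x = y + of_int n" using that(1) unfolding \<beta>_def circle_eq_iff[OF c] .
    then obtain n :: int where "x = y + of_int n" by blast
    moreover from this have "n = 0" using that(2) by auto
    ultimately show ?thesis by simp
  qed
  have kinj: "inj_on k {a<..<b}" if ab: "b \<le> a + 1" "\<And>x. x \<in> {a<..<b} \<Longrightarrow> \<beta> x \<in> open_edge G e" for a b
  proof
    fix x y assume xy: "x \<in> {a<..<b}" "y \<in> {a<..<b}" "k x = k y"
    obtain t where t: "t \<in> {0<..<1}" "\<beta> x = epoint e t" using ab(2)[OF xy(1)] open_edge_eq[OF e] by auto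
    obtain t' where t': "t' \<in> {0<..<1}" "\<beta> y = epoint e t'" using ab(2)[OF xy(2)] open_edge_eq[OF e] by auto
    have "t = t'" using kpt t t' xy(3) by fastforce
    then show "x = y" using binj[of x y] t t' xy ab(1) by auto
  qed
  define B where "B = {x. \<beta> x \<notin> open_edge G e}"
  have "open {x. \<beta> x \<in> open_edge G e}"
    using openin_continuous_map_preimage[OF bc openin_open_edge[OF e]] by simp
  moreover have "B = - {x. \<beta> x \<in> open_edge G e}" by (auto simp: B_def)
  ultimately have Bcl: "closed B" by (simp add: closed_def)
  \<comment> \<open>A circle cannot stay in one open edge: the parameter \<open>k\<close> would be
    injective on an open period and equal at its two ends.\<close>
  have "B \<noteq> {}"
  proof
    assume "B = {}"
    then have "inj_on k {0<..<1}" by (intro kinj) (auto simp: B_def)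
    moreover have "k 0 = k 1" using bper[of 0 1] by (simp add: k_def)
    ultimately show False using not_inj_on_same_ends[of 0 1 k] kc by simp
  qed
  then obtain b where "b \<in> B" by blast
  \<comment> \<open>The translate of \<open>b\<close> at most one period before \<open>x0\<close>.
    The maximal interval then fits between \<open>b'\<close> and \<open>b' + 1\<close> and has
    length at most 1, as cyclic traversal demands.\<close>
  define b' where "b' = b + of_int \<lfloor>x0 - b\<rfloor>"
  have b': "b' \<in> B" "b' + 1 \<in> B" using \<open>b \<in> B\<close> bper[of b] bper[of b' 1] by (auto simp: B_def b'_def)
  have x0b: "b' \<le> x0" "x0 < b' + 1" unfolding b'_def by linarith+
  define s where "s = Sup {x \<in> B. x \<le> x0}"
  define t where "t = Inf {x \<in> B. x0 \<le> x}"
  have cl1: "closed {x \<in> B. x \<le> x0}" "closed {x \<in> B. x0 \<le> x}"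
    using closed_Int[OF Bcl closed_atMost[of x0]] closed_Int[OF Bcl closed_atLeast[of x0]] by (simp_all add: Int_def)
  have bdd: "bdd_above {x \<in> B. x \<le> x0}" "bdd_below {x \<in> B. x0 \<le> x}" by (auto intro: bdd_aboveI bdd_belowI)
  have ne: "{x \<in> B. x \<le> x0} \<noteq> {}" "{x \<in> B. x0 \<le> x} \<noteq> {}" using b' x0b by (auto intro: less_imp_le)
  have sB: "s \<in> B" "s \<le> x0" using closed_contains_Sup[OF ne(1) bdd(1) cl1(1)] by (auto simp: s_def)
  have tB: "t \<in> B" "x0 \<le> t" using closed_contains_Inf[OF ne(2) bdd(2) cl1(2)] by (auto simp: t_def)
  have "x0 \<notin> B" using x0 by (simp add: B_def \<beta>_def)
  then have st: "s < x0" "x0 < t" using sB tB by (auto simp: less_le)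
  have "b' \<le> s" unfolding s_def using b' x0b by (intro cSup_upper bdd) auto
  moreover have "t \<le> b' + 1" unfolding t_def using b' x0b by (intro cInf_lower bdd) auto
  ultimately have ts: "t \<le> s + 1" by linarith
  have inner: "\<beta> x \<in> open_edge G e" if x: "x \<in> {s<..<t}" for x
  proof (rule ccontr)
    assume "\<beta> x \<notin> open_edge G e"
    then have xB: "x \<in> B" by (simp add: B_def)
    show False
    proof (cases "x \<le> x0")
      case True
      then have "x \<le> s" unfolding s_def using xB by (intro cSup_upper bdd) auto
      then show False using x by simp
    next
      case False
      then have "t \<le> x" unfolding t_def using xB by (intro cInf_lower bdd) auto
      then show False using x by simp
    qed
  qed
  have "open {x. \<beta> x \<in> points - closed_edge e}"
    using openin_continuous_map_preimage[OF bc openin_closed_edge_complement[OF e]] by simp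
  moreover have bp: "\<beta> x \<in> points" for x using bc by (auto simp: continuous_map_def)
  then have "{x. \<beta> x \<in> closed_edge e} = - {x. \<beta> x \<in> points - closed_edge e}" by auto
  ultimately have "closed {x. \<beta> x \<in> closed_edge e}" by (simp add: closed_def)
  moreover have "{s<..<t} \<subseteq> {x. \<beta> x \<in> closed_edge e}" using inner closed_edge_eq[OF e] by auto
  ultimately have "closure {s<..<t} \<subseteq> {x. \<beta> x \<in> closed_edge e}" by (rule closure_minimal[rotated])
  then have "{s..t} \<subseteq> {x. \<beta> x \<in> closed_edge e}" using st by (simp add: closure_greaterThanLessThan)
  moreover have "s \<in> {s..t}" "t \<in> {s..t}" using st by auto
  ultimately have "\<beta> s \<in> closed_edge e" "\<beta> t \<in> closed_edge e" by blast+
  then have ends: "\<beta> s = Vertex (src e) \<or> \<beta> s = Vertex (tgt e)" "\<beta> t = Vertex (src e) \<or> \<beta> t = Vertex (tgt e)"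
    using sB tB closed_edge_eq[OF e] by (auto simp: B_def)
  have kv: "k x = 0" if "\<beta> x = Vertex (src e)" for x using kpt[of x 0] that by simp
  have kw: "k x = 1" if "\<beta> x = Vertex (tgt e)" for x using kpt[of x 1] that by simp
  have "k s \<noteq> k t" using not_inj_on_same_ends[of s t k] kc kinj[OF ts inner] st by auto
  then have dir: "(\<beta> s = Vertex (src e) \<and> \<beta> t = Vertex (tgt e)) \<or> (\<beta> s = Vertex (tgt e) \<and> \<beta> t = Vertex (src e))"
    using ends kv[of s] kv[of t] kw[of s] kw[of t] by auto
  have img: "\<beta> ` {s<..<t} = open_edge G e"
  proof
    show "\<beta> ` {s<..<t} \<subseteq> open_edge G e" using inner by blast
    show "open_edge G e \<subseteq> \<beta> ` {s<..<t}"
    proof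
      fix p assume "p \<in> open_edge G e"
      then obtain y where y: "y \<in> {0<..<1}" "p = epoint e y" using open_edge_eq[OF e] by auto
      have "\<exists>x. s \<le> x \<and> x \<le> t \<and> k x = y"
        using dir
      proof
        assume "\<beta> s = Vertex (src e) \<and> \<beta> t = Vertex (tgt e)"
        then show ?thesis using IVT'[of k s y t] kv[of s] kw[of t] y st kc by auto
      next
        assume "\<beta> s = Vertex (tgt e) \<and> \<beta> t = Vertex (src e)"
        then show ?thesis using IVT2'[of k t y s] kv[of t] kw[of s] y st kc by auto
      qed
      then obtain x where x: "s \<le> x" "x \<le> t" "k x = y" by blast
      have "x \<noteq> s" "x \<noteq> t" using x dir kv kw y by fastforce+
      then have x': "x \<in> {s<..<t}" using x by auto
      then obtain t' where "t' \<in> {0<..<1}" "\<beta> x = epoint e t'" using inner open_edge_eq[OF e] by blast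
      then have "\<beta> x = p" using kpt[of x t'] x y by auto
      then show "p \<in> \<beta> ` {s<..<t}" using x' by blast
    qed
  qed
  have oe: "(e, src e, tgt e) \<in> oriented_edges G" "(e, tgt e, src e) \<in> oriented_edges G"
    using e endpts_eq[OF e] by (auto simp: oriented_edges_def)
  show ?thesis using dir
  proof
    assume "\<beta> s = Vertex (src e) \<and> \<beta> t = Vertex (tgt e)"
    then have "traverses G \<alpha> (e, src e, tgt e)"
      unfolding traverses.simps using oe st ts img by (intro conjI exI[of _ s] exI[of _ t]) (auto simp: \<beta>_def)
    then show ?thesis ..
  next
    assume "\<beta> s = Vertex (tgt e) \<and> \<beta> t = Vertex (src e)"
    then have "traverses G \<alpha> (e, tgt e, src e)"
      unfolding traverses.simps using oe st ts img by (intro conjI exI[of _ s] exI[of _ t]) (auto simp: \<beta>_def)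
    then show ?thesis ..
  qed
qed

text \<open>The ends of two opposite traversals match up to integer translations, so the two
  intervals together fill exactly one period. They are disjoint modulo 1, although both map onto the
  same open edge.\<close>

lemma not_traverses_both:
  assumes c: "circle G \<alpha>" and tr: "traverses G \<alpha> (e, u, v)" shows "\<not> traverses G \<alpha> (e, v, u)"
proof
  assume "traverses G \<alpha> (e, v, u)"
  then obtain s' t' where 2: "s' < t'" "t' \<le> s' + 1" "\<alpha> (frac s') = Vertex v" "\<alpha> (frac t') = Vertex u"
    "(\<lambda>x. \<alpha> (frac x)) ` {s'<..<t'} = open_edge G e" by auto
  obtain s t where 1: "s < t" "t \<le> s + 1" "\<alpha> (frac s) = Vertex u" "\<alpha> (frac t) = Vertex v"
    "(\<lambda>x. \<alpha> (frac x)) ` {s<..<t} = open_edge G e" using tr by auto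
  have e: "e \<in> E" "endpts G e = {u, v}" using tr by (auto simp: oriented_edges_def)
  then have uv: "u \<noteq> v" using endpts_neq by blast
  obtain n where n: "s' = t + of_int n" using 1 2 circle_eq_iff[OF c, of s' t] by auto
  obtain m where m: "t' = s + of_int m" using 1 2 circle_eq_iff[OF c, of t' s] by auto
  have "t \<noteq> s + 1" using 1 uv circle_eq_iff[OF c, of t s] by (auto dest: spec[of _ 1])
  then have ts: "t < s + 1" using 1 by simp
  have "0 < s - t + of_int (m - n)" "s - t + of_int (m - n) \<le> (1::real)" using 2 n m by auto
  then have "0 < of_int (m - n) + (0::real)" "of_int (m - n) < (2::real)" using 1 ts by linarith+
  then have "m - n = 1" by linarith
  then have t': "t' = s + 1 + of_int n" using m by simp
  define y where "y = (s' + t') / 2"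
  have y: "y \<in> {s'<..<t'}" using 2 by (auto simp: y_def)
  then have "\<alpha> (frac y) \<in> (\<lambda>x. \<alpha> (frac x)) ` {s<..<t}" using 1 2 by auto
  then obtain x where x: "x \<in> {s<..<t}" "\<alpha> (frac y) = \<alpha> (frac x)" by auto
  then obtain l where "y = x + of_int l" using circle_eq_iff[OF c] by auto
  then have "real_of_int (l - n) < 1" "0 < real_of_int (l - n)" using x y n t' 1 by auto
  then have "l - n < 1" "0 < l - n" by (simp_all only: of_int_less_1_iff of_int_0_less_iff)
  then show False by simp
qed

text \<open>The definition of \<open>oriented_circuit\<close> tests one direction first; it is
  antisymmetric because no circle traverses an edge in both directions.\<close>

lemma oriented_circuit_orient:
  assumes c: "circle G \<alpha>"
  shows "oriented_circuit G \<alpha> = orient (\<lambda>e. oriented_circuit G \<alpha> (e, src e, tgt e))"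
proof
  fix a :: "'e \<times> 'v \<times> 'v"
  obtain e u v where a: "a = (e, u, v)" by (cases a)
  show "oriented_circuit G \<alpha> a = orient (\<lambda>e. oriented_circuit G \<alpha> (e, src e, tgt e)) a"
  proof (cases "a \<in> oriented_edges G")
    case False
    then have neg: "\<not> (e \<in> E \<and> u = src e \<and> v = tgt e)" "\<not> (e \<in> E \<and> u = tgt e \<and> v = src e)"
      using endpts_eq[of e] unfolding a oriented_edges_def by blast+
    show ?thesis using oriented_circuit_outside[OF False] unfolding a orient_apply if_not_P[OF neg(1)] if_not_P[OF neg(2)] .
  next
    case True
    then have e: "e \<in> E" "endpts G e = {u, v}" by (auto simp: a oriented_edges_def)
    then show ?thesis
    proof (cases rule: src_tgt_cases)
      case 1
      then show ?thesis using orient_at[OF e(1), of "\<lambda>e. oriented_circuit G \<alpha> (e, src e, tgt e)"] by (simp add: a)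
    next
      case 2
      have "orient \<psi> (e, tgt e, src e) = - \<psi> e" for \<psi>
        using e(1) src_neq_tgt[OF e(1)] unfolding orient_apply by metis
      moreover have "oriented_circuit G \<alpha> (e, tgt e, src e) = - oriented_circuit G \<alpha> (e, src e, tgt e)"
        using not_traverses_both[OF c, of e "src e" "tgt e"] unfolding oriented_circuit_def reverse_edge.simps
        by (cases "traverses G \<alpha> (e, src e, tgt e)"; cases "traverses G \<alpha> (e, tgt e, src e)") (simp_all only: if_True if_False, simp_all)
      ultimately show ?thesis by (simp only: a 2)
    qed
  qed
qed

text \<open>Subtracting from the height the progress made along each traversed edge of
  \<open>F\<close> leaves a continuous function with integer values. It is constant over one period,
  so the total progress is 0.\<close>

lemma oriented_circuit_flow:
  assumes c: "circle G \<alpha>"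
  shows "(\<lambda>e. oriented_circuit G \<alpha> (e, src e, tgt e)) \<in> flows"
  unfolding flows_def balanced_def
proof (intro CollectI allI impI ballI)
  fix F K assume F: "finite F \<and> F \<subseteq> E" and K: "K \<in> comps G F"
  define \<psi> where "\<psi> e = oriented_circuit G \<alpha> (e, src e, tgt e)" for e
  define T where "T = {e \<in> F. \<psi> e \<noteq> 0}"
  define \<beta> where "\<beta> x = \<alpha> (frac x)" for x
  have beq: "\<beta> x = \<beta> y \<longleftrightarrow> (\<exists>n::int. x = y + of_int n)" for x y using circle_eq_iff[OF c] by (simp add: \<beta>_def)
  have FE: "finite F" "F \<subseteq> E" "finite T" "T \<subseteq> F" using F by (auto simp: T_def)
  have tr: "\<exists>s t x y. s < t \<and> t \<le> s + 1 \<and> \<beta> s = Vertex x \<and> \<beta> t = Vertex y \<and> \<beta> ` {s<..<t} = open_edge G e \<and>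
      of_bool (y \<in> K) - of_bool (x \<in> K) = \<psi> e * crossing K e"
    if e: "e \<in> T" for e
  proof -
    consider "\<psi> e = 1" "traverses G \<alpha> (e, src e, tgt e)" | "\<psi> e = - 1" "traverses G \<alpha> (e, tgt e, src e)"
      using e by (auto simp: T_def \<psi>_def oriented_circuit_def split: if_splits)
    then show ?thesis
    proof cases
      case 1
      then obtain s t where "s < t" "t \<le> s + 1" "\<beta> s = Vertex (src e)" "\<beta> t = Vertex (tgt e)" "\<beta> ` {s<..<t} = open_edge G e"
        by (auto simp: \<beta>_def)
      then show ?thesis using 1 by (intro exI[of _ s] exI[of _ t] exI[of _ "src e"] exI[of _ "tgt e"]) simp
    next
      case 2
      then obtain s t where "s < t" "t \<le> s + 1" "\<beta> s = Vertex (tgt e)" "\<beta> t = Vertex (src e)" "\<beta> ` {s<..<t} = open_edge G e"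
        by (auto simp: \<beta>_def)
      then show ?thesis using 2 by (intro exI[of _ s] exI[of _ t] exI[of _ "tgt e"] exI[of _ "src e"]) simp
    qed
  qed
  have red: "(\<Sum>e\<in>F. \<psi> e * crossing K e) = (\<Sum>e\<in>T. \<psi> e * crossing K e)"
    using FE by (intro sum.mono_neutral_right) (auto simp: T_def)
  show "(\<Sum>e\<in>F. oriented_circuit G \<alpha> (e, src e, tgt e) * crossing K e) = 0"
  proof (cases "T = {}")
    case True
    then show ?thesis using red by (simp add: \<psi>_def)
  next
    case False
    then obtain e0 where "e0 \<in> T" by blast
    \<comment> \<open>The period starts at a vertex, so that no traversal of an edge is cut by its
      ends.\<close>
    then obtain a x0 where a: "\<beta> a = Vertex x0" using tr by blast
    have "\<exists>s t x y. a \<le> s \<and> s < t \<and> t \<le> a + 1 \<and> \<beta> s = Vertex x \<and> \<beta> t = Vertex y \<and> \<beta> ` {s<..<t} = open_edge G e \<and>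
      of_bool (y \<in> K) - of_bool (x \<in> K) = \<psi> e * crossing K e"
      if e: "e \<in> T" for e
    proof -
      obtain s t x y where 1: "s < t" "t \<le> s + 1" "\<beta> s = Vertex x" "\<beta> t = Vertex y" "\<beta> ` {s<..<t} = open_edge G e"
        "of_bool (y \<in> K) - of_bool (x \<in> K) = \<psi> e * crossing K e"
        using tr[OF e] by blast
      define n where "n = \<lceil>a - s\<rceil>"
      have shift: "\<beta> (z + of_int n) = \<beta> z" for z using beq by blast
      have "\<beta> ` {s + of_int n<..<t + of_int n} = \<beta> ` {s<..<t}"
      proof
        show "\<beta> ` {s + of_int n<..<t + of_int n} \<subseteq> \<beta> ` {s<..<t}"
        proof
          fix p assume "p \<in> \<beta> ` {s + of_int n<..<t + of_int n}"
          then obtain z where z: "z \<in> {s + of_int n<..<t + of_int n}" "p = \<beta> z" by blast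
          have "p = \<beta> (z - of_int n)" using shift[of "z - of_int n"] z(2) by simp
          then show "p \<in> \<beta> ` {s<..<t}" using z(1) by auto
        qed
        show "\<beta> ` {s<..<t} \<subseteq> \<beta> ` {s + of_int n<..<t + of_int n}"
        proof
          fix p assume "p \<in> \<beta> ` {s<..<t}"
          then obtain z where "z \<in> {s<..<t}" "p = \<beta> (z + of_int n)" using shift by auto
          then show "p \<in> \<beta> ` {s + of_int n<..<t + of_int n}" by auto
        qed
      qed
      then have img: "\<beta> ` {s + of_int n<..<t + of_int n} = open_edge G e" using 1(5) by simp
      have an: "a \<le> s + of_int n" "s + of_int n < a + 1" unfolding n_def by linarith+
      have "t + of_int n \<le> a + 1"
      proof (rule ccontr)
        assume "\<not> t + of_int n \<le> a + 1"
        then have "\<beta> (a + 1) \<in> open_edge G e" using an img by auto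
        moreover have "\<beta> (a + 1) = \<beta> a" unfolding beq by (rule exI[of _ 1]) simp
        moreover have "e \<in> E" using e FE by blast
        ultimately show False using a open_edge_eq[of e] by (auto simp: Vertex_epoint_iff)
      qed
      then show ?thesis using 1 an img shift
        by (intro exI[of _ "s + of_int n"] exI[of _ "t + of_int n"] exI[of _ x] exI[of _ y]) simp
    qed
    then obtain s t x y where st: "\<And>e. e \<in> T \<Longrightarrow> a \<le> s e \<and> s e < t e \<and> t e \<le> a + 1 \<and> \<beta> (s e) = Vertex (x e) \<and>
      \<beta> (t e) = Vertex (y e) \<and> \<beta> ` {s e<..<t e} = open_edge G e \<and>
      of_bool (y e \<in> K) - of_bool (x e \<in> K) = \<psi> e * crossing K e"
      by metis
    define h where "h z = height K (\<beta> z)" for z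
    have hc: "continuous_on S h" for S
      using circle_height_continuous[OF c continuous_height[OF FE(1,2) K]] by (simp add: h_def[abs_def] \<beta>_def)
    \<comment> \<open>The parameter clamped to the traversal interval: the correction for
      \<open>e\<close> is 0 before it, the change of height so far during it, and the total change
      afterwards.\<close>
    define cp where "cp e z = max (s e) (min (t e) z)" for e z
    define \<gamma> where "\<gamma> z = h z - (\<Sum>e\<in>T. h (cp e z) - h (s e))" for z
    have cpc: "continuous_on {a..a + 1} (cp e)" for e unfolding cp_def[abs_def] by (intro continuous_intros)
    have gc: "continuous_on {a..a + 1} \<gamma>"
      unfolding \<gamma>_def[abs_def]
      by (intro continuous_intros hc continuous_on_compose2[OF hc[of UNIV] cpc]) auto
    have hs: "h (s e) \<in> \<int>" "h (t e) \<in> \<int>" if "e \<in> T" for e using st[OF that] by (auto simp: h_def)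
    \<comment> \<open>During the traversal of \<open>e\<close> its correction cancels the height up
      to the constant \<open>h (s e)\<close>; at all other times the circle is in a piece, where the
      height is 0 or 1. The remaining corrections are differences of heights of vertices.\<close>
    have gZ: "\<gamma> z \<in> \<int>" if z: "z \<in> {a..a + 1}" for z
    proof -
      have out: "h (cp e z) - h (s e) \<in> \<int>" if e: "e \<in> T" "z \<notin> {s e<..<t e}" for e
      proof -
        have "cp e z = s e \<or> cp e z = t e" using st[OF e(1)] e(2) by (auto simp: cp_def max_def min_def)
        then show ?thesis using hs[OF e(1)] by auto
      qed
      show ?thesis
      proof (cases "\<exists>e\<in>T. z \<in> {s e<..<t e}")
        case True
        then obtain e where e: "e \<in> T" "z \<in> {s e<..<t e}" by blast
        have "z \<notin> {s e'<..<t e'}" if e': "e' \<in> T" "e' \<noteq> e" for e'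
        proof
          assume "z \<in> {s e'<..<t e'}"
          then have "\<beta> z \<in> open_edge G e" "\<beta> z \<in> open_edge G e'" using e e' st by blast+
          moreover have "e \<in> E" "e' \<in> E" using e e' FE by blast+
          ultimately obtain y y' where "\<beta> z = epoint e y" "0 < y" "y < 1" "\<beta> z = epoint e' y'"
            using open_edge_eq[of e] open_edge_eq[of e'] by auto
          then show False using e'(2) epoint_inj[of e y e' y'] by simp
        qed
        then have "(\<Sum>e\<in>T - {e}. h (cp e z) - h (s e)) \<in> \<int>" using out by (intro Ints_sum) auto
        moreover have "cp e z = z" using e by (auto simp: cp_def)
        then have "\<gamma> z = h (s e) - (\<Sum>e\<in>T - {e}. h (cp e z) - h (s e))"
          unfolding \<gamma>_def using sum.remove[OF FE(3) e(1), of "\<lambda>e. h (cp e z) - h (s e)"] by simp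
        ultimately show ?thesis using hs[OF e(1)] by simp
      next
        case False
        have "\<beta> z \<in> points" using circle_continuous[OF c] by (auto simp: continuous_map_def \<beta>_def)
        with FE(1,2) have "h z \<in> \<int>"
        proof (cases rule: points_piece_or_edge)
          case (1 K')
          then show ?thesis using height_piece[OF FE(1,2) K 1] by (simp add: h_def)
        next
          case (2 e t')
          then have eE: "e \<in> E" and zo: "\<beta> z \<in> open_edge G e" using FE open_edge_eq[of e] by auto
          have "\<psi> e \<noteq> 0" using visited_edge_traversed[OF c eE zo[unfolded \<beta>_def]]
            by (auto simp: \<psi>_def oriented_circuit_def simp del: traverses.simps)
          then have eT: "e \<in> T" using 2 by (simp add: T_def)
          then obtain z' where z': "z' \<in> {s e<..<t e}" "\<beta> z = \<beta> z'" using st zo by (metis imageE)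
          then obtain n :: int where n: "z = z' + of_int n" using beq by blast
          have "\<bar>real_of_int n\<bar> < 1" using z z' n st[OF eT] by auto
          then have "z = z'" using n by simp
          then show ?thesis using False eT z' by blast
        qed
        moreover have "(\<Sum>e\<in>T. h (cp e z) - h (s e)) \<in> \<int>" using False out by (intro Ints_sum) auto
        ultimately show ?thesis by (simp add: \<gamma>_def)
      qed
    qed
    have "\<gamma> constant_on {a..a + 1}"
    proof (rule continuous_discrete_range_constant[OF connected_Icc gc])
      fix z assume z: "z \<in> {a..a + 1}"
      have "1 \<le> norm (\<gamma> z' - \<gamma> z)" if "z' \<in> {a..a + 1}" "\<gamma> z' \<noteq> \<gamma> z" for z'
      proof -
        have "\<gamma> z' - \<gamma> z \<in> \<int>" "\<gamma> z' - \<gamma> z \<noteq> 0" using gZ[OF z] gZ[OF that(1)] that(2) by auto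
        then show ?thesis using Ints_nonzero_abs_ge1[of "\<gamma> z' - \<gamma> z"] by simp
      qed
      then show "\<exists>e>0. \<forall>y. y \<in> {a..a + 1} \<and> \<gamma> y \<noteq> \<gamma> z \<longrightarrow> e \<le> norm (\<gamma> y - \<gamma> z)" by (intro exI[of _ 1]) auto
    qed
    then have "\<gamma> a = \<gamma> (a + 1)" unfolding constant_on_def by auto
    moreover have "\<beta> (a + 1) = \<beta> a" unfolding beq by (rule exI[of _ 1]) simp
    then have "h (a + 1) = h a" by (simp add: h_def)
    moreover have "cp e a = s e" "cp e (a + 1) = t e" if "e \<in> T" for e using st[OF that] by (auto simp: cp_def)
    ultimately have "(\<Sum>e\<in>T. h (t e) - h (s e)) = 0" by (simp add: \<gamma>_def)
    moreover have "h (t e) - h (s e) = of_int (\<psi> e * crossing K e)" if "e \<in> T" for e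
    proof -
      have "h (t e) - h (s e) = of_int (of_bool (y e \<in> K) - of_bool (x e \<in> K))"
      proof -
        have "\<beta> (s e) = Vertex (x e)" "\<beta> (t e) = Vertex (y e)" using st[OF that] by blast+
        then show ?thesis by (simp add: h_def)
      qed
      also have "of_bool (y e \<in> K) - of_bool (x e \<in> K) = \<psi> e * crossing K e"
        using st[OF that] by blast
      finally show ?thesis .
    qed
    ultimately have "(\<Sum>e\<in>T. real_of_int (\<psi> e * crossing K e)) = 0" by simp
    then have "(\<Sum>e\<in>T. \<psi> e * crossing K e) = 0"
      by (simp only: of_int_sum[symmetric] of_int_eq_0_iff)
    then show ?thesis using red by (simp add: \<psi>_def)
  qed
qed

end

section \<open>Finite cycles are circles\<close>

text \<open>A walk of least length repeats no vertex, since the part between two visits could be cut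
  out.\<close>

lemma shortest_path:
  assumes "(x, y) \<in> R\<^sup>*"
  obtains n f where "f 0 = x" "f n = y" "\<And>i. i < n \<Longrightarrow> (f i, f (Suc i)) \<in> R" "inj_on f {..n}"
proof -
  define n where "n = (LEAST n. (x, y) \<in> R ^^ n)"
  have "\<exists>n. (x, y) \<in> R ^^ n" using assms by (simp add: rtrancl_power)
  then have "(x, y) \<in> R ^^ n" unfolding n_def by (rule LeastI_ex)
  then obtain f where f: "f 0 = x" "f n = y" "\<forall>i<n. (f i, f (Suc i)) \<in> R" by (auto simp: relpow_fun_conv)
  have seg: "(f i, f j) \<in> R ^^ (j - i)" if "i \<le> j" "j \<le> n" for i j
    unfolding relpow_fun_conv by (rule exI[of _ "\<lambda>l. f (i + l)"]) (use that f in auto)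
  have no: "f i \<noteq> f j" if "i < j" "j \<le> n" for i j
  proof
    assume "f i = f j"
    then have "(x, y) \<in> R ^^ i O R ^^ (n - j)"
      using seg[of 0 i] seg[of j n] that f by (intro relcompI[of x "f i"]) auto
    then have "(x, y) \<in> R ^^ (i + (n - j))" by (simp only: relpow_add)
    then have "n \<le> i + (n - j)" unfolding n_def by (rule Least_le)
    then show False using that by linarith
  qed
  have "inj_on f {..n}" by (rule linorder_inj_onI) (use no in auto)
  then show thesis using that f by blast
qed

context lf_graph
begin

lemma pathin_edge_point:
  assumes e: "e \<in> E" and uv: "endpts G e = {u, v}" shows "pathin (freudenthal G) (edge_point e u v)"
proof -
  have "edge_point e u v t \<in> points" if "t \<in> {0..1}" for t
    using epoint_points[OF e, of t] epoint_points[OF e, of "1 - t"] that by (simp add: edge_point_epoint[OF e uv])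
  moreover have "openin (top_of_set {0..1}) {t \<in> {0..1}. edge_point e u v t \<in> U}" if U: "openin (freudenthal G) U" for U
  proof -
    have o: "open_trace e U" using U e by (simp add: openin_freudenthal_iff)
    show ?thesis
      using o open_trace_reverse[OF o] unfolding edge_point_epoint[OF e uv]
      by (cases "u = src e") (auto simp: open_trace_def edge_trace_def)
  qed
  ultimately show ?thesis by (simp add: pathin_def continuous_map_def)
qed

lemma open_edge_edge_point:
  assumes e: "e \<in> E" and uv: "endpts G e = {u, v}" shows "open_edge G e = edge_point e u v ` {0<..<1}"
proof
  show "edge_point e u v ` {0<..<1} \<subseteq> open_edge G e" 
    using uv unfolding open_edge_def image_subset_iff Ball_def greaterThanLessThan_iff by blast
  show "open_edge G e \<subseteq> edge_point e u v ` {0<..<1}"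
  proof
    fix p assume "p \<in> open_edge G e"
    then obtain t where t: "t \<in> {0<..<1}" "p = epoint e t" using open_edge_eq[OF e] by auto
    have p: "p = edge_point e u v (if u = src e then t else 1 - t)" using t by (simp add: edge_point_epoint[OF e uv])
    show "p \<in> edge_point e u v ` {0<..<1}" unfolding p by (rule imageI) (use t in auto)
  qed
qed

text \<open>The last hypothesis fixes the direction when both points lie on the same edge; with
  opposite directions the parameters would be \<open>t\<close> and \<open>1 - t\<close>.\<close>

lemma edge_point_inj:
  assumes "edge_point e u v t = edge_point e' u' v' t'" "e \<in> E" "endpts G e = {u, v}" "e' \<in> E" "endpts G e' = {u', v'}"
    "0 < t" "t < 1" "e = e' \<Longrightarrow> u = u'"
  shows "e = e' \<and> t = t'"
proof -
  define r where "r = (if u = src e then t else 1 - t)"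
  define r' where "r' = (if u' = src e' then t' else 1 - t')"
  have "epoint e r = edge_point e u v t" "epoint e' r' = edge_point e' u' v' t'"
    by (simp_all add: edge_point_epoint[OF assms(2,3)] edge_point_epoint[OF assms(4,5)] r_def r'_def)
  then have "epoint e r = epoint e' r'" using assms(1) by simp
  moreover have "0 < r" "r < 1" using assms(6,7) by (simp_all add: r_def)
  ultimately have er: "e = e'" "r = r'" using epoint_inj[of e r e' r'] by simp_all
  then have "u = u'" using assms(8) by simp
  then have "t = t'" using er unfolding r_def r'_def by (cases "u = src e") simp_all
  then show ?thesis using er(1) by simp
qed

text \<open>The edges are run through at constant speed, each in time \<open>1 / k\<close>. The case
  \<open>k = 2\<close> is a pair of parallel edges, for which distinct vertices do not imply
  distinct edges.\<close>

lemma cycle_circle: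
  fixes v :: "nat \<Rightarrow> 'v" and f :: "nat \<Rightarrow> 'e"
  assumes k: "2 \<le> k" and v: "inj_on v {..<k}" "v k = v 0" and f: "inj_on f {..<k}"
    and fv: "\<And>i. i < k \<Longrightarrow> f i \<in> E \<and> endpts G (f i) = {v i, v (Suc i)}"
  obtains \<alpha> where "circle G \<alpha>" "\<And>i. i < k \<Longrightarrow> oriented_circuit G \<alpha> (f i, v i, v (Suc i)) = 1"
    "\<And>a. fst a \<notin> f ` {..<k} \<Longrightarrow> oriented_circuit G \<alpha> a = 0"
proof -
  define q where "q i t = edge_point (f i) (v i) (v (Suc i)) t" for i t
  have q0: "q i 0 = Vertex (v i)" and q1: "q i 1 = Vertex (v (Suc i))" for i by (simp_all add: q_def edge_point_def)
  \<comment> \<open>At \<open>x = 1\<close> the floor would select an edge with index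
    \<open>k\<close>; the starting vertex is used instead.\<close>
  define \<alpha> where "\<alpha> x = (if x = 1 then Vertex (v 0) else q (nat \<lfloor>real k * x\<rfloor>) (real k * x - real (nat \<lfloor>real k * x\<rfloor>)))" for x
  have k0: "0 < real k" using k by simp
  \<comment> \<open>This covers the closed interval: at its right end the floor already selects the
    next edge, which starts where this one stops.\<close>
  have seg: "\<alpha> x = q i (real k * x - real i)" if i: "i < k" and x: "real i \<le> real k * x" "real k * x \<le> real (Suc i)" for i x
  proof (cases "real k * x = real (Suc i)")
    case True
    show ?thesis
    proof (cases "Suc i = k")
      case True
      then have "x = 1" using \<open>real k * x = real (Suc i)\<close> k0 by simp
      then have "\<alpha> x = Vertex (v 0)" by (simp add: \<alpha>_def)
      moreover have "real k * x - real i = 1" using \<open>real k * x = real (Suc i)\<close> by simp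
      ultimately show ?thesis using q1[of i] v(2) by (simp only: True)
    next
      case False
      then have "x \<noteq> 1" using True by auto
      moreover have "nat \<lfloor>real k * x\<rfloor> = Suc i" using True by (simp only: floor_of_nat nat_int)
      ultimately have "\<alpha> x = q (Suc i) 0" using True by (simp add: \<alpha>_def)
      then show ?thesis using q0[of "Suc i"] q1[of i] True by simp
    qed
  next
    case False
    then have x': "real k * x < real (Suc i)" using x by simp
    have "\<lfloor>real k * x\<rfloor> = int i" using x(1) x' by linarith
    then have "nat \<lfloor>real k * x\<rfloor> = i" by simp
    moreover have "x \<noteq> 1" using x' i by auto
    ultimately show ?thesis by (simp add: \<alpha>_def)
  qed
  have idx: "\<exists>i<k. real i \<le> real k * x \<and> real k * x < real (Suc i)" if x: "0 \<le> x" "x < 1" for x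
  proof -
    have "0 \<le> real k * x" "real k * x < real k" using x k0 by auto
    then show ?thesis by (intro exI[of _ "nat \<lfloor>real k * x\<rfloor>"]) linarith
  qed
  have a0: "\<alpha> 0 = Vertex (v 0)" using seg[of 0 0] k q0 by simp
  have a1: "\<alpha> 1 = Vertex (v 0)" by (simp add: \<alpha>_def)
  have cont: "pathin (freudenthal G) \<alpha>"
    unfolding pathin_def
  proof (rule pasting_lemma_closed[where I = "{..<k}" and T = "\<lambda>i. {real i / real k..real (Suc i) / real k}"
        and f = "\<lambda>i x. q i (real k * x - real i)"])
    show "finite {..<k}" by simp
    fix i assume i: "i \<in> {..<k}"
    have sub: "{real i / real k..real (Suc i) / real k} \<subseteq> {0..1}" using i k0 by (auto simp: field_simps)
    then show "closedin (top_of_set {0..1}) {real i / real k..real (Suc i) / real k}"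
      by (simp add: closed_subset)
    have top: "subtopology (top_of_set {0..1}) {real i / real k..real (Suc i) / real k} = top_of_set {real i / real k..real (Suc i) / real k}"
      by (simp only: subtopology_subtopology Int_absorb1[OF sub])
    have "continuous_map (top_of_set {real i / real k..real (Suc i) / real k}) (top_of_set {0..1}) (\<lambda>x. real k * x - real i)"
      using k0 by (auto intro!: continuous_intros simp: field_simps)
    from continuous_map_compose[OF this] pathin_edge_point[of "f i" "v i" "v (Suc i)"] fv i
    show "continuous_map (subtopology (top_of_set {0..1}) {real i / real k..real (Suc i) / real k}) (freudenthal G) (\<lambda>x. q i (real k * x - real i))"
      unfolding top by (auto simp: pathin_def o_def q_def)
  next
    fix i j x assume "i \<in> {..<k}" "j \<in> {..<k}"
      and x: "x \<in> topspace (top_of_set {0..1}) \<inter> {real i / real k..real (Suc i) / real k} \<inter> {real j / real k..real (Suc j) / real k}"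
    then have "real i \<le> real k * x" "real k * x \<le> real (Suc i)" "real j \<le> real k * x" "real k * x \<le> real (Suc j)"
      using k0 by (simp_all add: field_simps)
    then show "q i (real k * x - real i) = q j (real k * x - real j)"
      using seg[of i x] seg[of j x] \<open>i \<in> {..<k}\<close> \<open>j \<in> {..<k}\<close> by simp
  next
    fix x assume "x \<in> topspace (top_of_set {0..1::real})"
    then have x: "0 \<le> x" "x \<le> 1" by auto
    have "\<exists>i<k. real i \<le> real k * x \<and> real k * x \<le> real (Suc i)"
    proof (cases "x = 1")
      case True
      then show ?thesis using k by (intro exI[of _ "k - 1"]) auto
    next
      case False
      then show ?thesis using idx[of x] x by (meson less_eq_real_def)
    qed
    then obtain i where i: "i < k" "real i \<le> real k * x" "real k * x \<le> real (Suc i)" by blast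
    then show "\<exists>j. j \<in> {..<k} \<and> x \<in> {real j / real k..real (Suc j) / real k} \<and> \<alpha> x = q j (real k * x - real j)"
      using seg[OF i] k0 by (intro exI[of _ i]) (simp add: field_simps)
  qed
  have inj: "inj_on \<alpha> {0..<1}"
  proof (rule inj_onI)
    fix x y assume xy: "x \<in> {0..<1}" "y \<in> {0..<1}" "\<alpha> x = \<alpha> y"
    obtain i where i: "i < k" "real i \<le> real k * x" "real k * x < real (Suc i)" using idx[of x] xy by auto
    obtain j where j: "j < k" "real j \<le> real k * y" "real k * y < real (Suc j)" using idx[of y] xy by auto
    define t where "t = real k * x - real i"
    define t' where "t' = real k * y - real j"
    have t: "0 \<le> t" "t < 1" "0 \<le> t'" "t' < 1" using i j by (auto simp: t_def t'_def)
    have eq: "q i t = q j t'" using seg[of i x] seg[of j y] i j xy(3) by (simp add: t_def t'_def)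
    have "i = j \<and> t = t'"
    proof (cases "t = 0")
      case True
      then have "q j t' = Vertex (v i)" using eq q0 by simp
      then have "t' = 0" using t by (auto simp: q_def edge_point_def split: if_splits)
      then have "v i = v j" using eq True q0 by simp
      then show ?thesis using v(1) i j True \<open>t' = 0\<close> by (simp add: inj_on_eq_iff)
    next
      case False
      have ff: "f i = f j \<Longrightarrow> i = j" using f i j by (auto simp: inj_on_def)
      have "f i = f j \<and> t = t'"
        by (rule edge_point_inj[of "f i" "v i" "v (Suc i)" t "f j" "v j" "v (Suc j)" t'])
          (use eq fv i j t False ff in \<open>auto simp: q_def\<close>)
      then show ?thesis using ff by simp
    qed
    then have "real k * x = real k * y" by (auto simp: t_def t'_def)
    then show "x = y" using k0 by simp
  qed
  have c: "circle G \<alpha>" unfolding circle_def using cont inj a0 a1 by simp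
  have tr: "traverses G \<alpha> (f i, v i, v (Suc i))" if i: "i < k" for i
  proof -
    define s where "s = real i / real k"
    define t where "t = real (Suc i) / real k"
    have st: "s < t" "t \<le> s + 1" "0 \<le> s" "s < 1" "t \<le> 1" "real k * s = real i" "real k * t = real (Suc i)"
      using i k0 by (auto simp: s_def t_def field_simps)
    have fs: "frac s = s" using st by (simp add: frac_eq)
    have "\<alpha> s = Vertex (v i)" using seg[OF i, of s] st q0 by simp
    then have 1: "\<alpha> (frac s) = Vertex (v i)" using fs by simp
    have "\<alpha> t = Vertex (v (Suc i))" using seg[OF i, of t] st q1 by simp
    moreover have "\<alpha> (frac t) = \<alpha> t"
    proof (cases "t = 1")
      case True
      then show ?thesis using a0 a1 by simp
    next
      case False
      then have "frac t = t" using st by (simp add: frac_eq)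
      then show ?thesis by simp
    qed
    ultimately have 2: "\<alpha> (frac t) = Vertex (v (Suc i))" by simp
    have "(\<lambda>x. \<alpha> (frac x)) ` {s<..<t} = q i ` {0<..<1}"
    proof
      show "(\<lambda>x. \<alpha> (frac x)) ` {s<..<t} \<subseteq> q i ` {0<..<1}"
      proof
        fix p assume "p \<in> (\<lambda>x. \<alpha> (frac x)) ` {s<..<t}"
        then obtain x where x: "s < x" "x < t" "p = \<alpha> (frac x)" by auto
        then have "frac x = x" using st by (simp add: frac_eq)
        moreover have "real i < real k * x" "real k * x < real (Suc i)"
          using x k0 by (auto simp: s_def t_def field_simps)
        ultimately show "p \<in> q i ` {0<..<1}" using x seg[OF i, of x] by auto
      qed
      show "q i ` {0<..<1} \<subseteq> (\<lambda>x. \<alpha> (frac x)) ` {s<..<t}"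
      proof
        fix p assume "p \<in> q i ` {0<..<1}"
        then obtain y where y: "0 < y" "y < 1" "p = q i y" by auto
        define x where "x = (real i + y) / real k"
        have kx: "real k * x = real i + y" using k0 by (simp add: x_def)
        have x: "s < x" "x < t" using y k0 by (auto simp: s_def t_def x_def divide_strict_right_mono)
        then have "frac x = x" using st by (simp add: frac_eq)
        then have "p = \<alpha> (frac x)" using seg[OF i, of x] kx y by simp
        then show "p \<in> (\<lambda>x. \<alpha> (frac x)) ` {s<..<t}" using x by auto
      qed
    qed
    moreover have "q i ` {0<..<1} = open_edge G (f i)"
      using open_edge_edge_point[of "f i" "v i" "v (Suc i)"] fv[OF i] by (simp add: q_def[abs_def])
    moreover have "(f i, v i, v (Suc i)) \<in> oriented_edges G" using fv[OF i] by (simp add: oriented_edges_def)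
    ultimately show ?thesis using st 1 2 unfolding traverses.simps by (intro conjI exI[of _ s] exI[of _ t]) simp_all
  qed
  have zero: "oriented_circuit G \<alpha> a = 0" if a: "fst a \<notin> f ` {..<k}" for a
  proof -
    have no: "\<not> traverses G \<alpha> (fst a, u, w)" for u w
    proof
      assume T: "traverses G \<alpha> (fst a, u, w)"
      then have e: "fst a \<in> E" by (auto simp: oriented_edges_def)
      have "epoint (fst a) (1/2) \<in> open_edge G (fst a)" using open_edge_eq[OF e] by simp
      then obtain x where "\<alpha> (frac x) = epoint (fst a) (1/2)" using T by force
      moreover obtain i where i: "i < k" "real i \<le> real k * frac x" "real k * frac x < real (Suc i)"
        using idx[of "frac x"] frac_ge_0[of x] frac_lt_1[of x] by auto
      ultimately have *: "epoint (fst a) (1/2) = edge_point (f i) (v i) (v (Suc i)) (real k * frac x - real i)"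
        using seg[of i "frac x"] by (simp add: q_def)
      have "f i \<in> E" "endpts G (f i) = {v i, v (Suc i)}" using fv i by auto
      from edge_point_epoint[OF this] obtain r where "epoint (fst a) (1/2) = epoint (f i) r" using * by metis
      then have "fst a = f i" using epoint_inj[of "fst a" "1/2" "f i" r] by simp
      then show False using a i by auto
    qed
    obtain e u w where "a = (e, u, w)" by (cases a)
    then show ?thesis using no[of u w] no[of w u] by (simp add: oriented_circuit_def del: traverses.simps)
  qed
  show thesis
    by (rule that[OF c _ zero]) (simp_all add: oriented_circuit_def tr del: traverses.simps)
qed

section \<open>The oriented cycle space consists of the flows\<close>

text \<open>A shortest path in \<open>G - F\<close> from \<open>x\<close> to \<open>y\<close>,
  closed up by \<open>e\<close>, is a cycle whose only edge in \<open>F\<close> is \<open>e\<close>;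
  it runs through \<open>e\<close> from \<open>y\<close> to \<open>x\<close>.\<close>

lemma path_closes_to_circle:
  assumes F: "F \<subseteq> E" and e: "e \<in> F" "endpts G e = {x, y}" and path: "y \<in> comp_of G F x"
  obtains \<phi> where "\<phi> \<in> oriented_circuits G" "\<phi> (e, y, x) = 1" "\<And>a. fst a \<in> F - {e} \<Longrightarrow> \<phi> a = 0"
proof -
  have eE: "e \<in> E" using e F by blast
  have xy: "x \<noteq> y" using endpts_neq[OF eE e(2)] .
  have "(x, y) \<in> (edge_adj G F)\<^sup>*" using path by (simp add: comp_of_def)
  then obtain n g where g: "g 0 = x" "g n = y" "\<And>i. i < n \<Longrightarrow> (g i, g (Suc i)) \<in> edge_adj G F" "inj_on g {..n}"
    by (rule shortest_path) blast
  have "\<exists>h. h \<in> E - F \<and> endpts G h = {g i, g (Suc i)}" if "i < n" for i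
    using g(3)[OF that] by (auto simp: edge_adj_def)
  then obtain h where h: "\<And>i. i < n \<Longrightarrow> h i \<in> E - F \<and> endpts G (h i) = {g i, g (Suc i)}" by metis
  have n: "1 \<le> n" using g xy by (cases n) auto
  define v where "v i = (if i \<le> n then g i else x)" for i
  define f where "f i = (if i < n then h i else e)" for i
  have ginj: "g i = g j \<longleftrightarrow> i = j" if "i \<le> n" "j \<le> n" for i j using inj_on_eq_iff[OF g(4)] that by auto
  obtain \<alpha> where \<alpha>: "circle G \<alpha>" "\<And>i. i < Suc n \<Longrightarrow> oriented_circuit G \<alpha> (f i, v i, v (Suc i)) = 1"
    "\<And>a. fst a \<notin> f ` {..<Suc n} \<Longrightarrow> oriented_circuit G \<alpha> a = 0"
  proof (rule cycle_circle[of "Suc n" v f])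
    show "2 \<le> Suc n" using n by simp
    show "inj_on v {..<Suc n}" by (rule inj_onI) (use ginj in \<open>auto simp: v_def split: if_splits\<close>)
    show "v (Suc n) = v 0" using g by (simp add: v_def)
    show "inj_on f {..<Suc n}"
    proof (rule linorder_inj_onI)
      fix i j assume ij: "i < j" "i \<in> {..<Suc n}" "j \<in> {..<Suc n}"
      show "f i \<noteq> f j"
      proof (cases "j < n")
        case True
        show ?thesis
        proof
          assume "f i = f j"
          then have "{g i, g (Suc i)} = {g j, g (Suc j)}" using h[of i] h[of j] ij True by (auto simp: f_def)
          then have "g i = g j \<or> g i = g (Suc j)" by blast
          then show False using ginj[of i j] ginj[of i "Suc j"] ij True by auto
        qed
      next
        case False
        then show ?thesis using h[of i] ij e by (auto simp: f_def)
      qed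
    qed auto
    show "f i \<in> E \<and> endpts G (f i) = {v i, v (Suc i)}" if "i < Suc n" for i
    proof (cases "i < n")
      case True
      then show ?thesis using h[OF True] by (auto simp: f_def v_def)
    next
      case False
      then have "i = n" using that by simp
      then show ?thesis using e eE g by (auto simp: f_def v_def insert_commute)
    qed
  qed blast
  have "oriented_circuit G \<alpha> \<in> oriented_circuits G" using \<alpha>(1) by (auto simp: oriented_circuits_def)
  moreover have "oriented_circuit G \<alpha> (e, y, x) = 1" using \<alpha>(2)[of n] g by (simp add: f_def v_def)
  moreover have "oriented_circuit G \<alpha> a = 0" if "fst a \<in> F - {e}" for a
    by (rule \<alpha>(3)) (use that h in \<open>auto simp: f_def split: if_splits\<close>)
  ultimately show thesis using that by blast
qed

lemma circuit_orient: "\<phi> \<in> oriented_circuits G \<Longrightarrow> \<phi> = orient (\<lambda>e. \<phi> (e, src e, tgt e))"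
  using oriented_circuit_orient by (auto simp: oriented_circuits_def)

lemma circuit_flow: "\<phi> \<in> oriented_circuits G \<Longrightarrow> (\<lambda>e. \<phi> (e, src e, tgt e)) \<in> flows"
  using oriented_circuit_flow by (auto simp: oriented_circuits_def)

lemma flows_diff_scale:
  assumes "\<psi> \<in> flows" "\<theta> \<in> flows" shows "(\<lambda>e. \<psi> e - m * \<theta> e) \<in> flows"
proof -
  have "(\<Sum>e\<in>F. (\<psi> e - m * \<theta> e) * crossing K e) =
    (\<Sum>e\<in>F. \<psi> e * crossing K e) - m * (\<Sum>e\<in>F. \<theta> e * crossing K e)"
    for F K by (simp only: sum_distrib_left sum_subtractf[symmetric] left_diff_distrib mult.assoc)
  then show ?thesis using assms unfolding flows_def balanced_def by simp
qed

text \<open>If a flow \<open>\<theta>\<close> vanishes on a finite set \<open>A\<close> of edges but not on \<open>e\<close>, then \<open>e\<close> is not a bridge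
  of \<open>G - A\<close>, since otherwise \<open>\<theta>\<close> would be unbalanced on the finite cut consisting of \<open>e\<close> and edges in \<open>A\<close>.\<close>

lemma flow_reduce:
  assumes \<theta>: "\<theta> \<in> flows" and z: "\<And>e. e \<in> edges_lt n \<Longrightarrow> \<theta> e = 0"
  shows "\<exists>m \<phi>. (m \<noteq> 0 \<longrightarrow> \<phi> \<in> oriented_circuits G \<and> (\<forall>a. fst a \<in> edges_lt n \<longrightarrow> \<phi> a = 0)) \<and>
    (\<forall>e\<in>edges_lt (Suc n). \<theta> e = int m * \<phi> (e, src e, tgt e))"
proof (cases "\<forall>e\<in>edges_lt (Suc n). \<theta> e = 0")
  case True
  then show ?thesis by (intro exI[of _ 0]) simp
next
  case False
  then obtain e where e: "e \<in> edges_lt (Suc n)" "\<theta> e \<noteq> 0" by blast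
  then have eE: "e \<in> E" "to_nat_on E e = n" using z[of e] by (auto simp: edges_lt_def less_Suc_eq)
  have Fe: "edges_lt (Suc n) - {e} = edges_lt n"
  proof -
    have "e' = e" if "e' \<in> E" "to_nat_on E e' = n" for e'
      using that eE inj_on_to_nat_on[OF countable_E] by (auto simp: inj_on_def)
    then have "x \<in> edges_lt (Suc n) - {e} \<longleftrightarrow> x \<in> edges_lt n" for x
      using eE(2) unfolding edges_lt_def by (cases "to_nat_on E x = n") (auto simp: less_Suc_eq)
    then show ?thesis by blast
  qed
  have path: "tgt e \<in> comp_of G (edges_lt (Suc n)) (src e)"
  proof (rule ccontr)
    let ?K = "comp_of G (edges_lt (Suc n)) (src e)"
    assume no: "tgt e \<notin> ?K"
    have "?K \<in> comps G (edges_lt (Suc n))" using comp_of_in_comps[OF src_V[OF eE(1)]] .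
    then have "(\<Sum>e\<in>edges_lt (Suc n). \<theta> e * (of_bool (tgt e \<in> ?K) - of_bool (src e \<in> ?K))) = 0"
      using \<theta> finite_edges_lt edges_lt_subset unfolding flows_def balanced_def by blast
    moreover have "(\<Sum>e\<in>edges_lt (Suc n) - {e}. \<theta> e * (of_bool (tgt e \<in> ?K) - of_bool (src e \<in> ?K))) = 0"
      unfolding Fe using z by simp
    ultimately show False using sum.remove[OF finite_edges_lt e(1), of "\<lambda>e. \<theta> e * (of_bool (tgt e \<in> ?K) - of_bool (src e \<in> ?K))"]
        no e(2) by simp
  qed
  have eo: "endpts G e = {src e, tgt e}" using endpts_eq[OF eE(1)] .
  \<comment> \<open>Directing the circuit by the sign of the flow makes the multiplier a natural
    number, the absolute value of \<open>\<theta> e\<close>, so that it can later count copies of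
    the circuit.\<close>
  have "\<exists>\<phi>. \<phi> \<in> oriented_circuits G \<and> \<phi> (e, src e, tgt e) = sgn (\<theta> e) \<and> (\<forall>a. fst a \<in> edges_lt n \<longrightarrow> \<phi> a = 0)"
  proof (cases "\<theta> e > 0")
    case True
    have "src e \<in> comp_of G (edges_lt (Suc n)) (tgt e)" using comp_of_eqI[OF path] comp_of_self by metis
    moreover have "endpts G e = {tgt e, src e}" using eo by (simp add: insert_commute)
    ultimately obtain \<phi> where "\<phi> \<in> oriented_circuits G" "\<phi> (e, src e, tgt e) = 1" "\<And>a. fst a \<in> edges_lt (Suc n) - {e} \<Longrightarrow> \<phi> a = 0"
      using path_closes_to_circle[OF edges_lt_subset e(1), of "tgt e" "src e"] by blast
    then show ?thesis using True Fe by (intro exI[of _ \<phi>]) auto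
  next
    case False
    obtain \<phi> where p: "\<phi> \<in> oriented_circuits G" "\<phi> (e, tgt e, src e) = 1" "\<And>a. fst a \<in> edges_lt (Suc n) - {e} \<Longrightarrow> \<phi> a = 0"
      using path_closes_to_circle[OF edges_lt_subset e(1) eo path] by blast
    have "\<phi> (e, tgt e, src e) = - \<phi> (e, src e, tgt e)"
      using fun_cong[OF circuit_orient[OF p(1)], of "(e, tgt e, src e)"] eE(1) src_neq_tgt[OF eE(1)]
      unfolding orient_apply by metis
    then have "\<phi> (e, src e, tgt e) = sgn (\<theta> e)" using p(2) False e(2) by (simp add: sgn_if)
    then show ?thesis using p Fe by (intro exI[of _ \<phi>]) auto
  qed
  then obtain \<phi> where \<phi>: "\<phi> \<in> oriented_circuits G" "\<phi> (e, src e, tgt e) = sgn (\<theta> e)" "\<forall>a. fst a \<in> edges_lt n \<longrightarrow> \<phi> a = 0" by blast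
  have "\<theta> e' = int (nat \<bar>\<theta> e\<bar>) * \<phi> (e', src e', tgt e')" if "e' \<in> edges_lt (Suc n)" for e'
  proof (cases "e' = e")
    case True
    then show ?thesis using \<phi>(2) by (simp add: abs_mult_sgn)
  next
    case False
    then have "e' \<in> edges_lt n" using that Fe by blast
    then show ?thesis using z \<phi>(3) by simp
  qed
  then show ?thesis using \<phi> by blast
qed

text \<open>A circuit used at stage \<open>n\<close> avoids the edges numbered below
  \<open>n\<close>, so every edge meets finitely many stages. The remainder at stage
  \<open>N\<close> vanishes on \<open>edges_lt N\<close>, so on each edge the subtracted multiples
  add up to the flow.\<close>

lemma flow_thin_sum:
  assumes \<psi>: "\<psi> \<in> flows" shows "orient \<psi> \<in> carrier (oriented_cycle_space G)"
proof -
  \<comment> \<open>At a stage with \<open>m = 0\<close> there may be no suitable circuit, and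
    \<open>\<phi>\<close> is left arbitrary.\<close>
  let ?Q = "\<lambda>n \<theta> \<theta>'. \<exists>m \<phi>. (m \<noteq> 0 \<longrightarrow> \<phi> \<in> oriented_circuits G \<and> (\<forall>a. fst a \<in> edges_lt n \<longrightarrow> \<phi> a = 0)) \<and>
    (\<forall>e. \<theta>' e = \<theta> e - int m * \<phi> (e, src e, tgt e))"
  have "\<exists>\<theta>. \<forall>n. (\<theta> n \<in> flows \<and> (\<forall>e\<in>edges_lt n. \<theta> n e = 0) \<and> (n = 0 \<longrightarrow> \<theta> n = \<psi>)) \<and> ?Q n (\<theta> n) (\<theta> (Suc n))"
  proof (rule dependent_nat_choice)
    show "\<exists>\<theta>. \<theta> \<in> flows \<and> (\<forall>e\<in>edges_lt 0. \<theta> e = 0) \<and> (0 = (0::nat) \<longrightarrow> \<theta> = \<psi>)" using \<psi> by auto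
    fix \<theta> n assume th: "\<theta> \<in> flows \<and> (\<forall>e\<in>edges_lt n. \<theta> e = 0) \<and> (n = 0 \<longrightarrow> \<theta> = \<psi>)"
    obtain m \<phi> where m: "m \<noteq> 0 \<longrightarrow> \<phi> \<in> oriented_circuits G \<and> (\<forall>a. fst a \<in> edges_lt n \<longrightarrow> \<phi> a = 0)"
      "\<forall>e\<in>edges_lt (Suc n). \<theta> e = int m * \<phi> (e, src e, tgt e)"
      using flow_reduce[of \<theta> n] th by blast
    define \<theta>' where "\<theta>' e = \<theta> e - int m * \<phi> (e, src e, tgt e)" for e
    have "\<theta>' \<in> flows"
    proof (cases "m = 0")
      case True
      then show ?thesis using th by (simp add: \<theta>'_def[abs_def])
    next
      case False
      then show ?thesis unfolding \<theta>'_def[abs_def] using m th by (intro flows_diff_scale circuit_flow) auto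
    qed
    moreover have "\<forall>e\<in>edges_lt (Suc n). \<theta>' e = 0" using m(2) by (simp add: \<theta>'_def)
    moreover have "?Q n \<theta> \<theta>'" using m(1) \<theta>'_def by blast
    ultimately show "\<exists>\<theta>'. (\<theta>' \<in> flows \<and> (\<forall>e\<in>edges_lt (Suc n). \<theta>' e = 0) \<and> (Suc n = 0 \<longrightarrow> \<theta>' = \<psi>)) \<and> ?Q n \<theta> \<theta>'"
      by blast
  qed
  then obtain \<theta> where T: "\<forall>n. (\<theta> n \<in> flows \<and> (\<forall>e\<in>edges_lt n. \<theta> n e = 0) \<and> (n = 0 \<longrightarrow> \<theta> n = \<psi>)) \<and> ?Q n (\<theta> n) (\<theta> (Suc n))"
    by (rule exE)
  have \<theta>: "\<theta> 0 = \<psi>" using T by simp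
  have \<theta>0: "\<theta> n e = 0" if "e \<in> edges_lt n" for n e using T that by simp
  have "\<forall>n. ?Q n (\<theta> n) (\<theta> (Suc n))" by (rule allI) (rule T[THEN spec, THEN conjunct2])
  from choice[OF this] obtain m where "\<forall>n. \<exists>\<phi>. (m n \<noteq> 0 \<longrightarrow> \<phi> \<in> oriented_circuits G \<and> (\<forall>a. fst a \<in> edges_lt n \<longrightarrow> \<phi> a = 0)) \<and>
    (\<forall>e. \<theta> (Suc n) e = \<theta> n e - int (m n) * \<phi> (e, src e, tgt e))" by (rule exE)
  from choice[OF this] obtain \<phi> where M: "\<forall>n. (m n \<noteq> 0 \<longrightarrow> \<phi> n \<in> oriented_circuits G \<and> (\<forall>a. fst a \<in> edges_lt n \<longrightarrow> \<phi> n a = 0)) \<and>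
    (\<forall>e. \<theta> (Suc n) e = \<theta> n e - int (m n) * \<phi> n (e, src e, tgt e))" by (rule exE)
  have m: "m n \<noteq> 0 \<Longrightarrow> \<phi> n \<in> oriented_circuits G" "m n \<noteq> 0 \<Longrightarrow> fst a \<in> edges_lt n \<Longrightarrow> \<phi> n a = 0"
    "\<theta> (Suc n) e = \<theta> n e - int (m n) * \<phi> n (e, src e, tgt e)" for n a e
    using M[THEN spec, of n] by blast+
  \<comment> \<open>Thin sums have no coefficients, so the multiple \<open>m n\<close> is expressed
    by \<open>m n\<close> copies of the circuit, indexed by pairs.\<close>
  define I where "I = Sigma UNIV (\<lambda>n. {..<m n})"
  define \<Phi> where "\<Phi> p = \<phi> (fst p)" for p :: "nat \<times> nat"
  have circ: "\<Phi> ` I \<subseteq> oriented_circuits G"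
  proof
    fix f assume "f \<in> \<Phi> ` I"
    then obtain n i where "i < m n" "f = \<phi> n" by (auto simp: I_def \<Phi>_def)
    then show "f \<in> oriented_circuits G" using m(1)[of n] by simp
  qed
  have tel: "\<psi> e = (\<Sum>n<N. int (m n) * \<phi> n (e, src e, tgt e)) + \<theta> N e" for e N
    by (induction N) (simp_all add: \<theta> m(3))
  have sub: "{p \<in> I. \<Phi> p a \<noteq> 0} \<subseteq> Sigma {..<N} (\<lambda>n. {..<m n})" if a: "fst a \<in> edges_lt N" for a N
  proof
    fix p assume p: "p \<in> {p \<in> I. \<Phi> p a \<noteq> 0}"
    then have mn: "snd p < m (fst p)" "\<phi> (fst p) a \<noteq> 0" by (auto simp: I_def \<Phi>_def)
    have "fst p < N"
    proof (rule ccontr)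
      assume "\<not> fst p < N"
      then have "fst a \<in> edges_lt (fst p)" using a edges_lt_mono[of N "fst p"] by auto
      then show False using m(2)[of "fst p" a] mn by simp
    qed
    then show "p \<in> Sigma {..<N} (\<lambda>n. {..<m n})" using mn by (cases p) auto
  qed
  have inF: "fst a \<in> edges_lt (Suc (to_nat_on E (fst a)))" if "a \<in> oriented_edges G" for a
    using that by (auto simp: oriented_edges_def edges_lt_def)
  have thin: "thin_family G I \<Phi>"
    unfolding thin_family_def
  proof
    fix a assume "a \<in> oriented_edges G"
    from sub[OF inF[OF this]] show "finite {p \<in> I. \<Phi> p a \<noteq> 0}" by (rule finite_subset) simp
  qed
  have "thin_sum I \<Phi> a = orient \<psi> a" for a :: "'e \<times> 'v \<times> 'v"
  proof (cases "a \<in> oriented_edges G")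
    case False
    have "\<Phi> p a = 0" if "p \<in> I" for p
      using circ that oriented_circuit_outside[OF False] by (fastforce simp: oriented_circuits_def)
    then have "thin_sum I \<Phi> a = 0" unfolding thin_sum_def by (intro sum.neutral) auto
    moreover obtain e u v where a: "a = (e, u, v)" by (cases a)
    have neg: "\<not> (e \<in> E \<and> u = src e \<and> v = tgt e)" "\<not> (e \<in> E \<and> u = tgt e \<and> v = src e)"
      using False endpts_eq[of e] unfolding a oriented_edges_def by blast+
    have "orient \<psi> a = 0" unfolding a orient_apply if_not_P[OF neg(1)] if_not_P[OF neg(2)] ..
    ultimately show ?thesis by simp
  next
    case True
    define N where "N = Suc (to_nat_on E (fst a))"
    have aN: "fst a \<in> edges_lt N" using inF[OF True] by (simp add: N_def)
    have "thin_sum I \<Phi> a = (\<Sum>p\<in>Sigma {..<N} (\<lambda>n. {..<m n}). \<Phi> p a)"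
      unfolding thin_sum_def using sub[OF aN] by (intro sum.mono_neutral_left) (auto simp: I_def)
    also have "\<dots> = (\<Sum>(n, i)\<in>Sigma {..<N} (\<lambda>n. {..<m n}). \<phi> n a)"
      by (rule sum.cong) (auto simp: \<Phi>_def)
    also have "\<dots> = (\<Sum>n<N. \<Sum>i<m n. \<phi> n a)" by (rule sum.Sigma[symmetric]) auto
    also have "\<dots> = (\<Sum>n<N. int (m n) * \<phi> n a)" by simp
    finally have ts: "thin_sum I \<Phi> a = (\<Sum>n<N. int (m n) * \<phi> n a)" .
    obtain e u v where a: "a = (e, u, v)" by (cases a)
    have e: "e \<in> E" "endpts G e = {u, v}" using True by (auto simp: a oriented_edges_def)
    have \<psi>e: "\<psi> e = (\<Sum>n<N. int (m n) * \<phi> n (e, src e, tgt e))" using tel[of e N] \<theta>0[of e N] aN by (simp add: a)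
    from e show ?thesis
    proof (cases rule: src_tgt_cases)
      case 1
      then show ?thesis using ts \<psi>e orient_at[OF e(1), of \<psi>] by (simp add: a)
    next
      case 2
      have rev: "orient f (e, tgt e, src e) = - f e" for f
        using e(1) src_neq_tgt[OF e(1)] unfolding orient_apply by metis
      have "int (m n) * \<phi> n a = - (int (m n) * \<phi> n (e, src e, tgt e))" for n
      proof (cases "m n = 0")
        case False
        then show ?thesis
          using fun_cong[OF circuit_orient[OF m(1)[OF False]], of "(e, tgt e, src e)"] rev by (simp add: a 2)
      qed simp
      then show ?thesis using ts \<psi>e rev[of \<psi>] by (simp add: a 2 sum_negf)
    qed
  qed
  then have "orient \<psi> = thin_sum I \<Phi>" by (simp add: fun_eq_iff)
  \<comment> \<open>The pairs are replaced by natural numbers as indices.\<close>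
  then show ?thesis using thin_sum_in_oriented_cycle_space[OF lm con lf circ thin] by simp
qed

text \<open>Only the finitely many circuits in \<open>J\<close> use edges of \<open>F\<close>, so on
  \<open>F\<close> the thin sum is finite and the balance of its terms carries over.\<close>

lemma thin_sum_flow:
  fixes \<phi> :: "'i \<Rightarrow> 'e \<times> 'v \<times> 'v \<Rightarrow> int"
  assumes circ: "\<phi> ` I \<subseteq> oriented_circuits G" and thin: "thin_family G I \<phi>"
  shows "thin_sum I \<phi> \<in> orient ` flows"
proof
  define \<psi> where "\<psi> e = thin_sum I \<phi> (e, src e, tgt e)" for e
  have c: "\<phi> i \<in> oriented_circuits G" if "i \<in> I" for i using circ that by blast
  have rev: "orient f (e, tgt e, src e) = - f e" if "e \<in> E" for f e
    using that src_neq_tgt[OF that] unfolding orient_apply by metis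
  show "thin_sum I \<phi> = orient \<psi>"
  proof
    fix a :: "'e \<times> 'v \<times> 'v"
    obtain e u v where a: "a = (e, u, v)" by (cases a)
    consider "e \<in> E" "u = src e" "v = tgt e" | "e \<in> E" "u = tgt e" "v = src e" | "\<not> (e \<in> E \<and> u = src e \<and> v = tgt e)" "\<not> (e \<in> E \<and> u = tgt e \<and> v = src e)"
      by blast
    then show "thin_sum I \<phi> a = orient \<psi> a"
    proof cases
      case 1
      then show ?thesis using orient_at[OF 1(1), of \<psi>] by (simp add: a \<psi>_def)
    next
      case 2
      have eq: "\<phi> i a = - \<phi> i (e, src e, tgt e)" if "i \<in> I" for i
        using fun_cong[OF circuit_orient[OF c[OF that]], of a] rev[OF 2(1)] by (simp add: a 2)
      have "thin_sum I \<phi> a = (\<Sum>i\<in>{i \<in> I. \<phi> i (e, src e, tgt e) \<noteq> 0}. - \<phi> i (e, src e, tgt e))"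
        unfolding thin_sum_def using eq by (intro sum.cong) auto
      then show ?thesis using rev[OF 2(1), of \<psi>] by (simp add: a 2 \<psi>_def thin_sum_def sum_negf)
    next
      case 3
      have "orient f a = 0" for f unfolding a orient_apply if_not_P[OF 3(1)] if_not_P[OF 3(2)] ..
      moreover from this have "\<phi> i a = 0" if "i \<in> I" for i using circuit_orient[OF c[OF that]] by metis
      then have "thin_sum I \<phi> a = 0" unfolding thin_sum_def by (intro sum.neutral) auto
      ultimately show ?thesis by simp
    qed
  qed
  show "\<psi> \<in> flows"
    unfolding flows_def balanced_def
  proof (intro CollectI allI impI ballI)
    fix F K assume F: "finite F \<and> F \<subseteq> E" and K: "K \<in> comps G F"
    define J where "J = (\<Union>e\<in>F. {i \<in> I. \<phi> i (e, src e, tgt e) \<noteq> 0})"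
    have "(e, src e, tgt e) \<in> oriented_edges G" if "e \<in> F" for e
      using that F endpts_eq[of e] by (auto simp: oriented_edges_def)
    then have J: "finite J" using F thin by (auto simp: J_def thin_family_def)
    have JI: "J \<subseteq> I" by (auto simp: J_def)
    have eq: "\<psi> e = (\<Sum>i\<in>J. \<phi> i (e, src e, tgt e))" if "e \<in> F" for e
      unfolding \<psi>_def thin_sum_def using J that by (intro sum.mono_neutral_left) (auto simp: J_def)
    have "(\<Sum>e\<in>F. \<psi> e * crossing K e) =
      (\<Sum>e\<in>F. \<Sum>i\<in>J. \<phi> i (e, src e, tgt e) * crossing K e)"
      using eq by (intro sum.cong) (simp_all add: sum_distrib_right)
    also have "\<dots> = (\<Sum>i\<in>J. \<Sum>e\<in>F. \<phi> i (e, src e, tgt e) * crossing K e)"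
      by (rule sum.swap)
    also have "\<dots> = 0"
    proof (rule sum.neutral, rule ballI)
      fix i assume "i \<in> J"
      then have "(\<lambda>e. \<phi> i (e, src e, tgt e)) \<in> flows" using JI c circuit_flow by blast
      then show "(\<Sum>e\<in>F. \<phi> i (e, src e, tgt e) * crossing K e) = 0"
        using F K unfolding flows_def balanced_def by blast
    qed
    finally show "(\<Sum>e\<in>F. \<psi> e * crossing K e) = 0" .
  qed
qed

lemma carrier_oriented_cycle_space: "carrier (oriented_cycle_space G) = orient ` flows"
proof
  show "orient ` flows \<subseteq> carrier (oriented_cycle_space G)" using flow_thin_sum by blast
  show "carrier (oriented_cycle_space G) \<subseteq> orient ` flows"
    using thin_sum_flow by (auto simp: oriented_cycle_space_def)
qed

end

theorem theorem8:
  fixes G :: "('v, 'e) multigraph"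
  assumes "loopless_multigraph G" and "connected_graph G" and "locally_finite_graph G"
  shows "cech_homology 1 (freudenthal G) \<cong> oriented_cycle_space G"
proof -
  interpret lf_graph G by unfold_locales (fact assms)+
  show ?thesis by (rule cech_iso_flows[OF carrier_oriented_cycle_space])
qed

end
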